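(* Let $n$ be a positive integer and let $\mathcal{N}\to\mathcal{G}_3$ be an $n$-fold covering over $\mathcal{G}_3$ (with $\mathcal{N}$ connected). If $n$ is not divisible by $3$, then $\mathcal{N}$ is homeomorphic to $\mathcal{G}_3$. If $n$ is divisible by $3$, then $\mathcal{N}$ is homeomorphic to either $\mathcal{G}_3$ or $\mathcal{G}_1$. The corresponding numbers of nonequivalent coverings are given by $$(i)\quad c_{\pi_1(\mathcal{G}_3),\pi_1(\mathcal{G}_3)}(n)=\sum_{k\mid n}\theta(k)+\sum_{k\mid\frac{n}{3}}\theta(k)-2\sum_{k\mid\frac{n}{9}}\theta(k),$$ $$(ii)\quad c_{\mathbb{Z}^3,\pi_1(\mathcal{G}_3)}(n)=\frac{1}{3}\Big(\omega\!\left(\frac{n}{3}\right)+2\sum_{k\mid\frac{n}{3}}\theta(k)+4\sum_{k\mid\frac{n}{9}}\theta(k)\Big).$$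
   Context: $\mathcal{G}_1$ is the 3-torus, with $\pi_1(\mathcal{G}_1)\cong\mathbb{Z}^3$. $\mathcal{G}_3$ is the closed orientable flat (Euclidean) 3-manifold with $H_1(\mathcal{G}_3)=\mathbb{Z}_3\times\mathbb{Z}$; its fundamental group is $$\pi_1(\mathcal{G}_3)=\langle x,y,z : xyx^{-1}y^{-1}=1,\ zxz^{-1}=y,\ zyz^{-1}=(xy)^{-1}\rangle.$$ Two coverings $p_1:\mathcal{M}_1\to\mathcal{M}$ and $p_2:\mathcal{M}_2\to\mathcal{M}$ are equivalent if there is a homeomorphism $h:\mathcal{M}_1\to\mathcal{M}_2$ with $p_1=p_2\circ h$. Equivalence classes of connected $n$-fold coverings of $\mathcal{M}$ correspond bijectively to conjugacy classes of subgroups of index $n$ in $\pi_1(\mathcal{M})$. For groups $H,G$, $c_{H,G}(n)$ denotes the number of conjugacy classes (in $G$) of subgroups of index $n$ in $G$ that are isomorphic to $H$; thus $c_{H,\pi_1(\mathcal{M})}(n)$ is the number of nonequivalent connected $n$-fold coverings of $\mathcal{M}$ whose total space has fundamental group isomorphic to $H$. In (i) the total space is $\mathcal{G}_3$, in (ii) it is $\mathcal{G}_1$. Arithmetic functions, for a positive integer $n$: $\sigma_1(n)=\sum_{k\mid n}k$, $\omega(n)=\sum_{k\mid n}k\,\sigma_1(k)$, and $\theta(n)=\sum_{k\mid n}\left(\frac{k}{3}\right)$, where $\left(\frac{k}{3}\right)$ is the Legendre symbol ($1,-1,0$ for $k\equiv 1,2,0 \bmod 3$). All sums are over positive divisors.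 Each of these functions is taken to be $0$ at arguments that are not positive integers, and a sum over $k\mid m$ is $0$ if $m$ is not a positive integer. *)

theory Defs
  imports
    "HOL-Analysis.Analysis"
    "HOL-Algebra.Elementary_Groups"
    "HOL-Algebra.Bij"
    "HOL-Number_Theory.Residues"
begin

text \<open>The analogue for abstract topologies of the library predicate \<^const>\<open>covering_space\<close>.\<close>

definition covering_map :: "'a topology \<Rightarrow> 'b topology \<Rightarrow> ('a \<Rightarrow> 'b) \<Rightarrow> bool" where
  "covering_map N M p \<longleftrightarrow>
     continuous_map N M p \<and> p ` topspace N = topspace M \<and>
     (\<forall>x \<in> topspace M. \<exists>T. x \<in> T \<and> openin M T \<and>
        (\<exists>\<V>. \<Union>\<V> = {y \<in> topspace N. p y \<in> T} \<and>
             (\<forall>U \<in> \<V>. openin N U) \<and>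
             pairwise disjnt \<V> \<and>
             (\<forall>U \<in> \<V>. homeomorphic_map (subtopology N U) (subtopology M T) p)))"

text \<open>To be used with \<open>n > 0\<close> only, since \<^const>\<open>card\<close> is \<open>0\<close> on infinite fibres.\<close>

definition connected_covering :: "nat \<Rightarrow> 'a topology \<Rightarrow> 'b topology \<Rightarrow> ('a \<Rightarrow> 'b) \<Rightarrow> bool" where
  "connected_covering n N M p \<longleftrightarrow>
     connected_space N \<and> covering_map N M p \<and>
     (\<forall>x \<in> topspace M. card {y \<in> topspace N. p y = x} = n)"

definition equivalent_coverings ::
    "'a topology \<times> ('a \<Rightarrow> 'c) \<Rightarrow> 'b topology \<times> ('b \<Rightarrow> 'c) \<Rightarrow> bool" where
  "equivalent_coverings c1 c2 \<longleftrightarrow>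
     (\<exists>h. homeomorphic_map (fst c1) (fst c2) h \<and>
          (\<forall>y \<in> topspace (fst c1). snd c1 y = snd c2 (h y)))"

text \<open>HOL cannot quantify over all total spaces at once: here their points are drawn from the fixed
  type \<open>'a\<close>, which has to be large enough.\<close>

definition covering_classes ::
    "nat \<Rightarrow> 'c topology \<Rightarrow> 'b topology \<Rightarrow> ('a topology \<times> ('a \<Rightarrow> 'b)) set set" where
  "covering_classes n F M =
     {(N, p). connected_covering n N M p \<and> N homeomorphic_space F}
       // {(c1, c2). equivalent_coverings c1 c2}"

definition orbit_of :: "('a \<Rightarrow> 'a) set \<Rightarrow> 'a \<Rightarrow> 'a set" where
  "orbit_of \<Gamma> v = (\<lambda>g. g v) ` \<Gamma>"

definition orbit_space :: "('a::topological_space \<Rightarrow> 'a) set \<Rightarrow> 'a set topology" where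
  "orbit_space \<Gamma> = topology (\<lambda>U. U \<subseteq> range (orbit_of \<Gamma>) \<and> open (orbit_of \<Gamma> -` U))"

lemma openin_orbit_space:
  "openin (orbit_space \<Gamma>) U \<longleftrightarrow> U \<subseteq> range (orbit_of \<Gamma>) \<and> open (orbit_of \<Gamma> -` U)"
proof -
  have "istopology (\<lambda>U. U \<subseteq> range (orbit_of \<Gamma>) \<and> open (orbit_of \<Gamma> -` U))"
    unfolding istopology_def by (auto simp: vimage_Union intro!: open_Int)
  then show ?thesis
    by (simp add: orbit_space_def topology_inverse')
qed

lemma topspace_orbit_space: "topspace (orbit_space \<Gamma>) = range (orbit_of \<Gamma>)"
proof -
  have "orbit_of \<Gamma> -` range (orbit_of \<Gamma>) = UNIV"
    by auto
  then have "openin (orbit_space \<Gamma>) (range (orbit_of \<Gamma>))"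
    by (simp only: openin_orbit_space) auto
  then show ?thesis
    by (metis openin_orbit_space openin_subset openin_topspace subset_antisym)
qed

lemma quotient_map_orbit_space: "quotient_map euclidean (orbit_space \<Gamma>) (orbit_of \<Gamma>)"
  by (auto simp: quotient_map_def topspace_orbit_space openin_orbit_space vimage_def)

text \<open>Euclidean 3-space is taken to be \<open>\<complex> \<times> \<real>\<close>.  The orientable flat manifold \<open>\<G>\<^sub>3\<close> with first
  homology \<open>\<int>\<^sub>3 \<times> \<int>\<close> is its quotient by the group generated by two horizontal translations of
  equal length at angle \<open>2\<pi>/3\<close> and a vertical screw motion of angle \<open>2\<pi>/3\<close>.  The three isometries
  satisfy the relations \<open>xyx\<^sup>-\<^sup>1y\<^sup>-\<^sup>1 = 1\<close>, \<open>zxz\<^sup>-\<^sup>1 = y\<close>, \<open>zyz\<^sup>-\<^sup>1 = (xy)\<^sup>-\<^sup>1\<close>.\<close>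

type_synonym E3 = "complex \<times> real"

definition G3_x :: "E3 \<Rightarrow> E3" where "G3_x = (\<lambda>(w, t). (w + 1, t))"
definition G3_y :: "E3 \<Rightarrow> E3" where "G3_y = (\<lambda>(w, t). (w + cis (2 * pi / 3), t))"
definition G3_z :: "E3 \<Rightarrow> E3" where "G3_z = (\<lambda>(w, t). (cis (2 * pi / 3) * w, t + 1))"

definition manifold_G3 :: "E3 set topology" where
  "manifold_G3 = orbit_space (generate (BijGroup UNIV) {G3_x, G3_y, G3_z})"

definition manifold_G1 :: "(complex \<times> complex \<times> complex) topology" where
  "manifold_G1 = top_of_set (sphere 0 1 \<times> sphere 0 1 \<times> sphere 0 1)"

text \<open>Words in generators and their formal inverses: \<open>(g, True)\<close> stands for \<open>g\<close> and
  \<open>(g, False)\<close> for \<open>g\<^sup>-\<^sup>1\<close>.\<close>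

type_synonym 'g word = "('g \<times> bool) list"

inductive word_equiv :: "('g word \<times> 'g word) set \<Rightarrow> 'g word \<Rightarrow> 'g word \<Rightarrow> bool"
  for R where
  refl: "word_equiv R u u"
| sym: "word_equiv R u v \<Longrightarrow> word_equiv R v u"
| trans: "word_equiv R u v \<Longrightarrow> word_equiv R v w \<Longrightarrow> word_equiv R u w"
| cancel: "word_equiv R (u @ [(g, b), (g, \<not> b)] @ v) (u @ v)"
| relation: "(l, r) \<in> R \<Longrightarrow> word_equiv R (u @ l @ v) (u @ r @ v)"

definition presented_group :: "('g word \<times> 'g word) set \<Rightarrow> 'g word set monoid" where
  "presented_group R =
     \<lparr>carrier = UNIV // {(u, v). word_equiv R u v},
      monoid.mult = (\<lambda>A B. {w. \<exists>a \<in> A. \<exists>b \<in> B. word_equiv R (a @ b) w}),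
      one = {w. word_equiv R [] w}\<rparr>"

datatype gen = X | Y | Z

definition pi1_G3 :: "gen word set monoid" where
  "pi1_G3 = presented_group
     {([(X, True), (Y, True), (X, False), (Y, False)], []),
      ([(Z, True), (X, True), (Z, False)], [(Y, True)]),
      ([(Z, True), (Y, True), (Z, False)], [(Y, False), (X, False)])}"

definition int_cubed :: "(int \<times> int \<times> int) monoid" where
  "int_cubed = integer_group \<times>\<times> integer_group \<times>\<times> integer_group"

text \<open>For \<open>n > 0\<close> the cardinality condition forces the index to be finite.\<close>

definition subgroup_classes ::
    "('h, 'm) monoid_scheme \<Rightarrow> ('g, 'k) monoid_scheme \<Rightarrow> nat \<Rightarrow> 'g set set set" where
  "subgroup_classes H G n =
     {K. subgroup K G \<and> card (rcosets\<^bsub>G\<^esub> K) = n \<and> G\<lparr>carrier := K\<rparr> \<cong> H}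
       // {(K, L). \<exists>g \<in> carrier G. L = g <#\<^bsub>G\<^esub> K #>\<^bsub>G\<^esub> inv\<^bsub>G\<^esub> g}"

definition num_subgroup_classes ::
    "('h, 'm) monoid_scheme \<Rightarrow> ('g, 'k) monoid_scheme \<Rightarrow> nat \<Rightarrow> nat" where
  "num_subgroup_classes H G n = card (subgroup_classes H G n)"

text \<open>Rational arguments make expressions such as \<open>\<omega> (n / 3)\<close> literal: there are no divisors, and
  hence all functions vanish, unless the argument is a positive integer.\<close>

definition pos_divisors :: "rat \<Rightarrow> nat set" where
  "pos_divisors q = {k. \<exists>m::nat. m > 0 \<and> q = of_nat m \<and> k dvd m}"

definition sigma1 :: "rat \<Rightarrow> rat" where
  "sigma1 q = (\<Sum>k \<in> pos_divisors q. of_nat k)"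

definition omega :: "rat \<Rightarrow> rat" where
  "omega q = (\<Sum>k \<in> pos_divisors q. of_nat k * sigma1 (of_nat k))"

definition theta :: "rat \<Rightarrow> rat" where
  "theta q = (\<Sum>k \<in> pos_divisors q. of_int (Legendre (int k) 3))"

end

theory Submission
  imports Defs "HOL-Number_Theory.Residue_Primitive_Roots" "HOL-Computational_Algebra.Nth_Powers"
begin

text \<open>Every continuous map from Euclidean space lifts through a covering map, so the connected
  coverings of the quotient of Euclidean space by a group \<open>\<Gamma>\<close> acting freely, with displacement
  bounded below, are up to equivalence the orbit spaces of the subgroups of \<open>\<Gamma>\<close>, and equivalence
  of coverings is conjugacy in \<open>\<Gamma>\<close>.

  The group of \<open>\<G>\<^sub>3\<close> is the semidirect product of the Eisenstein integers \<open>E\<close>, horizontal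
  translations, with \<open>\<int>\<close>, the generator of which acts as multiplication by \<open>\<omega> = e\<^bsup>2\<pi>i/3\<^esup>\<close>.  A subgroup
  of finite index amounts to its height \<open>l > 0\<close>, a sublattice \<open>\<Lambda>\<close> of \<open>E\<close>, invariant under \<open>\<omega>\<^sup>l\<close>, and a
  coset \<open>C\<close> of \<open>\<Lambda>\<close>; the index is \<open>l \<cdot> [E : \<Lambda>]\<close>.  If \<open>3\<close> divides \<open>l\<close>, the subgroup is a lattice of translations,
  its orbit space is a torus, and conjugation only permutes the pairs \<open>(\<Lambda>, C)\<close> by multiplication by
  \<open>\<omega>\<close>, so that the orbits of a permutation of order \<open>3\<close> have to be counted.  Otherwise \<open>\<Lambda>\<close> is an
  ideal \<open>\<alpha>E\<close>, an affine change of coordinates conjugates the subgroup to the whole group, and the class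
  is determined by \<open>l\<close>, \<open>\<Lambda>\<close> and the image of \<open>C\<close> in \<open>E / (1 - \<omega>) = \<int>/3\<close>.

  Ideals of index \<open>k\<close> correspond to triples \<open>d, m, s\<close> with \<open>k = d\<^sup>2m\<close>, \<open>0 \<le> s < m\<close> and \<open>m\<close> dividing
  \<open>s\<^sup>2 - s + 1\<close>; both their number and \<open>\<theta>(k)\<close> are multiplicative in \<open>k\<close> and agree on prime powers.\<close>

section \<open>Lifting through covering maps\<close>

text \<open>In both counts an ideal \<Lambda> of index \<open>k\<close> carries the weight 3 if 3
  divides \<open>k\<close> and 1 otherwise. For heights prime to 3 the weight is the order of the
  cokernel of \<open>1 - om\<close> on \<open>Eis\<close> modulo \<Lambda>; for heights divisible by
  3 it is the number of cosets fixed by \<open>om\<close>, the order of the kernel of the same map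
  of a finite group, hence the same number. Tripling \<open>k\<close> does not change the number of
  ideals, so the weighted number of ideals, summed over the divisors of \<open>n\<close>, is W(n) =
  S(n) + 2 S(n/3), where S(n) is the sum of \<open>theta\<close> over the divisors of
  \<open>n\<close>. Heights prime to 3 contribute W(n) - W(n/3), which is formula (i). For heights
  divisible by 3 the number of orbits is a third of the number of all subgroups plus twice the
  number of fixed ones: there are omega(n/3) in all and W(n/3) fixed ones, which is formula (ii).
  The two kinds of total space are told apart by commutativity: a homeomorphism of orbit spaces
  lifts to Euclidean space and would make the group of the base commutative.\<close>

lemma continuous_map_locally:
  fixes S :: "'e::topological_space set"
  assumes loc: "\<And>x. x \<in> S \<Longrightarrow> \<exists>W h. openin (top_of_set S) W \<and> x \<in> W \<and>
             continuous_map (top_of_set W) N h \<and> (\<forall>y\<in>W. f y = h y)"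
  shows "continuous_map (top_of_set S) N f"
  unfolding continuous_map_def
proof (intro conjI allI impI)
  show "f \<in> topspace (top_of_set S) \<rightarrow> topspace N"
  proof
    fix x assume "x \<in> topspace (top_of_set S)"
    then obtain W h where "x \<in> W" "continuous_map (top_of_set W) N h" "f x = h x"
      using loc[of x] by auto
    then show "f x \<in> topspace N"
      by (metis continuous_map_image_subset_topspace image_subset_iff topspace_euclidean_subtopology)
  qed
  fix U assume U: "openin N U"
  show "openin (top_of_set S) {x \<in> topspace (top_of_set S). f x \<in> U}"
  proof (subst openin_subopen, intro ballI)
    fix x assume x: "x \<in> {x \<in> topspace (top_of_set S). f x \<in> U}"
    then obtain W h where W: "openin (top_of_set S) W" "x \<in> W"
      and h: "continuous_map (top_of_set W) N h" "\<And>y. y \<in> W \<Longrightarrow> f y = h y"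
      using loc[of x] by auto
    have "openin (top_of_set W) {y \<in> W. h y \<in> U}"
      using openin_continuous_map_preimage[OF h(1) U] by simp
    then have "openin (top_of_set S) {y \<in> W. h y \<in> U}"
      using W(1) openin_trans by blast
    moreover have "{y \<in> W. h y \<in> U} \<subseteq> {x \<in> topspace (top_of_set S). f x \<in> U}"
      using h(2) openin_subset[OF W(1)] by auto
    ultimately show "\<exists>T. openin (top_of_set S) T \<and> x \<in> T \<and>
         T \<subseteq> {x \<in> topspace (top_of_set S). f x \<in> U}"
      using x W(2) h(2) by (intro exI[of _ "{y \<in> W. h y \<in> U}"]) auto
  qed
qed

text \<open>An evenly covered open set together with its sheets, made explicit so that proofs can
  fix \<open>T\<close> and \<open>\<V>\<close> instead of unfolding the existential in
  \<open>covering_map\<close>.\<close>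

definition sheets :: "'a topology \<Rightarrow> 'b topology \<Rightarrow> ('a \<Rightarrow> 'b) \<Rightarrow> 'b set \<Rightarrow> 'a set set \<Rightarrow> bool" where
  "sheets N M p T \<V> \<longleftrightarrow> openin M T \<and> \<Union>\<V> = {y \<in> topspace N. p y \<in> T} \<and>
     (\<forall>U \<in> \<V>. openin N U) \<and> pairwise disjnt \<V> \<and>
     (\<forall>U \<in> \<V>. homeomorphic_map (subtopology N U) (subtopology M T) p)"

lemma covering_map_sheets:
  assumes "covering_map N M p" "x \<in> topspace M"
  obtains T \<V> where "x \<in> T" "sheets N M p T \<V>"
  using assms unfolding covering_map_def sheets_def by meson

lemma sheet_exists:
  assumes "sheets N M p T \<V>" "y \<in> topspace N" "p y \<in> T"
  obtains U where "U \<in> \<V>" "y \<in> U"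
proof -
  have "y \<in> \<Union>\<V>" using assms by (simp add: sheets_def)
  then show ?thesis using that by blast
qed

lemma sheets_unique:
  assumes "sheets N M p T \<V>" "U \<in> \<V>" "U' \<in> \<V>" "y \<in> U" "y \<in> U'"
  shows "U = U'"
  using assms unfolding sheets_def pairwise_def disjnt_def by blast

lemma sheet_subset:
  assumes "sheets N M p T \<V>" "U \<in> \<V>"
  shows "openin N U" "U \<subseteq> topspace N" "topspace (subtopology N U) = U"
    "topspace (subtopology M T) = T"
  using assms openin_subset[of N U] openin_subset[of M T] unfolding sheets_def by auto

lemma sheet_inj:
  assumes "sheets N M p T \<V>" "U \<in> \<V>"
  shows "inj_on p U" "p ` U = T"
proof -
  have h: "homeomorphic_map (subtopology N U) (subtopology M T) p"
    using assms by (auto simp: sheets_def)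
  show "inj_on p U" "p ` U = T"
    using homeomorphic_imp_injective_map[OF h] homeomorphic_imp_surjective_map[OF h]
      sheet_subset[OF assms] by auto
qed

text \<open>The set of agreement and its complement are both open in \<open>S\<close>: near a point
  the two lifts run either in one sheet, on which \<open>p\<close> is injective, or in two disjoint
  sheets.\<close>

lemma covering_map_lift_unique:
  fixes f g :: "'e::topological_space \<Rightarrow> 'a"
  assumes cov: "covering_map N M p" and S: "connected S"
    and f: "continuous_map (top_of_set S) N f" and g: "continuous_map (top_of_set S) N g"
    and pfg: "\<And>x. x \<in> S \<Longrightarrow> p (f x) = p (g x)" and a: "a \<in> S" "f a = g a"
    and x: "x \<in> S"
  shows "f x = g x"
proof (rule ccontr)
  assume neq: "f x \<noteq> g x"
  let ?E = "{x \<in> S. f x = g x}" and ?D = "{x \<in> S. f x \<noteq> g x}"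
  have fS: "f z \<in> topspace N" "g z \<in> topspace N" if "z \<in> S" for z
    using that continuous_map_image_subset_topspace[OF f] continuous_map_image_subset_topspace[OF g]
    by auto
  have opn: "openin (top_of_set S) {z \<in> S. f z \<in> U \<and> g z \<in> U'}" if "openin N U" "openin N U'" for U U'
  proof -
    have "openin (top_of_set S) ({z \<in> S. f z \<in> U} \<inter> {z \<in> S. g z \<in> U'})"
      using openin_continuous_map_preimage[OF f that(1)] openin_continuous_map_preimage[OF g that(2)]
      by (intro openin_Int) simp_all
    then show ?thesis by (simp add: Collect_conj_eq Int_ac)
  qed
  have nb: "\<exists>W. openin (top_of_set S) W \<and> z \<in> W \<and> (if f z = g z then W \<subseteq> ?E else W \<subseteq> ?D)"
    if z: "z \<in> S" for z
  proof -
    have "p (f z) \<in> topspace M"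
      using cov fS[OF z] by (auto simp: covering_map_def)
    then obtain T \<V> where T: "p (f z) \<in> T" "sheets N M p T \<V>"
      using covering_map_sheets[OF cov] by blast
    obtain U where U: "U \<in> \<V>" "f z \<in> U" using sheet_exists[OF T(2) fS(1)[OF z] T(1)] .
    obtain U' where U': "U' \<in> \<V>" "g z \<in> U'"
      using sheet_exists[OF T(2) fS(2)[OF z]] T(1) pfg[OF z] by metis
    define W where "W = {z \<in> S. f z \<in> U \<and> g z \<in> U'}"
    have W: "openin (top_of_set S) W" "z \<in> W"
      using opn sheet_subset[OF T(2)] U U' z by (auto simp: W_def)
    show ?thesis
    proof (cases "U = U'")
      case True
      then have "\<forall>w\<in>W. f w = g w"
        using sheet_inj(1)[OF T(2) U(1)] pfg unfolding W_def inj_on_def by auto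
      then show ?thesis using W by (intro exI[of _ W]) (auto simp: W_def)
    next
      case False
      then have "U \<inter> U' = {}" using sheets_unique[OF T(2) U(1) U'(1)] by blast
      then have "\<forall>w\<in>W. f w \<noteq> g w" unfolding W_def by auto
      then show ?thesis using W by (intro exI[of _ W]) (auto simp: W_def)
    qed
  qed
  have "openin (top_of_set S) ?E"
    by (subst openin_subopen) (use nb in fastforce)
  moreover have "openin (top_of_set S) ?D"
    by (subst openin_subopen) (use nb in fastforce)
  moreover have "S \<subseteq> ?E \<union> ?D" "?E \<inter> ?D = {}" "?E \<noteq> {}" "?D \<noteq> {}"
    using a x neq by auto
  ultimately show False
    using S unfolding connected_openin by meson
qed

text \<open>The lift is \<open>q \<circ> g\<close>, where \<open>q\<close> inverts \<open>p\<close>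
  on the sheet through \<open>y\<close>.\<close>

lemma sheets_local_lift:
  fixes g :: "'e::topological_space \<Rightarrow> 'b"
  assumes sh: "sheets N M p T \<V>" and g: "continuous_map (top_of_set W) M g" "g ` W \<subseteq> T"
    and e: "e \<in> W" and y: "y \<in> topspace N" "p y = g e"
  obtains s where "continuous_map (top_of_set W) N s" "\<And>x. x \<in> W \<Longrightarrow> p (s x) = g x" "s e = y"
proof -
  obtain U where U: "U \<in> \<V>" "y \<in> U"
    using sheet_exists[OF sh y(1)] y(2) g(2) e by auto
  have h: "homeomorphic_map (subtopology N U) (subtopology M T) p"
    using sh U by (auto simp: sheets_def)
  then obtain q where q: "homeomorphic_maps (subtopology N U) (subtopology M T) p q"
    by (auto simp: homeomorphic_map_maps)
  have "continuous_map (top_of_set W) (subtopology M T) g"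
    using g by (auto simp: continuous_map_in_subtopology)
  then have "continuous_map (top_of_set W) (subtopology N U) (q \<circ> g)"
    using q by (auto simp: homeomorphic_maps_def intro: continuous_map_compose)
  then have 1: "continuous_map (top_of_set W) N (q \<circ> g)"
    by (simp add: continuous_map_in_subtopology)
  have 2: "p ((q \<circ> g) x) = g x" if "x \<in> W" for x
    using q g(2) that sheet_subset[OF sh U(1)] unfolding homeomorphic_maps_def by auto
  have 3: "(q \<circ> g) e = y"
    using q U(2) y sheet_subset[OF sh U(1)] unfolding homeomorphic_maps_def
    by (metis comp_apply)
  show ?thesis using that[OF 1 2 3] .
qed

text \<open>A lift on a ball of radius \<open>\<rho>\<close> gives one on a larger ball: contract a point radially into the smaller
  ball and follow the local section there, which exists on a ball of uniform radius \<open>\<epsilon>\<close>.\<close>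

lemma covering_map_lift_ball:
  fixes g :: "'e::euclidean_space \<Rightarrow> 'b"
  assumes cov: "covering_map N M p" and g: "continuous_map euclidean M g"
    and y0: "y0 \<in> topspace N" "p y0 = g 0" and R: "R > 0"
  shows "\<exists>f. continuous_map (top_of_set (ball 0 R)) N f \<and> (\<forall>x\<in>ball 0 R. p (f x) = g x) \<and> f 0 = y0"
proof -
  define P where "P \<rho> \<longleftrightarrow> (\<exists>f. continuous_map (top_of_set (ball 0 \<rho>)) N f \<and>
     (\<forall>x\<in>ball 0 \<rho>. p (f x) = g x) \<and> f 0 = y0)" for \<rho> :: real
  define \<G> where "\<G> = {{x. g x \<in> T} |T. \<exists>\<V>. sheets N M p T \<V>}"
  have gM: "g x \<in> topspace M" for x
    using continuous_map_image_subset_topspace[OF g] by auto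
  have "cball 0 R \<subseteq> \<Union>\<G>"
  proof
    fix x :: 'e
    obtain T \<V> where "g x \<in> T" "sheets N M p T \<V>"
      using covering_map_sheets[OF cov gM] .
    then show "x \<in> \<Union>\<G>" by (auto simp: \<G>_def)
  qed
  moreover have "open G" if GG: "G \<in> \<G>" for G
  proof -
    obtain T \<V> where "sheets N M p T \<V>" and G: "G = {x. g x \<in> T}"
      using GG unfolding \<G>_def by blast
    then have "openin M T" by (simp add: sheets_def)
    then show ?thesis
      using openin_continuous_map_preimage[OF g, of T] by (simp add: G)
  qed
  \<comment> \<open>A Lebesgue number of the cover of the closed ball by preimages of evenly covered
    sets.\<close>
  ultimately obtain \<epsilon> where \<epsilon>: "\<epsilon> > 0" "\<And>x. x \<in> cball 0 R \<Longrightarrow> \<exists>G\<in>\<G>. ball x \<epsilon> \<subseteq> G"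
    using Heine_Borel_lemma[OF compact_cball, of 0 R \<G>] by metis
  have sec: "\<exists>s. continuous_map (top_of_set (ball a \<epsilon>)) N s \<and> (\<forall>x\<in>ball a \<epsilon>. p (s x) = g x) \<and> s a = y"
    if ay: "a \<in> ball 0 R" "y \<in> topspace N" "p y = g a" for a y
  proof -
    obtain G where "G \<in> \<G>" "ball a \<epsilon> \<subseteq> G"
      using \<epsilon>(2)[of a] \<open>a \<in> ball 0 R\<close> by auto
    then obtain T \<V> where T: "sheets N M p T \<V>" "ball a \<epsilon> \<subseteq> {x. g x \<in> T}"
      unfolding \<G>_def mem_Collect_eq by (metis (no_types))
    have "continuous_map (top_of_set (ball a \<epsilon>)) M g"
      using g by (simp add: continuous_map_from_subtopology)
    moreover have "g ` ball a \<epsilon> \<subseteq> T" "a \<in> ball a \<epsilon>" using T(2) \<epsilon>(1) by auto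
    ultimately obtain s where "continuous_map (top_of_set (ball a \<epsilon>)) N s"
      "\<And>x. x \<in> ball a \<epsilon> \<Longrightarrow> p (s x) = g x" "s a = y"
      using sheets_local_lift[OF T(1), of "ball a \<epsilon>" g a y] ay by metis
    then show ?thesis by blast
  qed
  \<comment> \<open>The contraction \<open>c\<close> below moves points by at most
    \<open>\<delta>\<close>, which has to stay strictly below the radius \<open>\<epsilon>\<close>
    of the local sections.\<close>
  define \<delta> where "\<delta> = \<epsilon> / 2"
  have \<delta>: "\<delta> > 0" "\<delta> < \<epsilon>" using \<epsilon> by (auto simp: \<delta>_def)
  have restrict: "continuous_map (top_of_set A) N h" if "continuous_map (top_of_set B) N h" "A \<subseteq> B" for A B h
    using that continuous_map_from_subtopology_mono by blast
  have base: "P (min R \<delta>)"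
  proof -
    obtain s where "continuous_map (top_of_set (ball 0 \<epsilon>)) N s" "\<forall>x\<in>ball 0 \<epsilon>. p (s x) = g x" "s 0 = y0"
      using sec[of 0 y0] R y0 by auto
    then show ?thesis unfolding P_def using \<delta>
      by (intro exI[of _ s]) (auto intro!: restrict[of "ball 0 \<epsilon>"])
  qed
  have step: "P (min R (\<rho> + \<delta>))" if P: "P \<rho>" and \<rho>: "0 < \<rho>" "\<rho> \<le> R" for \<rho>
  proof -
    obtain f where f: "continuous_map (top_of_set (ball 0 \<rho>)) N f"
      "\<And>x. x \<in> ball 0 \<rho> \<Longrightarrow> p (f x) = g x" "f 0 = y0"
      using P by (auto simp: P_def)
    define \<rho>' where "\<rho>' = min R (\<rho> + \<delta>)"
    have \<rho>': "\<rho> \<le> \<rho>'" "\<rho>' \<le> \<rho> + \<delta>" "\<rho>' > 0" using \<rho> \<delta> by (auto simp: \<rho>'_def)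
    define c :: "'e \<Rightarrow> 'e" where "c x = (\<rho> / \<rho>') *\<^sub>R x" for x
    have c1: "c x \<in> ball 0 \<rho>" if "x \<in> ball 0 \<rho>'" for x
      using that \<rho> \<rho>' by (simp add: c_def field_simps)
    have c2: "dist (c x) x < \<epsilon>" if "x \<in> ball 0 \<rho>'" for x
    proof -
      have "c x - x = (\<rho> / \<rho>' - 1) *\<^sub>R x" by (simp add: c_def algebra_simps)
      then have "dist (c x) x = (1 - \<rho> / \<rho>') * norm x"
        using \<rho>' \<rho> by (simp add: dist_norm)
      also have "\<dots> \<le> (1 - \<rho> / \<rho>') * \<rho>'"
        using that \<rho>' \<rho> by (intro mult_left_mono) auto
      also have "\<dots> = \<rho>' - \<rho>" using \<rho>' by (simp add: field_simps)
      finally show ?thesis using \<rho>' \<delta> by linarith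
    qed
    have fN: "f x \<in> topspace N" if "x \<in> ball 0 \<rho>" for x
      using continuous_map_image_subset_topspace[OF f(1)] that by auto
    have "\<exists>s. \<forall>a\<in>ball 0 \<rho>. continuous_map (top_of_set (ball a \<epsilon>)) N (s a) \<and>
        (\<forall>x\<in>ball a \<epsilon>. p (s a x) = g x) \<and> s a a = f a"
      using sec fN f(2) \<rho> by (intro bchoice) auto
    then obtain s where s: "\<And>a. a \<in> ball 0 \<rho> \<Longrightarrow> continuous_map (top_of_set (ball a \<epsilon>)) N (s a)"
      "\<And>a x. a \<in> ball 0 \<rho> \<Longrightarrow> x \<in> ball a \<epsilon> \<Longrightarrow> p (s a x) = g x"
      "\<And>a. a \<in> ball 0 \<rho> \<Longrightarrow> s a a = f a" by metis
    have eq1: "s a x = f x" if "a \<in> ball 0 \<rho>" "x \<in> ball 0 \<rho>" "x \<in> ball a \<epsilon>" for a x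
    proof (rule covering_map_lift_unique[OF cov, of "ball 0 \<rho> \<inter> ball a \<epsilon>" "s a" f a])
      show "connected (ball 0 \<rho> \<inter> ball a \<epsilon>)" by (intro convex_connected convex_Int convex_ball)
    qed (use that s f \<epsilon> in \<open>auto intro: restrict\<close>)
    \<comment> \<open>The two balls meet in a convex, hence connected set that contains
      \<open>a\<close>, where both sections take the value \<open>f a\<close>; lifts that agree at
      one point agree throughout.\<close>
    have eq2: "s a x = s b x" if "a \<in> ball 0 \<rho>" "b \<in> ball 0 \<rho>" "a \<in> ball b \<epsilon>"
      "x \<in> ball a \<epsilon>" "x \<in> ball b \<epsilon>" for a b x
    proof (rule covering_map_lift_unique[OF cov, of "ball a \<epsilon> \<inter> ball b \<epsilon>" "s a" "s b" a])
      show "connected (ball a \<epsilon> \<inter> ball b \<epsilon>)" by (intro convex_connected convex_Int convex_ball)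
      show "s a a = s b a" using eq1[of b a] s(3)[of a] that by simp
    qed (use that s \<epsilon> in \<open>auto intro: restrict\<close>)
    define F where "F x = s (c x) x" for x
    have "continuous_map (top_of_set (ball 0 \<rho>')) N F"
    proof (rule continuous_map_locally)
      fix x :: 'e assume x: "x \<in> ball 0 \<rho>'"
      \<comment> \<open>On \<open>W\<close> the base point \<open>c z\<close> of the section used by
        \<open>F\<close> stays within \<open>\<epsilon>\<close> of \<open>c x\<close>, so the
        varying section can be replaced by the fixed one at \<open>c x\<close>.\<close>
      define W where "W = ball 0 \<rho>' \<inter> ball (c x) \<epsilon> \<inter> c -` ball (c x) \<epsilon>"
      have "continuous_on UNIV c" unfolding c_def by (intro continuous_intros)
      then have "open W" unfolding W_def by (intro open_Int open_ball open_vimage) auto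
      then have 1: "openin (top_of_set (ball 0 \<rho>')) W"
        by (simp add: open_subset W_def le_infI1)
      have 2: "x \<in> W" using x c2[OF x] \<epsilon> by (auto simp: W_def)
      have 3: "continuous_map (top_of_set W) N (s (c x))"
        using s(1)[OF c1[OF x]] by (rule restrict) (auto simp: W_def)
      have 4: "\<forall>z\<in>W. F z = s (c x) z"
        unfolding F_def using c1 c2 x by (auto simp: W_def intro!: eq2)
      show "\<exists>W h. openin (top_of_set (ball 0 \<rho>')) W \<and> x \<in> W \<and>
             continuous_map (top_of_set W) N h \<and> (\<forall>y\<in>W. F y = h y)"
        using 1 2 3 4 by blast
    qed
    moreover have "\<forall>x\<in>ball 0 \<rho>'. p (F x) = g x"
      unfolding F_def using s(2) c1 c2 by simp
    moreover have "F 0 = y0"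
      using s(3)[of 0] \<rho> f(3) by (simp add: F_def c_def)
    ultimately show ?thesis unfolding P_def \<rho>'_def by blast
  qed
  have "P (min R (real (Suc k) * \<delta>))" for k
  proof (induction k)
    case 0
    then show ?case using base by simp
  next
    case (Suc k)
    have "0 < min R (real (Suc k) * \<delta>)" "min R (real (Suc k) * \<delta>) \<le> R"
      using R \<delta> by (auto simp: min_def)
    from step[OF Suc this] have "P (min R (min R (real (Suc k) * \<delta>) + \<delta>))" .
    also have "min R (min R (real (Suc k) * \<delta>) + \<delta>) = min R (real (Suc (Suc k)) * \<delta>)"
      using \<delta> by (auto simp: min_def algebra_simps)
    finally show ?case .
  qed
  moreover obtain k where "R < real k * \<delta>"
    using \<delta>(1) reals_Archimedean3 by blast
  then have "min R (real (Suc k) * \<delta>) = R" using \<delta> by (auto simp: min_def algebra_simps)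
  ultimately have "P R" by metis
  then show ?thesis by (simp add: P_def)
qed

text \<open>Lifts over the balls of radius \<open>Suc k\<close> agree on smaller balls by
  uniqueness, so they glue to one map, whose continuity is local.\<close>

lemma covering_map_lift_origin:
  fixes g :: "'e::euclidean_space \<Rightarrow> 'b"
  assumes cov: "covering_map N M p" and g: "continuous_map euclidean M g"
    and y0: "y0 \<in> topspace N" "p y0 = g 0"
  shows "\<exists>f. continuous_map euclidean N f \<and> (\<forall>x. p (f x) = g x) \<and> f 0 = y0"
proof -
  let ?B = "\<lambda>k. ball (0::'e) (real (Suc k))"
  have "\<exists>f. \<forall>k. continuous_map (top_of_set (?B k)) N (f k) \<and> (\<forall>x\<in>?B k. p (f k x) = g x) \<and> f k 0 = y0"
    by (intro choice allI covering_map_lift_ball[OF assms]) auto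
  then obtain f where f: "\<And>k. continuous_map (top_of_set (?B k)) N (f k)"
    "\<And>k x. x \<in> ?B k \<Longrightarrow> p (f k x) = g x" "\<And>k. f k 0 = y0" by metis
  have sub: "?B k \<subseteq> ?B l" if "k \<le> l" for k l using that by auto
  have mono: "f k x = f l x" if "k \<le> l" "x \<in> ?B k" for k l x
  proof (rule covering_map_lift_unique[OF cov, of "?B k" "f k" "f l" 0])
    show "continuous_map (top_of_set (?B k)) N (f l)"
      using f(1) sub[OF that(1)] continuous_map_from_subtopology_mono by blast
    show "p (f k z) = p (f l z)" if "z \<in> ?B k" for z
      using f(2) that sub[OF \<open>k \<le> l\<close>] by (metis subsetD)
  qed (use f that in auto)
  define m where "m x = nat \<lfloor>norm x\<rfloor>" for x :: 'e
  have m: "x \<in> ?B (m x)" for x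
    by (simp add: m_def) linarith
  define F where "F x = f (m x) x" for x
  have F: "F x = f k x" if "x \<in> ?B k" for x k
    using mono[of k "m x" x] mono[of "m x" k x] m[of x] that unfolding F_def by (metis nat_le_linear)
  have "continuous_map (top_of_set UNIV) N F"
  proof (rule continuous_map_locally)
    fix x
    show "\<exists>W h. openin (top_of_set UNIV) W \<and> x \<in> W \<and>
             continuous_map (top_of_set W) N h \<and> (\<forall>y\<in>W. F y = h y)"
      using m[of x] f(1) F by (intro exI[of _ "?B (m x)"] exI[of _ "f (m x)"]) auto
  qed
  moreover have "p (F x) = g x" for x using f(2) m by (simp add: F_def)
  moreover have "F 0 = y0" using f(3) by (simp add: F_def)
  ultimately show ?thesis by auto
qed

lemma covering_map_lift:
  fixes g :: "'e::euclidean_space \<Rightarrow> 'b"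
  assumes cov: "covering_map N M p" and g: "continuous_map euclidean M g"
    and y: "y \<in> topspace N" "p y = g a"
  obtains f where "continuous_map euclidean N f" "\<And>x. p (f x) = g x" "f a = y"
proof -
  have "continuous_map euclidean euclidean (\<lambda>x. a + x)"
    by (simp add: continuous_map_iff_continuous2 continuous_intros)
  from continuous_map_compose[OF this g] have "continuous_map euclidean M (\<lambda>x. g (a + x))"
    by (simp add: o_def)
  from covering_map_lift_origin[OF cov this y(1)] obtain f where
    f: "continuous_map euclidean N f" "\<And>x. p (f x) = g (a + x)" "f 0 = y" using y(2) by auto
  have "continuous_map euclidean euclidean (\<lambda>x. x - a)"
    by (simp add: continuous_map_iff_continuous2 continuous_intros)
  from continuous_map_compose[OF this f(1)] have "continuous_map euclidean N (\<lambda>x. f (x - a))"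
    by (simp add: o_def)
  then show ?thesis using that[of "\<lambda>x. f (x - a)"] f by simp
qed

section \<open>Free actions and their orbit spaces\<close>

text \<open>The notation \<open>inv\<close> is taken by group inverses.\<close>

abbreviation finv :: "('a \<Rightarrow> 'b) \<Rightarrow> 'b \<Rightarrow> 'a" where "finv \<equiv> inv_into UNIV"

text \<open>The two images are in bijection, finite or not. This compares fibres, cosets and
  conjugacy classes through the equality of their labels alone.\<close>

lemma card_image_same_kernel:
  assumes "\<And>a b. a \<in> A \<Longrightarrow> b \<in> A \<Longrightarrow> f a = f b \<longleftrightarrow> g a = g b"
  shows "card (f ` A) = card (g ` A)"
proof -
  have "g ` A = (g \<circ> inv_into A f) ` (f ` A)"
    unfolding image_comp o_def
    by (rule image_cong[OF HOL.refl]) (metis assms f_inv_into_f image_eqI inv_into_into)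
  moreover have "inj_on (g \<circ> inv_into A f) (f ` A)"
    by (rule inj_onI) (metis (no_types, lifting) assms comp_apply f_inv_into_f inv_into_into)
  ultimately show ?thesis using card_image by metis
qed

text \<open>The uniform bound in \<open>displacement\<close> gives freeness and evenly covered balls
  of one common radius, and it passes to subgroups.\<close>

locale deck_group =
  fixes \<Gamma> :: "('e::euclidean_space \<Rightarrow> 'e) set"
  assumes id_mem: "id \<in> \<Gamma>"
    and comp_mem: "g \<in> \<Gamma> \<Longrightarrow> h \<in> \<Gamma> \<Longrightarrow> g \<circ> h \<in> \<Gamma>"
    and inverse_ex: "g \<in> \<Gamma> \<Longrightarrow> \<exists>h\<in>\<Gamma>. g \<circ> h = id \<and> h \<circ> g = id"
    and cont: "g \<in> \<Gamma> \<Longrightarrow> continuous_on UNIV g"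
    and displacement: "\<exists>r>0. \<forall>g\<in>\<Gamma>. g \<noteq> id \<longrightarrow> (\<forall>x. r \<le> dist x (g x))"
begin

lemma inv_mem:
  assumes "g \<in> \<Gamma>"
  shows "finv g \<in> \<Gamma>" "g (finv g x) = x" "finv g (g x) = x" "g \<circ> finv g = id" "finv g \<circ> g = id"
proof -
  obtain h where h: "h \<in> \<Gamma>" "g \<circ> h = id" "h \<circ> g = id" using inverse_ex[OF assms] by blast
  then have "finv g = h" by (metis inv_unique_comp)
  then show "finv g \<in> \<Gamma>" "g \<circ> finv g = id" "finv g \<circ> g = id" using h by auto
  then show "g (finv g x) = x" "finv g (g x) = x" by (metis comp_apply id_apply)+
qed

lemma free:
  assumes "g \<in> \<Gamma>" "h \<in> \<Gamma>" "g x = h x"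
  shows "g = h"
proof -
  have "(finv h \<circ> g) x = x" using assms inv_mem[of h] by simp
  moreover have "finv h \<circ> g \<in> \<Gamma>" using assms inv_mem comp_mem by blast
  ultimately have "finv h \<circ> g = id" using displacement by (metis dist_self not_le)
  then show ?thesis using inv_mem[OF assms(2)] by (metis comp_assoc comp_id id_comp)
qed

lemma mem_orbit_self: "x \<in> orbit_of \<Gamma> x"
  unfolding orbit_of_def using id_mem by (metis id_apply imageI)

lemma orbit_of_mult: assumes "g \<in> \<Gamma>" shows "orbit_of \<Gamma> (g x) = orbit_of \<Gamma> x"
proof -
  have "h (g x) \<in> (\<lambda>g. g x) ` \<Gamma>" if "h \<in> \<Gamma>" for h
    using comp_mem[OF that assms] by (metis comp_apply imageI)
  moreover have "h x \<in> (\<lambda>h. h (g x)) ` \<Gamma>" if "h \<in> \<Gamma>" for h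
    using comp_mem[OF that inv_mem(1)[OF assms]] inv_mem(3)[OF assms] by (metis comp_apply imageI)
  ultimately show ?thesis unfolding orbit_of_def by auto
qed

lemma orbit_of_eq_iff: "orbit_of \<Gamma> x = orbit_of \<Gamma> y \<longleftrightarrow> (\<exists>g\<in>\<Gamma>. y = g x)"
proof
  assume "orbit_of \<Gamma> x = orbit_of \<Gamma> y"
  then have "y \<in> orbit_of \<Gamma> x" using mem_orbit_self by metis
  then show "\<exists>g\<in>\<Gamma>. y = g x" by (auto simp: orbit_of_def)
qed (use orbit_of_mult in auto)

lemma open_image: assumes "g \<in> \<Gamma>" "open W" shows "open (g ` W)"
proof -
  have "g ` W = finv g -` W"
  proof (intro Set.set_eqI iffI)
    fix x assume "x \<in> finv g -` W"
    then have "finv g x \<in> W" by simp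
    then have "g (finv g x) \<in> g ` W" by (rule imageI)
    then show "x \<in> g ` W" using inv_mem(2)[OF assms(1)] by simp
  qed (use inv_mem(3)[OF assms(1)] in auto)
  then show ?thesis using open_vimage[OF assms(2) cont[OF inv_mem(1)[OF assms(1)]]] by simp
qed

lemma openin_orbit_image: assumes "open W" shows "openin (orbit_space \<Gamma>) (orbit_of \<Gamma> ` W)"
proof -
  have "orbit_of \<Gamma> -` (orbit_of \<Gamma> ` W) = (\<Union>g\<in>\<Gamma>. g ` W)"
  proof (intro Set.set_eqI iffI)
    fix x assume "x \<in> orbit_of \<Gamma> -` (orbit_of \<Gamma> ` W)"
    then obtain w where "w \<in> W" "orbit_of \<Gamma> w = orbit_of \<Gamma> x" by auto
    then show "x \<in> (\<Union>g\<in>\<Gamma>. g ` W)" unfolding orbit_of_eq_iff by blast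
  next
    fix x assume "x \<in> (\<Union>g\<in>\<Gamma>. g ` W)"
    then obtain g w where "g \<in> \<Gamma>" "w \<in> W" "x = g w" by blast
    then show "x \<in> orbit_of \<Gamma> -` (orbit_of \<Gamma> ` W)" using orbit_of_mult by simp
  qed
  then show ?thesis
    using open_image[OF _ assms] by (auto simp: openin_orbit_space)
qed

lemma continuous_orbit_of: "continuous_map euclidean (orbit_space \<Gamma>) (orbit_of \<Gamma>)"
  using quotient_map_orbit_space quotient_imp_continuous_map by blast

text \<open>Applied with \<open>f = id\<close> and with the orbit projection of a subgroup. The
  hypothesis \<open>fib\<close> says that an element of \<open>\<Gamma>\<close> which identifies one
  point with its image does so for all points, that is, it belongs to the subgroup divided out by
  \<open>f\<close>.\<close>

lemma covering_map_factor:
  assumes f: "continuous_map euclidean N f" and fo: "\<And>W. open W \<Longrightarrow> openin N (f ` W)"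
    and fs: "range f = topspace N" and pf: "\<And>x. p (f x) = orbit_of \<Gamma> x"
    and fib: "\<And>g x y. g \<in> \<Gamma> \<Longrightarrow> f (g x) = f x \<Longrightarrow> f (g y) = f y"
  shows "covering_map N (orbit_space \<Gamma>) p"
proof -
  let ?M = "orbit_space \<Gamma>"
  have qf: "quotient_map euclidean N f"
    using f fo fs by (intro continuous_open_imp_quotient_map) (auto simp: open_map_def)
  have "p \<circ> f = orbit_of \<Gamma>" using pf by auto
  then have pc: "continuous_map N ?M p"
    using continuous_compose_quotient_map[OF qf] continuous_orbit_of by metis
  have po: "openin ?M (p ` W)" if W: "openin N W" for W
  proof -
    have "p ` W = orbit_of \<Gamma> ` {x. f x \<in> W}"
    proof -
      have "W = f ` {x. f x \<in> W}" using fs openin_subset[OF W] by auto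
      then have "p ` W = p ` f ` {x. f x \<in> W}" by simp
      then show ?thesis by (simp add: image_image pf)
    qed
    moreover have "open {x. f x \<in> W}" using openin_continuous_map_preimage[OF f W] by simp
    ultimately show ?thesis using openin_orbit_image by simp
  qed
  have ps: "p ` topspace N = topspace ?M"
    unfolding fs[symmetric] topspace_orbit_space image_image pf ..
  obtain r where r: "r > 0" "\<And>g x. g \<in> \<Gamma> \<Longrightarrow> g \<noteq> id \<Longrightarrow> r \<le> dist x (g x)"
    using displacement by blast
  have "\<exists>T. z \<in> T \<and> openin ?M T \<and> (\<exists>\<V>. \<Union>\<V> = {y \<in> topspace N. p y \<in> T} \<and>
             (\<forall>U \<in> \<V>. openin N U) \<and> pairwise disjnt \<V> \<and>
             (\<forall>U \<in> \<V>. homeomorphic_map (subtopology N U) (subtopology ?M T) p))"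
    if z: "z \<in> topspace ?M" for z
  proof -
    obtain x where x: "z = orbit_of \<Gamma> x" using z by (auto simp: topspace_orbit_space)
    \<comment> \<open>Two points of \<open>B\<close> have distance less than \<open>r\<close>, so no
      element of \<open>\<Gamma>\<close> except \<open>id\<close> carries one to the other.\<close>
    define B where "B = ball x (r / 2)"
    have Bx: "x \<in> B" "open B" using r by (auto simp: B_def)
    have Binj: "b = b'" if b: "b \<in> B" "b' \<in> B" and eq: "orbit_of \<Gamma> b = orbit_of \<Gamma> b'" for b b'
    proof -
      obtain g where g: "g \<in> \<Gamma>" "b' = g b" using eq orbit_of_eq_iff by blast
      have "dist b (g b) < r" using b g(2) dist_triangle_half_r[of x b r b'] by (simp add: B_def)
      then have "g = id" using r(2)[OF g(1), of b] by fastforce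
      then show ?thesis using g by simp
    qed
    define T where "T = orbit_of \<Gamma> ` B"
    \<comment> \<open>The sheets are the images of the translates of \<open>B\<close>. Different
      \<open>g\<close> may give the same sheet, so disjointness means that two sheets with a common
      point coincide; this is where \<open>fib\<close> enters.\<close>
    define \<V> where "\<V> = {f ` g ` B |g. g \<in> \<Gamma>}"
    have T: "z \<in> T" "openin ?M T" using x Bx openin_orbit_image by (auto simp: T_def)
    have op: "openin N U" if "U \<in> \<V>" for U
      using that fo open_image Bx(2) by (auto simp: \<V>_def)
    have un: "\<Union>\<V> = {y \<in> topspace N. p y \<in> T}"
    proof (intro Set.set_eqI iffI)
      fix y assume "y \<in> \<Union>\<V>"
      then obtain g b where "g \<in> \<Gamma>" "b \<in> B" "y = f (g b)" by (auto simp: \<V>_def)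
      then show "y \<in> {y \<in> topspace N. p y \<in> T}"
        using fs pf orbit_of_mult by (auto simp: T_def)
    next
      fix y assume y: "y \<in> {y \<in> topspace N. p y \<in> T}"
      then obtain x' where x': "y = f x'" using fs by auto
      then obtain b where b: "b \<in> B" "orbit_of \<Gamma> x' = orbit_of \<Gamma> b" using y pf by (auto simp: T_def)
      then obtain g where "g \<in> \<Gamma>" "x' = g b" using orbit_of_eq_iff by metis
      then show "y \<in> \<Union>\<V>" using x' b by (auto simp: \<V>_def)
    qed
    have "U = U'" if U: "U \<in> \<V>" "U' \<in> \<V>" "y \<in> U" "y \<in> U'" for U U' y
    proof -
      obtain g b where g: "g \<in> \<Gamma>" "b \<in> B" "y = f (g b)" "U = f ` g ` B" using U by (auto simp: \<V>_def)
      obtain h b' where h: "h \<in> \<Gamma>" "b' \<in> B" "y = f (h b')" "U' = f ` h ` B" using U by (auto simp: \<V>_def)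
      have "orbit_of \<Gamma> b = orbit_of \<Gamma> b'"
        using g h pf orbit_of_mult by metis
      then have bb: "b = b'" using Binj g h by blast
      have m: "h \<circ> finv g \<in> \<Gamma>" using comp_mem h g inv_mem by blast
      have "f ((h \<circ> finv g) (g b)) = f (g b)" using bb g h inv_mem(3)[OF g(1)] by simp
      then have "f ((h \<circ> finv g) (g w)) = f (g w)" for w using fib[OF m] by blast
      then have "f (h w) = f (g w)" for w using inv_mem(3)[OF g(1)] by simp
      then show ?thesis using g h by (simp add: image_image)
    qed
    then have dj: "pairwise disjnt \<V>" unfolding pairwise_def disjnt_def by blast
    have "homeomorphic_map (subtopology N U) (subtopology ?M T) p" if U: "U \<in> \<V>" for U
    proof (rule bijective_open_imp_homeomorphic_map)
      obtain g where g: "g \<in> \<Gamma>" "U = f ` g ` B" using U by (auto simp: \<V>_def)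
      have ts: "topspace (subtopology N U) = U" "topspace (subtopology ?M T) = T"
        using openin_subset[OF op[OF U]] openin_subset[OF T(2)] by auto
      have pU: "p ` U = T"
        by (simp add: g image_image pf orbit_of_mult T_def)
      show "p ` topspace (subtopology N U) = topspace (subtopology ?M T)"
        unfolding ts by (rule pU)
      show "continuous_map (subtopology N U) (subtopology ?M T) p"
        using pc pU by (auto simp: continuous_map_in_subtopology continuous_map_from_subtopology)
      show "open_map (subtopology N U) (subtopology ?M T) p"
        unfolding open_map_def openin_open_subtopology[OF op[OF U]] openin_open_subtopology[OF T(2)]
        using po pU by blast
      show "inj_on p (topspace (subtopology N U))"
        unfolding ts
      proof (rule inj_onI)
        fix u v assume "u \<in> U" "v \<in> U" and uv: "p u = p v"
        then obtain b b' where b: "b \<in> B" "b' \<in> B" "u = f (g b)" "v = f (g b')" using g(2) by blast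
        then have "orbit_of \<Gamma> b = orbit_of \<Gamma> b'" using uv pf orbit_of_mult[OF g(1)] by simp
        then show "u = v" using Binj b by blast
      qed
    qed
    then show ?thesis using T op un dj by blast
  qed
  then show ?thesis unfolding covering_map_def using pc ps by blast
qed

lemma covering_map_orbit_of: "covering_map euclidean (orbit_space \<Gamma>) (orbit_of \<Gamma>)"
proof (rule covering_map_factor[of _ id])
  fix g x y assume "g \<in> \<Gamma>" "id (g x) = id (x::'e)"
  then have "g = id" using free[OF _ id_mem, of g x] by simp
  then show "id (g y) = id y" by simp
qed (auto simp: continuous_map_id[unfolded id_def] id_def)

end

text \<open>On an orbit of a subgroup of \<open>\<Gamma>\<close> all members of the union coincide,
  and the value is the orbit of \<open>\<Gamma>\<close> that contains it: the canonical projection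
  between the orbit spaces.\<close>

definition orbit_down :: "('e \<Rightarrow> 'e) set \<Rightarrow> 'e set \<Rightarrow> 'e set" where
  "orbit_down \<Gamma> S = \<Union>(orbit_of \<Gamma> ` S)"

text \<open>\<open>A\<close> carries orbits of \<open>K\<close> to orbits of \<open>L\<close>. It
  may come from a larger deck group, which gives equivalences of coverings, or be an affine change
  of coordinates, which identifies total spaces.\<close>

lemma conj_homeomorphic_maps:
  fixes A B :: "'e::topological_space \<Rightarrow> 'e"
  assumes A: "continuous_on UNIV A" "continuous_on UNIV B" "A \<circ> B = id" "B \<circ> A = id"
    and L: "L = (\<lambda>k. A \<circ> k \<circ> B) ` K"
  shows "homeomorphic_maps (orbit_space K) (orbit_space L) ((`) A) ((`) B)"
    "A ` orbit_of K x = orbit_of L (A x)"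
proof -
  have AB: "A (B z) = z" "B (A z) = z" for z using A(3,4) by (metis comp_apply id_apply)+
  have K: "K = (\<lambda>k. B \<circ> k \<circ> A) ` L"
  proof -
    have "B \<circ> (A \<circ> k \<circ> B) \<circ> A = k" for k by (rule ext) (simp add: AB)
    then show ?thesis unfolding L image_image by simp
  qed
  have 1: "A ` orbit_of K x = orbit_of L (A x)" for x
    by (simp add: orbit_of_def L image_image AB)
  have 2: "B ` orbit_of L x = orbit_of K (B x)" for x
    by (subst K) (simp add: orbit_of_def image_image AB)
  have c: "continuous_map (orbit_space K') (orbit_space L') h"
    if "continuous_on UNIV C" "\<And>x. h (orbit_of K' x) = orbit_of L' (C x)"
    for K' L' h and C :: "'e \<Rightarrow> 'e"
  proof -
    have "continuous_map euclidean (orbit_space L') (orbit_of L' \<circ> C)"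
      using that(1) quotient_imp_continuous_map[OF quotient_map_orbit_space]
      by (intro continuous_map_compose[of _ euclidean]) auto
    moreover have "orbit_of L' \<circ> C = h \<circ> orbit_of K'" using that(2) by auto
    ultimately show ?thesis
      using continuous_compose_quotient_map[OF quotient_map_orbit_space] by metis
  qed
  show "A ` orbit_of K x = orbit_of L (A x)" by (rule 1)
  show "homeomorphic_maps (orbit_space K) (orbit_space L) ((`) A) ((`) B)"
    unfolding homeomorphic_maps_def topspace_orbit_space
    using c[OF A(1) 1] c[OF A(2) 2] by (auto simp: 1 2 AB)
qed

context deck_group begin

lemma orbit_down_orbit:
  assumes "deck_group K" "K \<subseteq> \<Gamma>"
  shows "orbit_down \<Gamma> (orbit_of K x) = orbit_of \<Gamma> x"
proof -
  interpret K: deck_group K by fact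
  have "orbit_of \<Gamma> ` orbit_of K x = {orbit_of \<Gamma> x}"
    using assms(2) orbit_of_mult K.mem_orbit_self[of x] by (auto simp: orbit_of_def[of K])
  then show ?thesis by (simp add: orbit_down_def)
qed

lemma covering_map_orbit_down:
  assumes "deck_group K" "K \<subseteq> \<Gamma>"
  shows "covering_map (orbit_space K) (orbit_space \<Gamma>) (orbit_down \<Gamma>)"
proof -
  interpret K: deck_group K by fact
  show ?thesis
  proof (rule covering_map_factor[of _ "orbit_of K"])
    fix g x y assume g: "g \<in> \<Gamma>" and "orbit_of K (g x) = orbit_of K x"
    then obtain k where k: "k \<in> K" "g x = k x" using K.orbit_of_eq_iff by metis
    then have "g = k" using free g assms(2) by blast
    then show "orbit_of K (g y) = orbit_of K y" using K.orbit_of_mult k(1) by blast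
  qed (use K.continuous_orbit_of K.openin_orbit_image orbit_down_orbit[OF assms] in
       \<open>auto simp: topspace_orbit_space\<close>)
qed

lemma connected_orbit_space: "connected_space (orbit_space \<Gamma>)"
  using connected_space_quotient_map_image[OF quotient_map_orbit_space]
    connectedin_topspace[of "euclidean::'e topology"] connectedin_iff_connected[of "UNIV::'e set"]
    connected_UNIV[where 'a='e]
  by simp

text \<open>The fibre consists of the \<open>K\<close>-orbits of the points \<open>g x\<close>; by
  freeness two of them coincide exactly if \<open>g\<close> and \<open>h\<close> lie in the same
  right coset of \<open>K\<close>.\<close>

lemma card_fibre_orbit_down:
  assumes "deck_group K" "K \<subseteq> \<Gamma>"
  shows "card {y \<in> topspace (orbit_space K). orbit_down \<Gamma> y = orbit_of \<Gamma> x}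
    = card ((\<lambda>g. (\<lambda>k. k \<circ> g) ` K) ` \<Gamma>)"
proof -
  interpret K: deck_group K by fact
  have "{y \<in> topspace (orbit_space K). orbit_down \<Gamma> y = orbit_of \<Gamma> x} = (\<lambda>g. orbit_of K (g x)) ` \<Gamma>"
    (is "?F = ?I")
  proof (intro Set.set_eqI iffI)
    fix y assume y: "y \<in> ?F"
    then obtain x' where x': "y = orbit_of K x'" by (auto simp: topspace_orbit_space)
    then have "orbit_of \<Gamma> x = orbit_of \<Gamma> x'" using y orbit_down_orbit[OF assms] by simp
    then show "y \<in> ?I" unfolding orbit_of_eq_iff x' by blast
  qed (auto simp: topspace_orbit_space orbit_down_orbit[OF assms] orbit_of_mult)
  moreover have "orbit_of K (g x) = orbit_of K (h x) \<longleftrightarrow> (\<lambda>k. k \<circ> g) ` K = (\<lambda>k. k \<circ> h) ` K"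
    if gh: "g \<in> \<Gamma>" "h \<in> \<Gamma>" for g h
  proof
    assume "orbit_of K (g x) = orbit_of K (h x)"
    then obtain k where k: "k \<in> K" "h x = (k \<circ> g) x" using K.orbit_of_eq_iff by auto
    then have h: "h = k \<circ> g" using free gh comp_mem assms(2) by blast
    have 1: "k' \<circ> g = (k' \<circ> finv k) \<circ> h" "k' \<circ> h = (k' \<circ> k) \<circ> g" for k'
      unfolding h using K.inv_mem(3)[OF k(1)] by (simp_all add: fun_eq_iff)
    show "(\<lambda>k. k \<circ> g) ` K = (\<lambda>k. k \<circ> h) ` K"
    proof (intro Set.set_eqI iffI)
      fix u assume "u \<in> (\<lambda>k. k \<circ> g) ` K"
      then obtain k' where k': "k' \<in> K" "u = k' \<circ> g" by blast
      have "k' \<circ> finv k \<in> K" using K.comp_mem[OF k'(1) K.inv_mem(1)[OF k(1)]] .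
      then show "u \<in> (\<lambda>k. k \<circ> h) ` K" unfolding k'(2) 1(1) by (rule imageI)
    next
      fix u assume "u \<in> (\<lambda>k. k \<circ> h) ` K"
      then obtain k' where k': "k' \<in> K" "u = k' \<circ> h" by blast
      have "k' \<circ> k \<in> K" using K.comp_mem[OF k'(1) k(1)] .
      then show "u \<in> (\<lambda>k. k \<circ> g) ` K" unfolding k'(2) 1(2) by (rule imageI)
    qed
  next
    assume "(\<lambda>k. k \<circ> g) ` K = (\<lambda>k. k \<circ> h) ` K"
    then have "id \<circ> h \<in> (\<lambda>k. k \<circ> g) ` K" using K.id_mem by blast
    then obtain k where "k \<in> K" "h = k \<circ> g" by auto
    then show "orbit_of K (g x) = orbit_of K (h x)" using K.orbit_of_mult by simp
  qed
  ultimately show ?thesis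
    using card_image_same_kernel[of \<Gamma> "\<lambda>g. orbit_of K (g x)" "\<lambda>g. (\<lambda>k. k \<circ> g) ` K"] by simp
qed

text \<open>A lift \<open>f\<close> of the orbit projection through \<open>p\<close> plays the role
  of the universal covering of \<open>N\<close>, and \<open>K\<close> consists of the elements of
  \<open>\<Gamma>\<close> under which \<open>f\<close> is invariant.\<close>

lemma covering_map_classification:
  assumes cov: "covering_map N (orbit_space \<Gamma>) p" and con: "connected_space N"
  obtains K h where "K \<subseteq> \<Gamma>" "deck_group K" "homeomorphic_map N (orbit_space K) h"
    "\<And>y. y \<in> topspace N \<Longrightarrow> p y = orbit_down \<Gamma> (h y)"
proof -
  let ?M = "orbit_space \<Gamma>"
  have pN: "p ` topspace N = topspace ?M" using cov by (simp add: covering_map_def)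
  then obtain y0 where y0: "y0 \<in> topspace N" "p y0 = orbit_of \<Gamma> 0"
    by (metis (no_types, lifting) imageE rangeI topspace_orbit_space)
  obtain f where f: "continuous_map euclidean N f" "\<And>x. p (f x) = orbit_of \<Gamma> x"
    using covering_map_lift[OF cov continuous_orbit_of y0] by blast
  have fN: "f x \<in> topspace N" for x
    using continuous_map_image_subset_topspace[OF f(1)] by auto
  have uniq: "f1 = f2" if "continuous_map euclidean N f1" "continuous_map euclidean N f2"
     "\<And>x. p (f1 x) = p (f2 x)" "f1 a = f2 a" for f1 f2 and a :: 'e
    by (rule ext, rule covering_map_lift_unique[OF cov connected_UNIV]) (use that in auto)
  have cg: "continuous_map euclidean N (f' \<circ> g)" if "g \<in> \<Gamma>" "continuous_map euclidean N f'" for f' g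
    using that cont by (intro continuous_map_compose[of _ euclidean]) auto
  \<comment> \<open>Inside a sheet the image of a small open set is the preimage under
    \<open>p\<close> of its image in the orbit space, which is open.\<close>
  have op: "openin N (f' ` W)" if f': "continuous_map euclidean N f'" "\<And>x. p (f' x) = orbit_of \<Gamma> x"
    and W: "open W" for f' W
  proof (subst openin_subopen, intro ballI)
    fix y assume "y \<in> f' ` W"
    then obtain x where x: "x \<in> W" "y = f' x" by auto
    have f'N: "f' x \<in> topspace N" for x
      using continuous_map_image_subset_topspace[OF f'(1)] by auto
    have "p y \<in> topspace ?M" using pN f'N x by auto
    then obtain T \<V> where T: "p y \<in> T" "sheets N ?M p T \<V>"
      using covering_map_sheets[OF cov] by blast
    obtain U where U: "U \<in> \<V>" "y \<in> U" using sheet_exists[OF T(2) _ T(1)] f'N x by blast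
    have oU: "openin N U" using sheet_subset[OF T(2) U(1)] by simp
    define W' where "W' = W \<inter> {x. f' x \<in> U}"
    have W': "open W'" unfolding W'_def using W openin_continuous_map_preimage[OF f'(1) oU] by auto
    have "f' ` W' = U \<inter> {y \<in> topspace N. p y \<in> orbit_of \<Gamma> ` W'}"
    proof (intro Set.set_eqI iffI)
      fix v assume v: "v \<in> U \<inter> {y \<in> topspace N. p y \<in> orbit_of \<Gamma> ` W'}"
      then obtain w where w: "w \<in> W'" "p v = p (f' w)" using f'(2) by auto
      then have "v = f' w" using sheet_inj(1)[OF T(2) U(1)] v unfolding inj_on_def W'_def by blast
      then show "v \<in> f' ` W'" using w by blast
    qed (use f'N f'(2) in \<open>auto simp: W'_def\<close>)
    moreover have "openin N {y \<in> topspace N. p y \<in> orbit_of \<Gamma> ` W'}"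
      by (rule openin_continuous_map_preimage[OF _ openin_orbit_image[OF W']])
        (use cov in \<open>simp add: covering_map_def\<close>)
    ultimately have "openin N (f' ` W')" using oU by auto
    then show "\<exists>S. openin N S \<and> y \<in> S \<and> S \<subseteq> f' ` W"
      using x U by (intro exI[of _ "f' ` W'"]) (auto simp: W'_def)
  qed
  \<comment> \<open>The range is open and closed: a lift \<open>f'\<close> through a point outside
    has open image, and if that met the range, uniqueness would give \<open>f' = f \<circ> g\<close>
    with \<open>g\<close> in \<open>\<Gamma>\<close>, putting the point into the range.\<close>
  have surj: "range f = topspace N"
  proof -
    have "openin N (topspace N - range f)"
    proof (subst openin_subopen, intro ballI)
      fix y assume y: "y \<in> topspace N - range f"
      have "p y \<in> topspace ?M" using y pN by auto
      then obtain a where a: "p y = orbit_of \<Gamma> a" by (auto simp: topspace_orbit_space)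
      obtain f' where f': "continuous_map euclidean N f'" "\<And>x. p (f' x) = orbit_of \<Gamma> x" "f' a = y"
        using covering_map_lift[OF cov continuous_orbit_of _ a] y by blast
      have "range f' \<inter> range f = {}"
      proof (rule ccontr)
        assume "range f' \<inter> range f \<noteq> {}"
        then obtain e1 e2 where e: "f' e1 = f e2" by auto
        then have "orbit_of \<Gamma> e1 = orbit_of \<Gamma> e2" using f f' by metis
        then obtain g where g: "g \<in> \<Gamma>" "e2 = g e1" using orbit_of_eq_iff by blast
        have "f' = f \<circ> g"
          by (rule uniq[OF f'(1) cg[OF g(1) f(1)], of e1])
             (use e g f f' orbit_of_mult in auto)
        then show False using y f'(3) by auto
      qed
      then show "\<exists>T. openin N T \<and> y \<in> T \<and> T \<subseteq> topspace N - range f"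
        using op[OF f'(1,2), of UNIV] f'(3) openin_subset by (intro exI[of _ "range f'"]) blast
    qed
    moreover have "openin N (range f)" using op[OF f, of UNIV] by simp
    ultimately have "range f = {} \<or> range f = topspace N"
      using con fN unfolding connected_space_clopen_in closedin_def by blast
    then show ?thesis using fN by auto
  qed
  define K where "K = {g \<in> \<Gamma>. f \<circ> g = f}"
  \<comment> \<open>By uniqueness of lifts, invariance of \<open>f\<close> under \<open>g\<close> at
    one point implies it everywhere.\<close>
  have KI: "g \<in> K" if "g \<in> \<Gamma>" "f (g x) = f x" for g x
  proof -
    have "f \<circ> g = f" by (rule uniq[OF cg[OF that(1) f(1)] f(1), of x]) (use that f orbit_of_mult in auto)
    then show ?thesis using that by (simp add: K_def)
  qed
  have fK: "f (g x) = f x" if "g \<in> K" for g x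
    using that unfolding K_def by (metis (mono_tags, lifting) comp_apply mem_Collect_eq)
  have KG: "K \<subseteq> \<Gamma>" by (auto simp: K_def)
  have dK: "deck_group K"
  proof
    show "id \<in> K" using id_mem by (simp add: K_def)
    fix g h assume gh: "g \<in> K" "h \<in> K"
    show "g \<circ> h \<in> K" using gh comp_mem[of g h] fK KG by (intro KI[of _ 0]) auto
  next
    fix g assume g: "g \<in> K"
    then have gG: "g \<in> \<Gamma>" using KG by blast
    have "f (finv g 0) = f 0" using fK[OF g, of "finv g 0"] inv_mem(2)[OF gG] by simp
    then have "finv g \<in> K" using KI inv_mem(1)[OF gG] by blast
    then show "\<exists>h\<in>K. g \<circ> h = id \<and> h \<circ> g = id" using inv_mem[OF gG] by blast
    show "continuous_on UNIV g" using cont gG by blast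
  next
    show "\<exists>r>0. \<forall>g\<in>K. g \<noteq> id \<longrightarrow> (\<forall>x. r \<le> dist x (g x))"
      using displacement KG by blast
  qed
  interpret K: deck_group K by fact
  have kf: "f x = f y \<longleftrightarrow> orbit_of K x = orbit_of K y" for x y
  proof
    assume e: "f x = f y"
    then have "orbit_of \<Gamma> x = orbit_of \<Gamma> y" using f by metis
    then obtain g where g: "g \<in> \<Gamma>" "y = g x" using orbit_of_eq_iff by blast
    then have "g \<in> K" using KI e by metis
    then show "orbit_of K x = orbit_of K y" using g K.orbit_of_mult by metis
  next
    assume "orbit_of K x = orbit_of K y"
    then show "f x = f y" using K.orbit_of_eq_iff fK by metis
  qed
  have qf: "quotient_map euclidean N f"
    using f(1) op[OF f] surj by (intro continuous_open_imp_quotient_map) (auto simp: open_map_def)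
  obtain h where h: "continuous_map N (orbit_space K) h" "\<And>x. h (f x) = orbit_of K x"
    using quotient_map_lift_exists[OF qf K.continuous_orbit_of] kf by (metis UNIV_I topspace_euclidean)
  obtain h' where h': "continuous_map (orbit_space K) N h'" "\<And>x. h' (orbit_of K x) = f x"
    using quotient_map_lift_exists[OF quotient_map_orbit_space f(1), of K] kf
    by (metis UNIV_I topspace_euclidean)
  have "homeomorphic_maps N (orbit_space K) h h'"
    using h h' unfolding homeomorphic_maps_def surj[symmetric] topspace_orbit_space by auto
  then have hh: "homeomorphic_map N (orbit_space K) h" using homeomorphic_map_maps by blast
  have "p y = orbit_down \<Gamma> (h y)" if "y \<in> topspace N" for y
  proof -
    obtain x where "y = f x" using \<open>y \<in> topspace N\<close> surj by (metis imageE)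
    then show ?thesis using h(2) f(2) orbit_down_orbit[OF dK KG] by simp
  qed
  then show ?thesis using that KG dK hh by blast
qed

text \<open>For the forward direction, an equivalence \<open>h\<close> composed with the projection
  to \<open>K\<close>-orbits lifts the projection to \<open>\<Gamma>\<close>-orbits, as does
  \<open>orbit_of L \<circ> g\<close> for every \<open>g\<close> in \<open>\<Gamma>\<close>. A
  suitable \<open>g\<close> makes the two agree at the origin, hence everywhere, and this
  \<open>g\<close> conjugates \<open>K\<close> to \<open>L\<close>.\<close>

lemma equivalent_coverings_orbit_iff:
  assumes K: "deck_group K" "K \<subseteq> \<Gamma>" and L: "deck_group L" "L \<subseteq> \<Gamma>"
  shows "equivalent_coverings (orbit_space K, orbit_down \<Gamma>) (orbit_space L, orbit_down \<Gamma>)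
    \<longleftrightarrow> (\<exists>g\<in>\<Gamma>. L = (\<lambda>k. g \<circ> k \<circ> finv g) ` K)"
proof
  interpret K: deck_group K by fact
  interpret L: deck_group L by fact
  assume "equivalent_coverings (orbit_space K, orbit_down \<Gamma>) (orbit_space L, orbit_down \<Gamma>)"
  then obtain h where h: "homeomorphic_map (orbit_space K) (orbit_space L) h"
    "\<And>x. orbit_of \<Gamma> x = orbit_down \<Gamma> (h (orbit_of K x))"
    using orbit_down_orbit[OF K] by (auto simp: equivalent_coverings_def topspace_orbit_space)
  have hc: "continuous_map euclidean (orbit_space L) (h \<circ> orbit_of K)"
    using h(1) K.continuous_orbit_of
    by (auto intro: continuous_map_compose homeomorphic_imp_continuous_map)
  obtain y where y: "h (orbit_of K 0) = orbit_of L y"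
    using homeomorphic_imp_surjective_map[OF h(1)] unfolding topspace_orbit_space
    by (metis imageE imageI rangeI)
  then have "orbit_of \<Gamma> 0 = orbit_of \<Gamma> y" using h(2)[of 0] orbit_down_orbit[OF L] by simp
  then obtain g where g: "g \<in> \<Gamma>" "y = g 0" using orbit_of_eq_iff by blast
  have gc: "continuous_map euclidean (orbit_space L) (orbit_of L \<circ> g)"
    using L.continuous_orbit_of cont[OF g(1)] by (intro continuous_map_compose[of _ euclidean]) auto
  have od: "orbit_down \<Gamma> ((h \<circ> orbit_of K) x) = orbit_down \<Gamma> ((orbit_of L \<circ> g) x)" for x
    using h(2)[of x] orbit_down_orbit[OF L, of "g x"] orbit_of_mult[OF g(1), of x] by simp
  have hg: "(h \<circ> orbit_of K) x = (orbit_of L \<circ> g) x" for x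
  proof (rule covering_map_lift_unique[OF covering_map_orbit_down[OF L] connected_UNIV _ _ od])
    show "(h \<circ> orbit_of K) 0 = (orbit_of L \<circ> g) 0" using y g by simp
  qed (use hc gc in \<open>simp_all only: subtopology_UNIV UNIV_I\<close>)
  have eq: "orbit_of K x = orbit_of K x' \<longleftrightarrow> orbit_of L (g x) = orbit_of L (g x')" for x x'
    using hg homeomorphic_imp_injective_map[OF h(1)]
    by (metis (no_types, opaque_lifting) comp_apply inj_onD rangeI topspace_orbit_space)
  have "L = (\<lambda>k. g \<circ> k \<circ> finv g) ` K"
  proof (intro Set.set_eqI iffI)
    fix l assume l: "l \<in> L"
    define k where "k = finv g \<circ> l \<circ> g"
    have k: "k \<in> \<Gamma>" using l L g inv_mem comp_mem by (auto simp: k_def)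
    have "g (k 0) = l (g 0)" using inv_mem(2)[OF g(1)] by (simp add: k_def)
    then have "orbit_of K (k 0) = orbit_of K 0" using eq L.orbit_of_mult[OF l] by simp
    then obtain k' where "k' \<in> K" "k 0 = k' 0" using K.orbit_of_eq_iff by metis
    then have "k \<in> K" using free[OF k] K(2) by blast
    moreover have "l = g \<circ> k \<circ> finv g"
      using inv_mem(2)[OF g(1)] by (auto simp: k_def)
    ultimately show "l \<in> (\<lambda>k. g \<circ> k \<circ> finv g) ` K" by blast
  next
    fix l assume "l \<in> (\<lambda>k. g \<circ> k \<circ> finv g) ` K"
    then obtain k where k: "k \<in> K" "l = g \<circ> k \<circ> finv g" by blast
    have lG: "l \<in> \<Gamma>" using k K(2) g inv_mem comp_mem by auto
    have "orbit_of L (g (k 0)) = orbit_of L (g 0)"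
      using eq[of "k 0" 0] K.orbit_of_mult[OF k(1)] by simp
    then obtain l' where l': "l' \<in> L" "g (k 0) = l' (g 0)" using L.orbit_of_eq_iff by metis
    moreover have "l (g 0) = g (k 0)" using k inv_mem(3)[OF g(1)] by simp
    ultimately have "l = l'" using free[OF lG] L(2) by (metis subsetD)
    then show "l \<in> L" using l' by simp
  qed
  then show "\<exists>g\<in>\<Gamma>. L = (\<lambda>k. g \<circ> k \<circ> finv g) ` K" using g by blast
next
  assume "\<exists>g\<in>\<Gamma>. L = (\<lambda>k. g \<circ> k \<circ> finv g) ` K"
  then obtain g where g: "g \<in> \<Gamma>" "L = (\<lambda>k. g \<circ> k \<circ> finv g) ` K" by blast
  note * = conj_homeomorphic_maps[OF cont[OF g(1)] cont[OF inv_mem(1)[OF g(1)]] inv_mem(4,5)[OF g(1)] g(2)]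
  have "homeomorphic_map (orbit_space K) (orbit_space L) ((`) g)"
    using *(1) homeomorphic_map_maps by blast
  moreover have "orbit_down \<Gamma> y = orbit_down \<Gamma> (g ` y)" if "y \<in> topspace (orbit_space K)" for y
    using that *(2) orbit_down_orbit[OF K] orbit_down_orbit[OF L] orbit_of_mult[OF g(1)]
    by (auto simp: topspace_orbit_space)
  ultimately show "equivalent_coverings (orbit_space K, orbit_down \<Gamma>) (orbit_space L, orbit_down \<Gamma>)"
    unfolding equivalent_coverings_def by auto
qed

end

text \<open>A homeomorphism and its inverse lift to maps \<open>f\<close> and \<open>g\<close> with \<open>g \<circ> f = id\<close>, and \<open>f\<close> intertwines each
  element of \<open>\<Gamma>\<close> with an element of \<open>K\<close>.\<close>

lemma homeomorphic_orbit_spaces_commute: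
  assumes K: "deck_group K" and G: "deck_group \<Gamma>"
    and hom: "orbit_space K homeomorphic_space orbit_space \<Gamma>"
    and comm: "\<And>k l. k \<in> K \<Longrightarrow> l \<in> K \<Longrightarrow> k \<circ> l = l \<circ> k"
    and ab: "a \<in> \<Gamma>" "b \<in> \<Gamma>"
  shows "a \<circ> b = b \<circ> a"
proof -
  interpret K: deck_group K by fact
  interpret G: deck_group \<Gamma> by fact
  obtain h h' where h: "homeomorphic_maps (orbit_space K) (orbit_space \<Gamma>) h h'"
    using hom homeomorphic_space_def by blast
  then have hc: "continuous_map (orbit_space K) (orbit_space \<Gamma>) h"
    "continuous_map (orbit_space \<Gamma>) (orbit_space K) h'"
    and hh: "\<And>x. h (h' (orbit_of \<Gamma> x)) = orbit_of \<Gamma> x"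
    by (auto simp: homeomorphic_maps_def topspace_orbit_space)
  have c1: "continuous_map euclidean (orbit_space K) (h' \<circ> orbit_of \<Gamma>)"
    using G.continuous_orbit_of hc(2) by (rule continuous_map_compose)
  have c2: "continuous_map euclidean (orbit_space \<Gamma>) (h \<circ> orbit_of K)"
    using K.continuous_orbit_of hc(1) by (rule continuous_map_compose)
  have "h' (orbit_of \<Gamma> 0) \<in> topspace (orbit_space K)"
    using continuous_map_image_subset_topspace[OF hc(2)] by (auto simp: topspace_orbit_space)
  then obtain y where "orbit_of K y = (h' \<circ> orbit_of \<Gamma>) 0" by (auto simp: topspace_orbit_space)
  then obtain f where f: "continuous_map euclidean euclidean f"
    "\<And>x. orbit_of K (f x) = h' (orbit_of \<Gamma> x)"
    using covering_map_lift[OF K.covering_map_orbit_of c1, of y 0] by (metis UNIV_I topspace_euclidean comp_apply)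
  have "orbit_of \<Gamma> 0 = (h \<circ> orbit_of K) (f 0)" using f(2) hh by simp
  then obtain g where g: "continuous_map euclidean euclidean g"
    "\<And>x. orbit_of \<Gamma> (g x) = h (orbit_of K x)" "g (f 0) = 0"
    using covering_map_lift[OF G.covering_map_orbit_of c2, of 0 "f 0"] by (metis UNIV_I topspace_euclidean comp_apply)
  \<comment> \<open>Both \<open>g \<circ> f\<close> and \<open>id\<close> lift the projection to
    \<open>\<Gamma>\<close>-orbits, and they agree at the origin.\<close>
  have gf: "(g \<circ> f) x = id x" for x
    by (rule covering_map_lift_unique[OF G.covering_map_orbit_of connected_UNIV, of _ _ 0])
      (use f g hh in \<open>auto simp: o_def id_def intro!: continuous_on_compose2[of UNIV g UNIV f]\<close>)
  have eqv: "\<exists>k\<in>K. f \<circ> c = k \<circ> f" if c: "c \<in> \<Gamma>" for c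
  proof -
    have e: "orbit_of K (f (c x)) = orbit_of K (f x)" for x
      using f(2) G.orbit_of_mult[OF c] by simp
    then obtain k where k: "k \<in> K" "f (c 0) = k (f 0)" using K.orbit_of_eq_iff by metis
    have "(f \<circ> c) x = (k \<circ> f) x" for x
      by (rule covering_map_lift_unique[OF K.covering_map_orbit_of connected_UNIV, of _ _ 0])
        (use f e k K.orbit_of_mult[OF k(1)] G.cont[OF c] K.cont[OF k(1)] in
          \<open>auto simp: o_def intro: continuous_on_compose2[of UNIV f UNIV c] continuous_on_compose2[of UNIV k UNIV f]\<close>)
    then show ?thesis using k(1) by blast
  qed
  obtain k where k: "k \<in> K" "f \<circ> a = k \<circ> f" using eqv[OF ab(1)] by blast
  obtain l where l: "l \<in> K" "f \<circ> b = l \<circ> f" using eqv[OF ab(2)] by blast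
  have "f \<circ> (a \<circ> b) = k \<circ> l \<circ> f" using k(2) l(2) by (metis comp_assoc)
  also have "\<dots> = l \<circ> k \<circ> f" using comm k(1) l(1) by metis
  also have "\<dots> = f \<circ> (b \<circ> a)" using k(2) l(2) by (metis comp_assoc)
  finally have "f ((a \<circ> b) x) = f ((b \<circ> a) x)" for x by (metis comp_apply)
  then have "(a \<circ> b) x = (b \<circ> a) x" for x using gf by (metis comp_apply id_apply)
  then show ?thesis by blast
qed

section \<open>Roots of \<open>s\<^sup>2 - s + 1\<close> modulo \<open>m\<close>\<close>

definition chi3 :: "nat \<Rightarrow> int" where "chi3 k = Legendre (int k) 3"

lemma chi3_eq: "chi3 k = (if k mod 3 = 0 then 0 else if k mod 3 = 1 then 1 else - 1)"
proof -
  have z: "[int k = 0] (mod 3) \<longleftrightarrow> k mod 3 = 0"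
    by (metis cong_0_iff mod_0_imp_dvd dvd_imp_mod_0 of_nat_dvd_iff of_nat_numeral)
  have q: "QuadRes 3 (int k) \<longleftrightarrow> k mod 3 = 1" if k: "k mod 3 \<noteq> 0"
  proof
    assume "QuadRes 3 (int k)"
    then obtain y :: int where y: "y ^ 2 mod 3 = int k mod 3" by (auto simp: QuadRes_def cong_def)
    have "y mod 3 = 0 \<or> y mod 3 = 1 \<or> y mod 3 = 2" by presburger
    then have "y ^ 2 mod 3 = 0 \<or> y ^ 2 mod 3 = 1"
      by (auto simp: power2_eq_square mod_mult_eq[of y 3 y, symmetric])
    then have "int (k mod 3) = 0 \<or> int (k mod 3) = 1" using y by (simp add: zmod_int)
    then show "k mod 3 = 1" using k by auto
  next
    assume k1: "k mod 3 = 1"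
    then have "int k mod 3 = 1 mod 3" by (metis mod_mod_trivial of_nat_1 of_nat_mod of_nat_numeral)
    then show "QuadRes 3 (int k)" unfolding QuadRes_def cong_def by (intro exI[of _ 1]) simp
  qed
  show ?thesis unfolding chi3_def Legendre_def using z q by auto
qed

lemma chi3_mult: "chi3 (m * n) = chi3 m * chi3 n"
proof -
  have "(m * n) mod 3 = ((m mod 3) * (n mod 3)) mod 3" by (simp add: mod_mult_eq)
  moreover have "m mod 3 = 0 \<or> m mod 3 = 1 \<or> m mod 3 = 2" "n mod 3 = 0 \<or> n mod 3 = 1 \<or> n mod 3 = 2"
    by presburger+
  ultimately show ?thesis unfolding chi3_eq by auto
qed

lemma chi3_1 [simp]: "chi3 1 = 1" "chi3 (Suc 0) = 1" by (simp_all add: chi3_eq)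

lemma chi3_power: "chi3 (p ^ i) = chi3 p ^ i"
  by (induction i) (auto simp: chi3_mult)

section \<open>Multiplicative functions and Dirichlet convolution\<close>

definition multiplicative :: "(nat \<Rightarrow> int) \<Rightarrow> bool" where
  "multiplicative f \<longleftrightarrow> f 1 = 1 \<and> (\<forall>m n. m > 0 \<longrightarrow> n > 0 \<longrightarrow> coprime m n \<longrightarrow> f (m * n) = f m * f n)"

definition dconv :: "(nat \<Rightarrow> int) \<Rightarrow> (nat \<Rightarrow> int) \<Rightarrow> nat \<Rightarrow> int" where
  "dconv f g n = (\<Sum>d | d dvd n. f d * g (n div d))"

lemma bij_betw_divisors_mult:
  fixes m n :: nat
  assumes "coprime m n"
  shows "bij_betw (\<lambda>(a, b). a * b) ({d. d dvd m} \<times> {d. d dvd n}) {d. d dvd m * n}"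
proof -
  \<comment> \<open>The factors are recovered from the product by taking gcds, which gives
    injectivity.\<close>
  have g: "gcd (a * b) m = a \<and> gcd (a * b) n = b" if "a dvd m" "b dvd n" for a b
  proof -
    have "coprime b m" "coprime a n" using that assms coprime_divisors coprime_commute
      by (metis dvd_refl)+
    then show ?thesis using that
      by (simp add: gcd_mult_right_right_cancel gcd_mult_left_right_cancel gcd_mult_left_left_cancel
          gcd_proj1_iff coprime_commute)
  qed
  show ?thesis
  proof (rule bij_betwI')
    fix x y assume "x \<in> {d. d dvd m} \<times> {d. d dvd n}" "y \<in> {d. d dvd m} \<times> {d. d dvd n}"
    then show "((case x of (a, b) \<Rightarrow> a * b) = (case y of (a, b) \<Rightarrow> a * b)) = (x = y)"
      using g by (cases x; cases y) (metis SigmaE2 case_prod_conv mem_Collect_eq)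
  next
    fix y assume "y \<in> {d. d dvd m * n}"
    then obtain b c where "y = b * c" "b dvd m" "c dvd n" using division_decomp[of y m n] by auto
    then show "\<exists>x\<in>{d. d dvd m} \<times> {d. d dvd n}. y = (case x of (a, b) \<Rightarrow> a * b)" by auto
  qed (auto intro: mult_dvd_mono)
qed

lemma multiplicative_dconv:
  assumes f: "multiplicative f" and g: "multiplicative g"
  shows "multiplicative (dconv f g)"
  unfolding multiplicative_def
proof (intro conjI allI impI)
  show "dconv f g 1 = 1" using f g by (simp add: dconv_def multiplicative_def)
  fix m n :: nat assume mn: "m > 0" "n > 0" "coprime m n"
  have "dconv f g (m * n) = (\<Sum>(a, b)\<in>{d. d dvd m} \<times> {d. d dvd n}. f (a * b) * g (m * n div (a * b)))"
    unfolding dconv_def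
    by (subst sum.reindex_bij_betw[OF bij_betw_divisors_mult[OF mn(3)], symmetric])
      (auto intro: sum.cong)
  also have "\<dots> = (\<Sum>(a, b)\<in>{d. d dvd m} \<times> {d. d dvd n}. (f a * g (m div a)) * (f b * g (n div b)))"
  proof (rule sum.cong[OF HOL.refl], clarify)
    fix a b assume ab: "a dvd m" "b dvd n"
    have pos: "a > 0" "b > 0" "m div a > 0" "n div b > 0"
      using ab mn by (auto intro: dvd_pos_nat simp: div_greater_zero_iff dvd_imp_le)
    have "coprime a b" "coprime (m div a) (n div b)"
      using coprime_divisors[OF _ _ mn(3)] ab dvd_div_mult_self[OF ab(1)] dvd_div_mult_self[OF ab(2)]
      by (blast, metis dvd_triv_left)
    moreover have "m * n div (a * b) = (m div a) * (n div b)"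
      using ab by (simp add: div_mult_div_if_dvd)
    ultimately show "f (a * b) * g (m * n div (a * b)) = (f a * g (m div a)) * (f b * g (n div b))"
      using f g pos by (simp add: multiplicative_def)
  qed
  also have "\<dots> = dconv f g m * dconv f g n"
    by (simp add: dconv_def sum_product sum.cartesian_product)
  finally show "dconv f g (m * n) = dconv f g m * dconv f g n" .
qed

text \<open>Split off from \<open>k\<close> the full power of one prime and recurse on the coprime
  cofactor.\<close>

lemma multiplicative_eqI:
  assumes f: "multiplicative f" and g: "multiplicative g"
    and eq: "\<And>p i. prime p \<Longrightarrow> f (p ^ Suc i) = g (p ^ Suc i)" and "k > 0"
  shows "f k = g k"
  using \<open>k > 0\<close>
proof (induction k rule: less_induct)
  case (less k)
  show ?case
  proof (cases "k = 1")
    case True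
    then show ?thesis using f g by (simp add: multiplicative_def)
  next
    case False
    then obtain p where p: "prime p" "p dvd k" using prime_factor_nat by blast
    define a where "a = multiplicity p k"
    have "k \<noteq> 0" "\<not> is_unit p" using less.prems p(1) by (auto dest: not_prime_unit)
    then obtain m where m: "k = p ^ a * m" "\<not> p dvd m"
      using multiplicity_decompose'[of k p] unfolding a_def by blast
    have "a > 0" using p m by (cases a) auto
    then obtain i where i: "a = Suc i" by (cases a) auto
    have m0: "m > 0" using less.prems m by (cases m) auto
    have "coprime p m" using m(2) p(1) prime_imp_coprime by blast
    then have co: "coprime (p ^ a) m" by simp
    have "p ^ a > 1" using p(1) \<open>a > 0\<close> by (metis one_less_power prime_gt_1_nat)
    then have "m < k" using m m0 by simp
    then have "f m = g m" using less.IH m0 by blast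
    moreover have "f (p ^ a) = g (p ^ a)" using eq[OF p(1)] i by simp
    moreover have "p ^ a > 0" using \<open>p ^ a > 1\<close> by linarith
    ultimately show ?thesis
      using f g co m0 unfolding m(1) multiplicative_def by metis
  qed
qed

lemma dconv_prime_power:
  assumes "prime p"
  shows "dconv f g (p ^ a) = (\<Sum>i\<le>a. f (p ^ i) * g (p ^ (a - i)))"
proof -
  have inj: "inj_on (\<lambda>i. p ^ i) {..a}"
    using assms by (auto intro!: inj_onI dest: power_inject_exp[OF prime_gt_1_nat, THEN iffD1, rotated])
  have "{d. d dvd p ^ a} = (\<lambda>i. p ^ i) ` {..a}"
    using divides_primepow_nat[OF assms] by (auto intro: le_imp_power_dvd)
  then show ?thesis
    unfolding dconv_def using inj assms
    by (simp add: sum.reindex o_def power_diff prime_gt_0_nat)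
qed

text \<open>The value \<open>s^2 - s + 1\<close> is the norm of \<open>s + om\<close>; the root
  condition says that the lattice spanned by \<open>m\<close> and \<open>s + om\<close> is an
  ideal.\<close>

definition eroots :: "nat \<Rightarrow> int set" where
  "eroots m = {s. 0 \<le> s \<and> s < int m \<and> int m dvd s^2 - s + 1}"

lemma finite_eroots: "finite (eroots m)"
  by (rule finite_subset[of _ "{0..<int m}"]) (auto simp: eroots_def)

lemma eroot_shift:
  fixes s t m :: int
  assumes "m dvd s - t"
  shows "m dvd s^2 - s + 1 \<longleftrightarrow> m dvd t^2 - t + 1"
proof -
  have "(s^2 - s + 1) - (t^2 - t + 1) = (s - t) * (s + t - 1)" by (simp add: algebra_simps power2_eq_square)
  then have "m dvd (s^2 - s + 1) - (t^2 - t + 1)" using assms by simp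
  then show ?thesis by (metis dvd_diff_right_iff dvd_diff_commute dvd_diff_left_iff)
qed

lemma eroot_mod: "int m dvd (s mod int m)^2 - s mod int m + 1 \<longleftrightarrow> int m dvd s^2 - s + 1"
  by (rule eroot_shift) (metis dvd_diff_commute dvd_minus_mod)

text \<open>The polynomial has discriminant -3 and derivative \<open>2 * s - 1\<close>; the identity
  \<open>4 * (s^2 - s + 1) - (2 * s - 1)^2 = 3\<close> shows that its roots are simple modulo primes
  other than 3.\<close>

lemma eroot_discriminant:
  fixes d s :: int
  assumes "d dvd s^2 - s + 1" "d dvd 2 * s - 1"
  shows "d dvd 3"
proof -
  have "d dvd 4 * (s^2 - s + 1)" using assms(1) by (rule dvd_mult)
  moreover have "d dvd (2 * s - 1) * (2 * s - 1)" using assms(2) by (rule dvd_mult2)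
  ultimately have "d dvd 4 * (s^2 - s + 1) - (2 * s - 1) * (2 * s - 1)" by (rule dvd_diff)
  then show ?thesis by (simp add: algebra_simps power2_eq_square)
qed

lemma card_eroots_mult:
  assumes "m > 0" "n > 0" "coprime m n"
  shows "card (eroots (m * n)) = card (eroots m) * card (eroots n)"
proof -
  have co: "coprime (int m) (int n)" using assms by simp
  have "bij_betw (\<lambda>s. (s mod int m, s mod int n)) (eroots (m * n)) (eroots m \<times> eroots n)"
    unfolding bij_betw_def
  proof
    show "inj_on (\<lambda>s. (s mod int m, s mod int n)) (eroots (m * n))"
    proof (rule inj_onI)
      fix s t assume st: "s \<in> eroots (m * n)" "t \<in> eroots (m * n)"
        and eq: "(s mod int m, s mod int n) = (t mod int m, t mod int n)"
      have "int m dvd s - t" "int n dvd s - t" using eq by (auto simp: mod_eq_dvd_iff)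
      then have "int m * int n dvd s - t" using co divides_mult by blast
      moreover have "\<bar>s - t\<bar> < int m * int n" using st by (auto simp: eroots_def)
      ultimately have "s - t = 0"
        using dvd_imp_le_int[of "s - t" "int m * int n"] by (auto simp: abs_mult)
      then show "s = t" by simp
    qed
    show "(\<lambda>s. (s mod int m, s mod int n)) ` eroots (m * n) = eroots m \<times> eroots n"
    proof (intro equalityI subsetI)
      fix z assume "z \<in> (\<lambda>s. (s mod int m, s mod int n)) ` eroots (m * n)"
      then obtain s where s: "s \<in> eroots (m * n)" "z = (s mod int m, s mod int n)" by blast
      have "int m * int n dvd s^2 - s + 1" using s(1) by (auto simp: eroots_def)
      then have "int m dvd s^2 - s + 1" "int n dvd s^2 - s + 1"
        using dvd_mult_left dvd_mult_right by blast+
      then show "z \<in> eroots m \<times> eroots n"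
        using s(2) assms by (simp add: eroots_def eroot_mod)
    next
      fix z assume "z \<in> eroots m \<times> eroots n"
      then obtain a b where ab: "z = (a, b)" "a \<in> eroots m" "b \<in> eroots n" by auto
      obtain x where x: "[x = a] (mod int m)" "[x = b] (mod int n)"
        using binary_chinese_remainder_int[OF co] by blast
      define s where "s = x mod (int m * int n)"
      have sm: "s mod int m = a" "s mod int n = b"
        using x ab by (simp_all add: s_def cong_def eroots_def mod_mod_cancel)
      have "int m dvd s^2 - s + 1" "int n dvd s^2 - s + 1"
        using ab sm eroot_mod[of m s] eroot_mod[of n s] by (auto simp: eroots_def)
      then have "int m * int n dvd s^2 - s + 1" using co divides_mult by blast
      then have "s \<in> eroots (m * n)" using assms by (simp add: eroots_def s_def)
      then show "z \<in> (\<lambda>s. (s mod int m, s mod int n)) ` eroots (m * n)" using sm ab(1) by blast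
    qed
  qed
  then show ?thesis by (simp add: bij_betw_same_card card_cartesian_product)
qed

text \<open>For a primitive root \<open>g\<close>, the power \<open>x = g ^ ((p - 1) div 3)\<close>
  is a nontrivial cube root of 1, so \<open>x^2 + x + 1\<close> vanishes modulo \<open>p\<close> and
  \<open>- x\<close> is the root sought.\<close>

lemma cube_root_mod_prime:
  assumes p: "prime p" "p mod 3 = 1"
  shows "\<exists>s. int p dvd s^2 - s + 1"
proof -
  obtain g where g: "residue_primroot p g" using prime_primitive_root_exists[of p] p prime_gt_1_nat by blast
  have p1: "p > 1" using prime_gt_1_nat[OF p(1)] .
  define k where "k = (p - 1) div 3"
  have k: "p - 1 = 3 * k" using p(2) p1 unfolding k_def by presburger
  have og: "ord p g = p - 1" using g p(1) by (simp add: residue_primroot_def totient_prime)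
  define x where "x = int g ^ k"
  have "[g ^ (3 * k) = 1] (mod p)" using ord_divides[of g "3 * k" p] og k by simp
  then have "[int (g ^ (3 * k)) = int 1] (mod int p)" by (simp only: cong_int_iff)
  then have "int p dvd x ^ 3 - 1" by (simp add: x_def cong_iff_dvd_diff power_mult[symmetric] mult.commute)
  moreover have "x ^ 3 - 1 = (x - 1) * (x^2 + x + 1)" by (simp add: algebra_simps power2_eq_square power3_eq_cube)
  moreover have "\<not> int p dvd x - 1"
  proof
    assume "int p dvd x - 1"
    then have "[int (g ^ k) = int 1] (mod int p)" by (simp add: x_def cong_iff_dvd_diff)
    then have "[g ^ k = 1] (mod p)" by (simp only: cong_int_iff)
    then have "p - 1 dvd k" using ord_divides og by metis
    moreover have "k > 0" "k < p - 1" using k p1 by linarith+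
    ultimately show False using dvd_imp_le by fastforce
  qed
  ultimately have "int p dvd x^2 + x + 1" using p(1) prime_dvd_mult_iff[of "int p"] by auto
  then have "int p dvd (- x)^2 - (- x) + 1" by simp
  then show ?thesis by blast
qed

text \<open>A root satisfies \<open>s ^ 3 = - 1\<close> modulo \<open>p\<close>. Since
  \<open>p - 1\<close> is 1 modulo 3, Fermat's theorem then forces \<open>s\<close> to be 1 or -1,
  where the polynomial takes the values 1 and 3.\<close>

lemma no_eroot_mod_prime:
  assumes p: "prime p" "p mod 3 = 2"
  shows "\<not> int p dvd s^2 - s + 1"
proof
  assume d: "int p dvd s^2 - s + 1"
  have p1: "p > 1" using prime_gt_1_nat[OF p(1)] .
  have p3: "\<not> int p dvd 3"
  proof
    assume "int p dvd 3"
    then have "p dvd 3" by (metis of_nat_dvd_iff of_nat_numeral)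
    then have "p = 1 \<or> p = 3" using prime_nat_iff[of 3] by auto
    then show False using p p1 by auto
  qed
  have nd: "\<not> int p dvd s"
  proof
    assume "int p dvd s"
    then have "int p dvd s * (s - 1)" by simp
    then have "int p dvd (s^2 - s + 1) - s * (s - 1)" using d by (rule dvd_diff[rotated])
    then show False using p1 by (simp add: algebra_simps power2_eq_square)
  qed
  define k where "k = p div 3"
  have k: "p - 1 = 3 * k + 1" using p(2) p1 unfolding k_def by presburger
  have "s ^ 3 + 1 = (s + 1) * (s^2 - s + 1)" by (simp add: algebra_simps power2_eq_square power3_eq_cube)
  then have "int p dvd s ^ 3 - (- 1)" using d by simp
  then have "[s ^ 3 = - 1] (mod int p)" by (simp only: cong_iff_dvd_diff)
  then have "[(s ^ 3) ^ k * s = (- 1) ^ k * s] (mod int p)" by (intro cong_scalar_right cong_pow)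
  moreover have "[s ^ (p - 1) = 1] (mod int p)"
  proof -
    define a where "a = nat (s mod int p)"
    have a: "int a = s mod int p" using p1 by (simp add: a_def)
    then have "[s = int a] (mod int p)" by (simp add: cong_def)
    moreover have "\<not> p dvd a"
      using nd a by (metis dvd_mod_iff dvd_refl of_nat_dvd_iff)
    then have "[a ^ (p - 1) = 1] (mod p)" using fermat_theorem p(1) by blast
    then have "[int a ^ (p - 1) = 1] (mod int p)" by (metis cong_int_iff of_nat_1 of_nat_power)
    ultimately show ?thesis using cong_pow cong_trans by blast
  qed
  ultimately have c: "[(- 1) ^ k * s = 1] (mod int p)"
    unfolding k by (simp add: power_add power_mult) (metis cong_sym cong_trans mult.commute)
  have "int p dvd s - 1 \<or> int p dvd s + 1"
  proof (cases "even k")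
    case True
    then show ?thesis using c by (simp add: cong_iff_dvd_diff)
  next
    case False
    then have "int p dvd - s - 1" using c by (simp add: cong_iff_dvd_diff)
    then have "int p dvd - (- s - 1)" by (simp only: dvd_minus_iff)
    then show ?thesis by (simp add: add.commute)
  qed
  then show False
  proof
    assume "int p dvd s - 1"
    then have "int p dvd (s^2 - s + 1) - (s - 1) * s" using d by (intro dvd_diff) auto
    then show False using p1 by (simp add: algebra_simps power2_eq_square)
  next
    assume "int p dvd s + 1"
    then have "int p dvd (s^2 - s + 1) - (s + 1) * (s - 2)" using d by (intro dvd_diff) auto
    then show False using p3 by (simp add: algebra_simps power2_eq_square)
  qed
qed

text \<open>Hensel lifting: \<open>t\<close> is the Newton step from \<open>s\<close>, with
  \<open>u\<close> an inverse of the derivative \<open>2 * s - 1\<close> modulo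
  \<open>p\<close>.\<close>

lemma eroot_lift:
  assumes p: "prime p" "p mod 3 = 1"
  shows "\<exists>s. int p ^ Suc i dvd s^2 - s + 1"
proof (induction i)
  case 0
  then show ?case using cube_root_mod_prime[OF p] by simp
next
  case (Suc i)
  then obtain s where s: "int p ^ Suc i dvd s^2 - s + 1" by blast
  then obtain q where q: "s^2 - s + 1 = int p ^ Suc i * q" by blast
  have "int p dvd s^2 - s + 1" by (rule dvd_trans[OF _ s]) simp
  have pp: "prime (int p)" using p(1) by simp
  have "\<not> int p dvd 2 * s - 1"
  proof
    assume "int p dvd 2 * s - 1"
    then have "int p dvd 3"
      using \<open>int p dvd s^2 - s + 1\<close> eroot_discriminant by blast
    then have "p dvd 3" by (metis of_nat_dvd_iff of_nat_numeral)
    then have "p = 1 \<or> p = 3" using prime_nat_iff[of 3] by auto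
    then show False using p prime_gt_1_nat[OF p(1)] by auto
  qed
  then have "coprime (2 * s - 1) (int p)" using pp prime_imp_coprime coprime_commute by blast
  then obtain u where u: "[(2 * s - 1) * u = 1] (mod int p)" using cong_solve_coprime_int by blast
  then obtain w where w: "(2 * s - 1) * u - 1 = int p * w" by (auto simp: cong_iff_dvd_diff)
  define P where "P = int p ^ Suc i"
  have PP: "int p * P dvd P * P" unfolding P_def by simp
  define t where "t = s - P * (q * u)"
  have "t^2 - t + 1 = (s^2 - s + 1) - P * q * ((2 * s - 1) * u) + P * P * (q * u)^2"
    by (simp add: t_def algebra_simps power2_eq_square)
  also have "(2 * s - 1) * u = 1 + int p * w" using w by simp
  also have "(s^2 - s + 1) - P * q * (1 + int p * w) + P * P * (q * u)^2
      = P * P * (q * u)^2 - int p * P * (q * w)"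
    unfolding q P_def[symmetric] by (simp add: algebra_simps)
  finally have "int p * P dvd t^2 - t + 1" using PP by (metis dvd_diff dvd_mult2 dvd_triv_left)
  then show ?case by (intro exI[of _ t]) (simp add: P_def)
qed

text \<open>With \<open>s\<close> also \<open>1 - s\<close> is a root. For a further root
  \<open>x\<close> the difference of the two values factors as \<open>(x - s) * (x + s - 1)\<close>;
  the factors add up to the derivative \<open>2 * x - 1\<close>, which is prime to \<open>p\<close>,
  so the whole power of \<open>p\<close> divides one of them.\<close>

lemma card_eroots_prime_power_1:
  assumes p: "prime p" "p mod 3 = 1"
  shows "card (eroots (p ^ Suc i)) = 2"
proof -
  let ?P = "int (p ^ Suc i)"
  have pp: "prime (int p)" using p(1) by simp
  have p3: "\<not> int p dvd 3"
  proof
    assume "int p dvd 3"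
    then have "p dvd 3" by (metis of_nat_dvd_iff of_nat_numeral)
    then have "p = 1 \<or> p = 3" using prime_nat_iff[of 3] by auto
    then show False using p prime_gt_1_nat[OF p(1)] by auto
  qed
  have P0: "?P > 0" using p(1) by (simp add: prime_gt_0_nat)
  have pP: "int p dvd ?P" by simp
  have nd: "\<not> int p dvd 2 * x - 1" if "?P dvd x^2 - x + 1" for x
  proof
    assume "int p dvd 2 * x - 1"
    moreover have "int p dvd x^2 - x + 1" using that pP dvd_trans by blast
    ultimately show False using p3 eroot_discriminant by blast
  qed
  obtain s0 where s0: "?P dvd s0^2 - s0 + 1" using eroot_lift[OF p, of i] by auto
  define s where "s = s0 mod ?P"
  define t where "t = (1 - s) mod ?P"
  have s: "?P dvd s^2 - s + 1" "0 \<le> s" "s < ?P" using s0 P0 eroot_mod[of "p ^ Suc i"] by (simp_all add: s_def)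
  have "?P dvd (1 - s)^2 - (1 - s) + 1" using s(1) by (simp add: algebra_simps power2_eq_square)
  then have t: "?P dvd t^2 - t + 1" "0 \<le> t" "t < ?P" using P0 eroot_mod[of "p ^ Suc i"] by (simp_all add: t_def)
  have ts: "?P dvd (1 - s) - t" unfolding t_def by (rule dvd_minus_mod)
  have "s \<noteq> t"
  proof
    assume "s = t"
    then have "?P dvd - (2 * s - 1)" using ts by simp
    then have "int p dvd 2 * s - 1" using pP dvd_trans by (metis dvd_minus_iff)
    then show False using nd[OF s(1)] by blast
  qed
  moreover have "eroots (p ^ Suc i) = {s, t}"
  proof (intro equalityI subsetI)
    fix x assume "x \<in> eroots (p ^ Suc i)"
    then have x: "?P dvd x^2 - x + 1" "0 \<le> x" "x < ?P" by (auto simp: eroots_def)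
    have "?P dvd (x^2 - x + 1) - (s^2 - s + 1)" using x(1) s(1) by (rule dvd_diff)
    also have "(x^2 - x + 1) - (s^2 - s + 1) = (x - s) * (x + s - 1)"
      by (simp add: algebra_simps power2_eq_square)
    finally have d: "?P dvd (x - s) * (x + s - 1)" .
    have bd: "u = v" if "?P dvd u - v" "0 \<le> u" "u < ?P" "0 \<le> v" "v < ?P" for u v
      using that by (metis mod_eq_dvd_iff mod_pos_pos_trivial)
    show "x \<in> {s, t}"
    proof (cases "int p dvd x - s")
      case True
      then have "\<not> int p dvd x + s - 1"
        using nd[OF x(1)] dvd_add[of "int p" "x - s" "x + s - 1"] by (auto simp: algebra_simps)
      then have "coprime ?P (x + s - 1)"
        using pp prime_imp_coprime coprime_power_left_iff by (metis of_nat_power)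
      then have "?P dvd x - s" using d coprime_dvd_mult_left_iff by blast
      then show ?thesis using bd x s by blast
    next
      case False
      then have "coprime ?P (x - s)" using pp prime_imp_coprime coprime_power_left_iff by (metis of_nat_power)
      then have "?P dvd x + s - 1" using d coprime_dvd_mult_right_iff by blast
      then have "?P dvd (x + s - 1) + ((1 - s) - t)" using ts by (rule dvd_add)
      then have "?P dvd x - t" by simp
      then show ?thesis using bd x t by blast
    qed
  qed (use s t in \<open>auto simp: eroots_def\<close>)
  ultimately show ?thesis by simp
qed

text \<open>The count is 2, 0, or for \<open>p = 3\<close> it is 1 and then 0. As a sum of two
  successive values of the character it fits the step by two exponents in the convolution with
  squares.\<close>

lemma card_eroots_prime_power:
  assumes p: "prime p"
  shows "int (card (eroots (p ^ Suc i))) = chi3 (p ^ i) + chi3 (p ^ Suc i)"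
proof -
  consider "p mod 3 = 1" | "p mod 3 = 2" | "p mod 3 = 0" by linarith
  then show ?thesis
  proof cases
    case 1
    then show ?thesis using card_eroots_prime_power_1[OF p 1, of i] by (simp only: chi3_power) (simp add: chi3_eq)
  next
    case 2
    have "\<not> int (p ^ Suc i) dvd s^2 - s + 1" for s
      using no_eroot_mod_prime[OF p 2, of s] by (metis dvd_mult_left of_nat_power power_Suc)
    then have "eroots (p ^ Suc i) = {}" by (auto simp: eroots_def)
    moreover have "chi3 p = - 1" using 2 by (simp add: chi3_eq)
    ultimately show ?thesis by (simp only: chi3_power) simp
  next
    case 3
    then have "3 dvd p" by (simp add: mod_eq_0_iff_dvd)
    then have "(3::nat) = 1 \<or> 3 = p" using p unfolding prime_nat_iff by blast
    then have p3: "p = 3" by simp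
    show ?thesis
    proof (cases i)
      case 0
      have "eroots 3 = {2}"
      proof (intro equalityI subsetI)
        fix s assume "s \<in> eroots 3"
        then have "0 \<le> s" "s < 3" "3 dvd s^2 - s + 1" by (auto simp: eroots_def)
        then have "(s = 0 \<or> s = 1 \<or> s = 2) \<and> 3 dvd s^2 - s + 1" by auto
        then show "s \<in> {2}" by auto
      qed (auto simp: eroots_def)
      then show ?thesis unfolding 0 p3 by (simp add: chi3_eq)
    next
      case (Suc j)
      have "\<not> int (p ^ Suc i) dvd s^2 - s + 1" for s
      proof
        assume "int (p ^ Suc i) dvd s^2 - s + 1"
        moreover have "(9::int) dvd int (p ^ Suc i)" unfolding p3 Suc by simp
        ultimately have "9 dvd s^2 - s + 1" using dvd_trans by blast
        then have "9 dvd (s mod 9)^2 - s mod 9 + 1" using eroot_mod[of 9 s] by simp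
        moreover have "s mod 9 \<in> {0,1,2,3,4,5,6,7,8}" by simp presburger
        ultimately show False by auto
      qed
      then have "eroots (p ^ Suc i) = {}" by (auto simp: eroots_def)
      then show ?thesis unfolding p3 Suc by (simp add: chi3_eq)
    qed
  qed
qed

definition sq_ind :: "nat \<Rightarrow> int" where "sq_ind n = (if is_nth_power 2 n then 1 else 0)"

lemma multiplicative_sq_ind: "multiplicative sq_ind"
  by (auto simp: multiplicative_def sq_ind_def is_nth_power_mult_coprime_nat_iff)

lemma multiplicative_eroots: "multiplicative (\<lambda>m. int (card (eroots m)))"
proof -
  have "eroots 1 = {0}" by (auto simp: eroots_def)
  then show ?thesis by (auto simp: multiplicative_def card_eroots_mult)
qed

text \<open>At a prime power only exponents of the parity of \<open>a\<close> survive in the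
  convolution, so passing from \<open>a - 2\<close> to \<open>a\<close> adds just the number of
  roots modulo \<open>p ^ a\<close>. That number is
  \<open>chi3 (p ^ (a - 1)) + chi3 (p ^ a)\<close>, which is what the character sum gains.\<close>

theorem dconv_eroots_eq:
  assumes "k > 0"
  shows "dconv (\<lambda>m. int (card (eroots m))) sq_ind k = (\<Sum>d | d dvd k. chi3 d)"
proof -
  let ?r = "\<lambda>m. int (card (eroots m))"
  have 1: "multiplicative chi3" "multiplicative (\<lambda>_. 1)" by (auto simp: multiplicative_def chi3_mult)
  have r1: "?r (Suc 0) = 1" using multiplicative_eroots by (simp add: multiplicative_def)
  have "dconv ?r sq_ind k = dconv chi3 (\<lambda>_. 1) k"
  proof (rule multiplicative_eqI[OF multiplicative_dconv multiplicative_dconv _ assms])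
    fix p i :: nat assume p: "prime p"
    have sq: "sq_ind (p ^ j) = (if even j then 1 else 0)" for j
      using is_nth_power_prime_power_nat_iff[OF p, of 2 j] by (simp add: sq_ind_def)
    have "(\<Sum>i\<le>a. ?r (p ^ i) * sq_ind (p ^ (a - i))) = (\<Sum>i\<le>a. chi3 (p ^ i))" for a
    proof (induction a rule: less_induct)
      case (less a)
      consider "a = 0" | "a = 1" | b where "a = Suc (Suc b)"
        by (metis One_nat_def not0_implies_Suc)
      then show ?case
      proof cases
        case 1
        then show ?thesis using r1 by (simp add: sq_ind_def)
      next
        case 2
        then show ?thesis using card_eroots_prime_power[OF p, of 0] by (simp add: sq)
      next
        case (3 b)
        have "(\<Sum>i\<le>b. ?r (p ^ i) * sq_ind (p ^ (a - i))) = (\<Sum>i\<le>b. ?r (p ^ i) * sq_ind (p ^ (b - i)))"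
        proof (rule sum.cong[OF HOL.refl])
          fix x assume "x \<in> {..b}"
          then have "even (a - x) \<longleftrightarrow> even (b - x)" by (simp add: 3)
          then show "?r (p ^ x) * sq_ind (p ^ (a - x)) = ?r (p ^ x) * sq_ind (p ^ (b - x))"
            unfolding sq by simp
        qed
        also have "\<dots> = (\<Sum>i\<le>b. chi3 (p ^ i))" using less[of b] 3 by simp
        finally show ?thesis
          using card_eroots_prime_power[OF p, of "Suc b"] by (simp add: 3 sq)
      qed
    qed
    then show "dconv ?r sq_ind (p ^ Suc i) = dconv chi3 (\<lambda>_. 1) (p ^ Suc i)"
      unfolding dconv_prime_power[OF p] by simp
  qed (use 1 multiplicative_sq_ind multiplicative_eroots in auto)
  then show ?thesis by (simp add: dconv_def)
qed

section \<open>Sublattices of the Eisenstein integers\<close>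

definition om :: complex where "om = cis (2 * pi / 3)"

lemma om_Re_Im: "Re om = - 1 / 2" "Im om = sqrt 3 / 2"
  by (simp_all add: om_def cos_120 sin_120)

lemma om_sq: "om * om = - 1 - om"
  by (rule complex_eqI) (simp_all only: om_Re_Im times_complex.simps minus_complex.simps uminus_complex.simps
      one_complex.simps, simp_all add: field_simps)

lemma om_cubed: "om * (om * om) = 1"
  unfolding om_sq by (simp add: right_diff_distrib om_sq)

lemma om_neq [simp]: "om \<noteq> 0" "om \<noteq> 1"
  using om_Re_Im(2) by (auto simp: complex_eq_iff)

definition eis :: "int \<Rightarrow> int \<Rightarrow> complex" where "eis a b = of_int a + of_int b * om"

definition Eis :: "complex set" where "Eis = {eis a b |a b. True}"

lemma eis_Re_Im: "Re (eis a b) = of_int a - of_int b / 2" "Im (eis a b) = of_int b * sqrt 3 / 2"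
  unfolding eis_def by (simp_all only: om_Re_Im times_complex.simps plus_complex.simps) auto

lemma eis_eq_iff [simp]: "eis a b = eis c d \<longleftrightarrow> a = c \<and> b = d"
  by (auto simp: complex_eq_iff eis_Re_Im)

lemma eis_0: "0 = eis 0 0" and eis_1: "1 = eis 1 0" and eis_om: "om = eis 0 1"
  by (simp_all add: eis_def)

lemma eis_add: "eis a b + eis c d = eis (a + c) (b + d)"
  and eis_diff: "eis a b - eis c d = eis (a - c) (b - d)"
  and eis_minus: "- eis a b = eis (- a) (- b)"
  by (simp_all add: eis_def algebra_simps)

lemma eis_of_int: "of_int k = eis k 0" by (simp add: eis_def)

lemma eis_mult: "eis a b * eis c d = eis (a * c - b * d) (a * d + b * c - b * d)"
proof -
  have "eis a b * eis c d = of_int (a * c) + of_int (a * d + b * c) * om + of_int (b * d) * (om * om)"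
    by (simp add: eis_def algebra_simps)
  also have "\<dots> = eis (a * c - b * d) (a * d + b * c - b * d)"
    unfolding om_sq by (simp add: eis_def algebra_simps)
  finally show ?thesis .
qed

lemma om_mult_eis: "om * eis a b = eis (- b) (a - b)"
  unfolding eis_om eis_mult by simp

lemma eis_in [simp, intro]: "eis a b \<in> Eis" by (auto simp: Eis_def)

lemma Eis_E: assumes "u \<in> Eis" obtains a b where "u = eis a b"
  using assms by (auto simp: Eis_def)

lemma Eis_closed [simp, intro]:
  "0 \<in> Eis" "1 \<in> Eis" "om \<in> Eis" "of_int k \<in> Eis"
  "u \<in> Eis \<Longrightarrow> v \<in> Eis \<Longrightarrow> u + v \<in> Eis" "u \<in> Eis \<Longrightarrow> v \<in> Eis \<Longrightarrow> u - v \<in> Eis"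
  "u \<in> Eis \<Longrightarrow> - u \<in> Eis" "u \<in> Eis \<Longrightarrow> v \<in> Eis \<Longrightarrow> u * v \<in> Eis"
  by (auto simp: eis_0 eis_1 eis_om eis_of_int eis_add eis_diff eis_minus eis_mult elim!: Eis_E)

lemma rot_3: "om powi 3 = 1"
  using om_cubed by (simp add: power3_eq_cube mult.assoc)

lemma rot_mult3 [simp]: "om powi (3 * k) = 1"
  by (simp only: power_int_mult rot_3 power_int_1_left)

lemma rot_mod3: "om powi c = om powi (c mod 3)"
proof -
  have "om powi c = om powi (3 * (c div 3) + c mod 3)" by simp
  also have "\<dots> = om powi (c mod 3)" by (subst power_int_add) simp_all
  finally show ?thesis .
qed

lemma rot_cases: "om powi c \<in> {1, om, - 1 - om}"
proof -
  have "c mod 3 = 0 \<or> c mod 3 = 1 \<or> c mod 3 = 2" by presburger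
  then show ?thesis
    by (subst rot_mod3) (auto simp: om_sq[symmetric] power2_eq_square)
qed

lemma rot_eq_1_iff: "om powi c = 1 \<longleftrightarrow> 3 dvd c"
proof -
  have "c mod 3 = 0 \<or> c mod 3 = 1 \<or> c mod 3 = 2" by presburger
  moreover have "- 1 - om \<noteq> 1"
    using om_Re_Im(2) by (auto simp: complex_eq_iff)
  ultimately show ?thesis
    by (subst rot_mod3) (auto simp: om_sq power2_eq_square dvd_eq_mod_eq_0)
qed

lemma rot_in [simp, intro]: "om powi c \<in> Eis"
  using rot_cases[of c] by auto

lemma rot_add: "om powi (c + d) = om powi c * om powi d"
  by (rule power_int_add) simp

lemma rot_minus: "om powi (- c) * om powi c = 1" "om powi c * om powi (- c) = 1"
  by (simp_all add: rot_add[symmetric])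

text \<open>Any additive subgroup of the Eisenstein integers; full rank enters only through the
  finiteness of \<open>cosets\<close>.\<close>

definition sublattice :: "complex set \<Rightarrow> bool" where
  "sublattice \<Lambda> \<longleftrightarrow> \<Lambda> \<subseteq> Eis \<and> 0 \<in> \<Lambda> \<and> (\<forall>u\<in>\<Lambda>. \<forall>v\<in>\<Lambda>. u - v \<in> \<Lambda>)"

definition cosets :: "complex set \<Rightarrow> complex set set" where
  "cosets \<Lambda> = (\<lambda>v. (+) v ` \<Lambda>) ` Eis"

lemma sublatticeD:
  assumes "sublattice \<Lambda>"
  shows "u \<in> \<Lambda> \<Longrightarrow> u \<in> Eis" "0 \<in> \<Lambda>" "u \<in> \<Lambda> \<Longrightarrow> v \<in> \<Lambda> \<Longrightarrow> u - v \<in> \<Lambda>" "u \<in> \<Lambda> \<Longrightarrow> - u \<in> \<Lambda>"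
    "u \<in> \<Lambda> \<Longrightarrow> v \<in> \<Lambda> \<Longrightarrow> u + v \<in> \<Lambda>"
proof -
  show *: "u \<in> \<Lambda> \<Longrightarrow> u \<in> Eis" "0 \<in> \<Lambda>" "u \<in> \<Lambda> \<Longrightarrow> v \<in> \<Lambda> \<Longrightarrow> u - v \<in> \<Lambda>" for u v
    using assms by (auto simp: sublattice_def)
  show **: "u \<in> \<Lambda> \<Longrightarrow> - u \<in> \<Lambda>" for u using *(3)[of 0 u] *(2) by simp
  show "u \<in> \<Lambda> \<Longrightarrow> v \<in> \<Lambda> \<Longrightarrow> u + v \<in> \<Lambda>" using *(3)[of u "- v"] **[of v] by simp
qed

lemma sublattice_of_int:
  assumes L: "sublattice \<Lambda>" and u: "u \<in> \<Lambda>"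
  shows "of_int k * u \<in> \<Lambda>"
proof (cases k rule: int_cases2)
  case (nonneg n)
  have "of_nat n * u \<in> \<Lambda>" for n
    by (induction n) (use u sublatticeD[OF L] in \<open>auto simp: algebra_simps\<close>)
  then show ?thesis using nonneg by simp
next
  case (nonpos n)
  have "of_nat n * u \<in> \<Lambda>" for n
    by (induction n) (use u sublatticeD[OF L] in \<open>auto simp: algebra_simps\<close>)
  then show ?thesis using nonpos sublatticeD(4)[OF L] by simp
qed

lemma coset_eq_iff:
  assumes L: "sublattice \<Lambda>"
  shows "(+) u ` \<Lambda> = (+) v ` \<Lambda> \<longleftrightarrow> u - v \<in> \<Lambda>"
proof
  assume "(+) u ` \<Lambda> = (+) v ` \<Lambda>"
  then have "u + 0 \<in> (+) v ` \<Lambda>" using sublatticeD(2)[OF L] by blast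
  then show "u - v \<in> \<Lambda>" by auto
next
  assume d: "u - v \<in> \<Lambda>"
  have "x \<in> (+) v ` \<Lambda> \<longleftrightarrow> x \<in> (+) u ` \<Lambda>" for x
  proof -
    have "x \<in> (+) v ` \<Lambda> \<longleftrightarrow> x - v \<in> \<Lambda>" for x v by (force simp: image_iff algebra_simps)
    moreover have "x - v \<in> \<Lambda> \<longleftrightarrow> x - u \<in> \<Lambda>"
      using sublatticeD(3)[OF L _ d, of "x - v"] sublatticeD(5)[OF L _ d, of "x - u"] by auto
    ultimately show ?thesis by simp
  qed
  then show "(+) u ` \<Lambda> = (+) v ` \<Lambda>" by blast
qed

lemma mem_coset: "x \<in> (+) v ` \<Lambda> \<longleftrightarrow> x - v \<in> (\<Lambda> :: complex set)"
  by (force simp: image_iff algebra_simps)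

text \<open>Hermite normal form: the lattice spanned by \<open>eis a 0\<close> and
  \<open>eis s d\<close>.\<close>

definition hnf :: "int \<Rightarrow> int \<Rightarrow> int \<Rightarrow> complex set" where
  "hnf a d s = {eis (i * a + j * s) (j * d) |i j. True}"

lemma eis_in_hnf: "eis x y \<in> hnf a d s \<longleftrightarrow> (\<exists>i j. x = i * a + j * s \<and> y = j * d)"
  by (auto simp: hnf_def)

lemma sublattice_hnf: "sublattice (hnf a d s)"
  unfolding sublattice_def
proof (intro conjI ballI)
  show "0 \<in> hnf a d s" unfolding eis_0 eis_in_hnf by (intro exI[of _ 0]) simp
  fix u v assume "u \<in> hnf a d s" "v \<in> hnf a d s"
  then obtain i j k l where "u = eis (i * a + j * s) (j * d)" "v = eis (k * a + l * s) (l * d)"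
    by (auto simp: hnf_def)
  then show "u - v \<in> hnf a d s"
    by (simp add: eis_diff eis_in_hnf) (intro exI[of _ "i - k"] exI[of _ "j - l"], simp add: algebra_simps)
qed (auto simp: hnf_def)

lemma card_cosets_hnf:
  assumes "a > 0" "d > 0"
  shows "card (cosets (hnf a d s)) = nat (a * d)"
proof -
  have "bij_betw (\<lambda>(x, y). (+) (eis x y) ` hnf a d s) ({0..<a} \<times> {0..<d}) (cosets (hnf a d s))"
    unfolding bij_betw_def
  proof
    show "inj_on (\<lambda>(x, y). (+) (eis x y) ` hnf a d s) ({0..<a} \<times> {0..<d})"
    proof (rule inj_onI, clarify)
      fix x y x' y' assume b: "x \<in> {0..<a}" "y \<in> {0..<d}" "x' \<in> {0..<a}" "y' \<in> {0..<d}"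
        and "(+) (eis x y) ` hnf a d s = (+) (eis x' y') ` hnf a d s"
      then have "eis (x - x') (y - y') \<in> hnf a d s"
        by (simp add: coset_eq_iff[OF sublattice_hnf] eis_diff)
      then obtain i j where ij: "x - x' = i * a + j * s" "y - y' = j * d" by (auto simp: eis_in_hnf)
      have "d dvd y - y'" using ij(2) by simp
      then have "y = y'" using b by (metis atLeastLessThan_iff mod_eq_dvd_iff mod_pos_pos_trivial)
      then have "j = 0" using ij(2) assms by simp
      then have "a dvd x - x'" using ij(1) by simp
      then have "x = x'" using b by (metis atLeastLessThan_iff mod_eq_dvd_iff mod_pos_pos_trivial)
      then show "x = x' \<and> y = y'" using \<open>y = y'\<close> by simp
    qed
    show "(\<lambda>(x, y). (+) (eis x y) ` hnf a d s) ` ({0..<a} \<times> {0..<d}) = cosets (hnf a d s)"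
    proof (intro equalityI subsetI)
      fix C assume "C \<in> cosets (hnf a d s)"
      then obtain p q where C: "C = (+) (eis p q) ` hnf a d s" by (auto simp: cosets_def Eis_def)
      \<comment> \<open>Reduce the second coordinate by multiples of \<open>eis s d\<close>, which
        shifts the first by \<open>j * s\<close>, and then the first coordinate modulo
        \<open>a\<close>.\<close>
      define j where "j = q div d"
      define i where "i = (p - j * s) div a"
      have "eis p q - eis ((p - j * s) mod a) (q mod d) = eis (i * a + j * s) (j * d)"
        by (simp add: eis_diff i_def j_def algebra_simps minus_mod_eq_mult_div[symmetric])
      then have "eis p q - eis ((p - j * s) mod a) (q mod d) \<in> hnf a d s" by (auto simp: eis_in_hnf)
      then have "C = (+) (eis ((p - j * s) mod a) (q mod d)) ` hnf a d s"
        unfolding C coset_eq_iff[OF sublattice_hnf] .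
      then show "C \<in> (\<lambda>(x, y). (+) (eis x y) ` hnf a d s) ` ({0..<a} \<times> {0..<d})"
        using assms by (intro image_eqI[of _ _ "((p - j * s) mod a, q mod d)"]) auto
    qed (auto simp: cosets_def)
  qed
  then have "card (cosets (hnf a d s)) = card ({0..<a} \<times> {0..<d})" by (metis bij_betw_same_card)
  then show ?thesis using assms by (simp add: card_cartesian_product nat_mult_distrib)
qed

text \<open>The lattice determines its data: \<open>a\<close> generates its intersection with the
  integers, \<open>d\<close> generates the coefficients of \<open>om\<close> that occur, and
  \<open>s\<close> is then fixed modulo \<open>a\<close>.\<close>

lemma hnf_inj:
  assumes eq: "hnf a d s = hnf a' d' s'" and pos: "a > 0" "d > 0" "a' > 0" "d' > 0"
    and s: "0 \<le> s" "s < a" "0 \<le> s'" "s' < a'"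
  shows "a = a' \<and> d = d' \<and> s = s'"
proof -
  have 1: "a' dvd a \<and> d' dvd d" if "hnf a d s = hnf a' d' s'" "a > 0" "d > 0" "a' > 0" "d' > 0" for a d s a' d' s'
  proof -
    have "eis a 0 \<in> hnf a d s" unfolding eis_in_hnf by (rule exI[of _ 1], rule exI[of _ 0]) simp
    then have "eis a 0 \<in> hnf a' d' s'" using that by simp
    then obtain i j where "a = i * a' + j * s'" "0 = j * d'" by (auto simp: eis_in_hnf)
    then have a: "a' dvd a" using that by simp
    have "eis s d \<in> hnf a d s" unfolding eis_in_hnf by (rule exI[of _ 0], rule exI[of _ 1]) simp
    then have "eis s d \<in> hnf a' d' s'" using that by simp
    then show ?thesis using a by (auto simp: eis_in_hnf)
  qed
  have ad: "a = a'" "d = d'"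
    using 1[OF eq pos] 1[OF eq[symmetric] pos(3,4,1,2)] pos by (simp_all add: zdvd_antisym_nonneg)
  have "eis s d \<in> hnf a d s" unfolding eis_in_hnf by (rule exI[of _ 0], rule exI[of _ 1]) simp
  then have "eis s d \<in> hnf a d s'" using eq ad by simp
  then obtain i j where "s = i * a + j * s'" "d = j * d" by (auto simp: eis_in_hnf)
  then have "a dvd s - s'" using pos by simp
  then have "s = s'" using s ad by (metis mod_eq_dvd_iff mod_pos_pos_trivial)
  then show ?thesis using ad by simp
qed

lemma int_subgroup_generator:
  fixes S :: "int set"
  assumes 0: "0 \<in> S" and diff: "\<And>x y. x \<in> S \<Longrightarrow> y \<in> S \<Longrightarrow> x - y \<in> S" and ne: "\<exists>x\<in>S. x \<noteq> 0"
  obtains d where "d > 0" "\<And>x. x \<in> S \<longleftrightarrow> d dvd x"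
proof -
  have neg: "- x \<in> S" if "x \<in> S" for x using diff[OF 0 that] by simp
  then obtain x where x: "x \<in> S" "x > 0" using ne by (metis neg_0_less_iff_less linorder_neqE)
  define m where "m = (LEAST m. m > 0 \<and> int m \<in> S)"
  have ex: "\<exists>m. m > 0 \<and> int m \<in> S" using x by (intro exI[of _ "nat x"]) auto
  have m: "m > 0" "int m \<in> S" using LeastI_ex[OF ex] by (auto simp: m_def)
  have least: "k \<ge> m" if "k > 0" "int k \<in> S" for k using that unfolding m_def by (intro Least_le) blast
  have mult: "k * int m \<in> S" for k
  proof -
    have "int n * int m \<in> S" for n
    proof (induction n)
      case (Suc n)
      have "int n * int m - (- int m) \<in> S" using diff[OF Suc neg[OF m(2)]] .
      then show ?case by (simp add: algebra_simps)
    qed (use 0 in auto)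
    then show ?thesis using neg by (cases k rule: int_cases2) force+
  qed
  have "x \<in> S \<longleftrightarrow> int m dvd x" for x
  proof
    assume "x \<in> S"
    then have "x - x div int m * int m \<in> S" using diff mult by blast
    then have "x mod int m \<in> S" by (simp add: minus_div_mult_eq_mod)
    moreover have "0 \<le> x mod int m" "x mod int m < int m" using m by auto
    ultimately have "x mod int m = 0" using least[of "nat (x mod int m)"] by force
    then show "int m dvd x" by auto
  qed (use mult in \<open>auto simp: mult.commute\<close>)
  then show ?thesis using that[of "int m"] m by simp
qed

text \<open>By the pigeonhole principle two different multiples of \<open>v\<close> lie in the same
  coset.\<close>

lemma finite_cosets_multiple:
  assumes L: "sublattice \<Lambda>" and fin: "finite (cosets \<Lambda>)" and v: "v \<in> Eis"
  shows "\<exists>k>0. of_int k * v \<in> \<Lambda>"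
proof -
  have "finite (range (\<lambda>i::nat. (+) (of_int (int i) * v) ` \<Lambda>))"
    by (rule finite_subset[OF _ fin])
      (use v Eis_closed(4,8) in \<open>unfold cosets_def, intro image_subsetI imageI, blast\<close>)
  then have "\<not> inj (\<lambda>i::nat. (+) (of_int (int i) * v) ` \<Lambda>)" using finite_imageD infinite_UNIV_nat by blast
  then obtain i j :: nat where ij: "i \<noteq> j" "of_int (int i) * v - of_int (int j) * v \<in> \<Lambda>"
    unfolding inj_def coset_eq_iff[OF L] by blast
  then have "of_int (int i - int j) * v \<in> \<Lambda>" by (simp add: algebra_simps)
  moreover then have "of_int (int j - int i) * v \<in> \<Lambda>" using sublatticeD(4)[OF L] by (fastforce simp: algebra_simps)
  ultimately show ?thesis using ij(1) by (cases "i < j") (auto intro: exI[of _ "int j - int i"] exI[of _ "int i - int j"])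
qed

lemma sublattice_hnf_exists:
  assumes L: "sublattice \<Lambda>" and fin: "finite (cosets \<Lambda>)"
  obtains a d s where "a > 0" "d > 0" "0 \<le> s" "s < a" "\<Lambda> = hnf a d s"
proof -
  \<comment> \<open>The integers in the lattice, and the projection of the lattice to the
    coefficient of \<open>om\<close>; finite index makes both subgroups nonzero.\<close>
  let ?A = "{x. eis x 0 \<in> \<Lambda>}" and ?D = "{y. \<exists>x. eis x y \<in> \<Lambda>}"
  have z: "eis 0 0 \<in> \<Lambda>" using sublatticeD(2)[OF L] eis_0 by simp
  have df: "eis (x - x') (y - y') \<in> \<Lambda>" if "eis x y \<in> \<Lambda>" "eis x' y' \<in> \<Lambda>" for x y x' y'
    using sublatticeD(3)[OF L that] by (simp add: eis_diff)
  obtain k where "k > 0" "of_int k * eis 1 0 \<in> \<Lambda>" using finite_cosets_multiple[OF L fin, of "eis 1 0"] by auto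
  then have k: "k \<in> ?A" "k \<noteq> 0" by (auto simp: eis_of_int eis_mult)
  obtain l where "l > 0" "of_int l * eis 0 1 \<in> \<Lambda>" using finite_cosets_multiple[OF L fin, of "eis 0 1"] by auto
  then have l: "l \<in> ?D" "l \<noteq> 0" by (auto simp: eis_of_int eis_mult)
  obtain a where a: "a > 0" "\<And>x. x \<in> ?A \<longleftrightarrow> a dvd x"
    by (rule int_subgroup_generator[of ?A]) (use z df[of _ 0 _ 0] k in auto)
  obtain d where d: "d > 0" "\<And>y. y \<in> ?D \<longleftrightarrow> d dvd y"
  proof (rule int_subgroup_generator[of ?D])
    fix x y assume "x \<in> ?D" "y \<in> ?D" then show "x - y \<in> ?D" using df by blast
  qed (use z l in auto)
  obtain s0 where s0: "eis s0 d \<in> \<Lambda>" using d(2)[of d] by auto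
  define s where "s = s0 mod a"
  have ai: "eis (i * a) 0 \<in> \<Lambda>" for i using a(2)[of "i * a"] by simp
  have s: "eis s d \<in> \<Lambda>"
    using df[OF s0 ai, of "s0 div a"] by (simp add: s_def minus_div_mult_eq_mod)
  have sj: "eis (j * s) (j * d) \<in> \<Lambda>" for j
    using sublattice_of_int[OF L s, of j] by (simp add: eis_of_int eis_mult)
  have "\<Lambda> = hnf a d s"
  proof (intro equalityI subsetI)
    fix u assume u: "u \<in> \<Lambda>"
    then obtain x y where xy: "u = eis x y" using sublatticeD(1)[OF L] Eis_E by metis
    then have "y \<in> ?D" using u by auto
    then have "d dvd y" using d(2) by blast
    then obtain j where j: "y = j * d" by (metis dvdE mult.commute)
    then have "eis (x - j * s) 0 \<in> \<Lambda>" using df[OF _ sj, of x y j] u xy by simp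
    then obtain i where "x - j * s = a * i" using a(2) by blast
    then have "x = i * a + j * s" by (simp add: algebra_simps)
    then show "u \<in> hnf a d s" using xy j by (auto simp: eis_in_hnf)
  next
    fix u assume "u \<in> hnf a d s"
    then obtain i j where "u = eis (i * a) 0 + eis (j * s) (j * d)" by (auto simp: hnf_def eis_add)
    then show "u \<in> \<Lambda>" using ai sj sublatticeD(5)[OF L] by simp
  qed
  then show ?thesis using that[of a d s] a d by (simp add: s_def)
qed

section \<open>Counting sublattices and ideals of a given index\<close>

definition Lat :: "nat \<Rightarrow> complex set set" where
  "Lat k = {\<Lambda>. sublattice \<Lambda> \<and> card (cosets \<Lambda>) = k}"

text \<open>Since 1 and \<open>om\<close> span \<open>Eis\<close> over the integers, these are the
  ideals of index \<open>k\<close>.\<close>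

definition InvLat :: "nat \<Rightarrow> complex set set" where
  "InvLat k = {\<Lambda> \<in> Lat k. \<forall>u\<in>\<Lambda>. om * u \<in> \<Lambda>}"

lemma Lat_hnf:
  assumes "k > 0" "\<Lambda> \<in> Lat k"
  obtains a d s where "a > 0" "d > 0" "0 \<le> s" "s < a" "\<Lambda> = hnf a d s" "int k = a * d"
proof -
  have L: "sublattice \<Lambda>" "card (cosets \<Lambda>) = k" using assms by (auto simp: Lat_def)
  then have "finite (cosets \<Lambda>)" using assms(1) card_ge_0_finite by metis
  then obtain a d s where *: "a > 0" "d > 0" "0 \<le> s" "s < a" "\<Lambda> = hnf a d s"
    using sublattice_hnf_exists[OF L(1)] by blast
  then have "nat (a * d) = k" using card_cosets_hnf[of a d s] L(2) by simp
  moreover have "a * d > 0" using *(1,2) by simp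
  ultimately have "int k = a * d" by linarith
  then show ?thesis using * that by blast
qed

text \<open>The divisor \<open>a\<close> determines \<open>d = k div a\<close> and leaves
  \<open>a\<close> choices for \<open>s\<close>.\<close>

lemma card_Lat:
  assumes "k > 0"
  shows "card (Lat k) = (\<Sum>a | a dvd k. a)" "finite (Lat k)"
proof -
  let ?I = "SIGMA a:{a. a dvd k}. {0..<int a}"
  let ?f = "\<lambda>(a, s). hnf (int a) (int (k div a)) s"
  have inj: "inj_on ?f ?I"
  proof (rule inj_onI, clarify)
    fix a s a' s' assume *: "a dvd k" "s \<in> {0..<int a}" "a' dvd k" "s' \<in> {0..<int a'}"
      "hnf (int a) (int (k div a)) s = hnf (int a') (int (k div a')) s'"
    then have "a > 0" "a' > 0" "k div a > 0" "k div a' > 0"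
      using assms by (auto intro: dvd_pos_nat simp: div_greater_zero_iff dvd_imp_le)
    then show "a = a' \<and> s = s'" using hnf_inj[OF *(5)] * by auto
  qed
  have "?f ` ?I = Lat k"
  proof (intro equalityI subsetI)
    fix \<Lambda> assume "\<Lambda> \<in> ?f ` ?I"
    then obtain a s where *: "a dvd k" "\<Lambda> = hnf (int a) (int (k div a)) s" by auto
    then have "a > 0" "k div a > 0"
      using assms by (auto intro: dvd_pos_nat simp: div_greater_zero_iff dvd_imp_le)
    then have "card (cosets \<Lambda>) = nat (int a * int (k div a))" using card_cosets_hnf *(2) by simp
    also have "int a * int (k div a) = int k" using *(1) by (metis dvd_mult_div_cancel of_nat_mult)
    finally show "\<Lambda> \<in> Lat k" using * sublattice_hnf by (simp add: Lat_def)
  next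
    fix \<Lambda> assume "\<Lambda> \<in> Lat k"
    then obtain a d s where *: "a > 0" "d > 0" "0 \<le> s" "s < a" "\<Lambda> = hnf a d s" "int k = a * d"
      using Lat_hnf[OF assms] by blast
    have k: "k = nat a * nat d" using * by (metis nat_int nat_mult_distrib less_imp_le)
    then show "\<Lambda> \<in> ?f ` ?I"
      using * by (intro image_eqI[of _ _ "(nat a, s)"]) auto
  qed
  moreover have fin: "finite ?I" using assms by auto
  ultimately show "finite (Lat k)" by (metis finite_imageI)
  have "card (Lat k) = card ?I" using card_image[OF inj] \<open>?f ` ?I = Lat k\<close> by simp
  also have "\<dots> = (\<Sum>a | a dvd k. a)" using assms by (subst card_SigmaI) auto
  finally show "card (Lat k) = (\<Sum>a | a dvd k. a)" .
qed

text \<open>It suffices to test the two basis vectors: \<open>om\<close> sends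
  \<open>eis a 0\<close> to \<open>eis 0 a\<close> and \<open>eis s d\<close> to
  \<open>eis (- d) (s - d)\<close>. The first forces \<open>d\<close> to divide \<open>a\<close> and
  \<open>s\<close>, the second the condition on the norm of \<open>t + om\<close>.\<close>

lemma hnf_invariant_iff:
  assumes "a > 0" "d > 0"
  shows "(\<forall>u\<in>hnf a d s. om * u \<in> hnf a d s) \<longleftrightarrow>
    (\<exists>m t. a = d * m \<and> s = d * t \<and> m dvd t^2 - t + 1)"
proof
  assume inv: "\<forall>u\<in>hnf a d s. om * u \<in> hnf a d s"
  have "eis a 0 \<in> hnf a d s" unfolding eis_in_hnf by (rule exI[of _ 1], rule exI[of _ 0]) simp
  then have "eis 0 a \<in> hnf a d s" using inv om_mult_eis[of a 0] by fastforce
  then obtain i m where im: "0 = i * a + m * s" "a = m * d" by (auto simp: eis_in_hnf)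
  have "m > 0" using im(2) assms by (simp add: zero_less_mult_iff)
  moreover have "m * (i * d + s) = 0" using im by (simp add: algebra_simps)
  ultimately have "i * d + s = 0" by simp
  then have s: "s = d * (- i)" by (simp add: algebra_simps)
  define t where "t = - i"
  have "eis s d \<in> hnf a d s" unfolding eis_in_hnf by (rule exI[of _ 0], rule exI[of _ 1]) simp
  then have "eis (- d) (s - d) \<in> hnf a d s" using inv om_mult_eis[of s d] by fastforce
  then obtain p j where pj: "- d = p * a + j * s" "s - d = j * d" by (auto simp: eis_in_hnf)
  have "j * d = (t - 1) * d" using pj(2) s by (simp add: t_def algebra_simps)
  then have j: "j = t - 1" using assms by simp
  have "d * (t^2 - t + 1) = d * (m * (- p))"
    using pj(1) im(2) s unfolding j t_def[symmetric] by (simp add: algebra_simps power2_eq_square)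
  then have "t^2 - t + 1 = m * (- p)" using assms(2) mult_left_cancel[of d] by blast
  then have "m dvd t^2 - t + 1" by simp
  then show "\<exists>m t. a = d * m \<and> s = d * t \<and> m dvd t^2 - t + 1"
    using im(2) s t_def by (intro exI[of _ m] exI[of _ t]) (simp add: mult.commute)
next
  assume "\<exists>m t. a = d * m \<and> s = d * t \<and> m dvd t^2 - t + 1"
  then obtain m t p where *: "a = d * m" "s = d * t" "t^2 - t + 1 = m * p" by blast
  show "\<forall>u\<in>hnf a d s. om * u \<in> hnf a d s"
  proof
    fix u assume "u \<in> hnf a d s"
    then obtain i j where u: "u = eis (i * a + j * s) (j * d)" by (auto simp: hnf_def)
    have p: "t * t = m * p - 1 + t" using *(3) by (simp add: power2_eq_square)
    \<comment> \<open>The second coordinate determines the new coefficient of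
      \<open>eis s d\<close>, and the first then that of \<open>eis a 0\<close>; here
      \<open>p\<close> is the quotient of \<open>t^2 - t + 1\<close> by \<open>m\<close>.\<close>
    have "om * u = eis ((- i * t - j * p) * a + (i * m + j * (t - 1)) * s) ((i * m + j * (t - 1)) * d)"
      unfolding u om_mult_eis eis_eq_iff
    proof
      have "(- i * t - j * p) * a + (i * m + j * (t - 1)) * s = d * (j * (t * t) - j * t - j * (m * p))"
        by (simp add: * algebra_simps)
      then show "- (j * d) = (- i * t - j * p) * a + (i * m + j * (t - 1)) * s"
        unfolding p by (simp add: algebra_simps)
      show "i * a + j * s - j * d = (i * m + j * (t - 1)) * d" by (simp add: * algebra_simps)
    qed
    then show "om * u \<in> hnf a d s" by (auto simp: hnf_def)
  qed
qed

lemma InvLat_hnf: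
  assumes "k > 0" "\<Lambda> \<in> InvLat k"
  obtains d m t where "d > 0" "m > 0" "t \<in> eroots m" "\<Lambda> = hnf (int (d * m)) (int d) (int d * t)" "k = d\<^sup>2 * m"
proof -
  obtain a d s where *: "a > 0" "d > 0" "0 \<le> s" "s < a" "\<Lambda> = hnf a d s" "int k = a * d"
    using Lat_hnf[OF assms(1)] assms(2) unfolding InvLat_def by blast
  obtain m t where mt: "a = d * m" "s = d * t" "m dvd t^2 - t + 1"
    using hnf_invariant_iff[OF *(1,2), of s] assms(2) *(5) unfolding InvLat_def by blast
  have "m > 0" using mt(1) * by (simp add: zero_less_mult_iff)
  have "0 \<le> t" "t < m" using * mt by (simp_all add: zero_le_mult_iff)
  then have "t \<in> eroots (nat m)" using mt(3) \<open>m > 0\<close> by (simp add: eroots_def)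
  moreover have "int k = int ((nat d)\<^sup>2 * nat m)" using * mt \<open>m > 0\<close> by (simp add: power2_eq_square)
  then have "k = (nat d)\<^sup>2 * nat m" by (simp only: of_nat_eq_iff)
  ultimately show ?thesis using that[of "nat d" "nat m" t] * mt \<open>m > 0\<close> by simp
qed

lemma card_InvLat:
  assumes "k > 0"
  shows "int (card (InvLat k)) = (\<Sum>d | d dvd k. chi3 d)" "finite (InvLat k)"
proof -
  show "finite (InvLat k)" using card_Lat(2)[OF assms] by (simp add: InvLat_def)
  \<comment> \<open>The index is \<open>m\<close> alone, because \<open>d\<close> is the square root
    of \<open>k div m\<close>, which \<open>c\<close> picks out.\<close>
  define M where "M = {m. m dvd k \<and> is_nth_power 2 (k div m)}"
  define c where "c m = (THE c::nat. c\<^sup>2 = k div m)" for m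
  have c: "(c m)\<^sup>2 = k div m" if "m \<in> M" for m
  proof -
    have "is_nth_power 2 (k div m)" using that by (simp add: M_def)
    then obtain e where e: "e\<^sup>2 = k div m" by (metis is_nth_powerE)
    have "c m = e" unfolding c_def
    proof (rule the_equality[of _ e])
      fix x assume "x\<^sup>2 = k div m"
      then have "x\<^sup>2 = e\<^sup>2" using e by simp
      then show "x = e" by (simp add: power2_eq_iff_nonneg)
    qed (rule e)
    then show ?thesis using e by simp
  qed
  have kM: "k = (c m)\<^sup>2 * m" "m > 0" "c m > 0" if "m \<in> M" for m
  proof -
    have m: "m dvd k" using that by (simp add: M_def)
    then show "k = (c m)\<^sup>2 * m" using c[OF that] by simp
    then show "m > 0" "c m > 0" using assms by (auto intro: gr0I)
  qed
  let ?I = "SIGMA m:M. eroots m"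
  let ?f = "\<lambda>(m, t). hnf (int (c m * m)) (int (c m)) (int (c m) * t)"
  have inj: "inj_on ?f ?I"
  proof (rule inj_onI, clarify)
    fix m t m' t' assume *: "m \<in> M" "t \<in> eroots m" "m' \<in> M" "t' \<in> eroots m'"
      "hnf (int (c m * m)) (int (c m)) (int (c m) * t) = hnf (int (c m' * m')) (int (c m')) (int (c m') * t')"
    have "int (c m * m) = int (c m' * m') \<and> int (c m) = int (c m') \<and> int (c m) * t = int (c m') * t'"
      by (rule hnf_inj[OF *(5)]) (use * kM[OF *(1)] kM[OF *(3)] in \<open>auto simp: eroots_def\<close>)
    then have cc: "c m = c m'" "int (c m) * t = int (c m') * t'" by auto
    then have "t = t'" using kM(3)[OF *(1)] by simp
    moreover have "(c m)\<^sup>2 * m = (c m)\<^sup>2 * m'" using kM(1)[OF *(1)] kM(1)[OF *(3)] cc(1) by metis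
    then have "m = m'" using kM(3)[OF *(1)] by auto
    ultimately show "m = m' \<and> t = t'" by simp
  qed
  have "?f ` ?I = InvLat k"
  proof (intro equalityI subsetI)
    fix \<Lambda> assume "\<Lambda> \<in> ?f ` ?I"
    then obtain m t where *: "m \<in> M" "t \<in> eroots m" "\<Lambda> = hnf (int (c m * m)) (int (c m)) (int (c m) * t)"
      by auto
    note km = kM[OF *(1)]
    have "card (cosets \<Lambda>) = nat (int (c m * m) * int (c m))" using card_cosets_hnf *(3) km by simp
    also have "\<dots> = k" by (subst km(1)) (simp add: power2_eq_square nat_mult_distrib)
    finally have "\<Lambda> \<in> Lat k" using sublattice_hnf * by (simp add: Lat_def)
    moreover have "\<forall>u\<in>\<Lambda>. om * u \<in> \<Lambda>" unfolding *(3)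
      using km *(2) by (subst hnf_invariant_iff) (auto simp: eroots_def)
    ultimately show "\<Lambda> \<in> InvLat k" by (simp add: InvLat_def)
  next
    fix \<Lambda> assume "\<Lambda> \<in> InvLat k"
    then obtain d m t where *: "d > 0" "m > 0" "t \<in> eroots m" "\<Lambda> = hnf (int (d * m)) (int d) (int d * t)" "k = d\<^sup>2 * m"
      using InvLat_hnf[OF assms] by blast
    then have "k div m = d\<^sup>2" by simp
    then have m: "m \<in> M" using * by (auto simp: M_def)
    have "(c m)\<^sup>2 = d\<^sup>2" using c[OF m] \<open>k div m = d\<^sup>2\<close> by simp
    then have "c m = d" by (simp add: power2_eq_iff_nonneg)
    then show "\<Lambda> \<in> ?f ` ?I" using * m by (intro image_eqI[of _ _ "(m, t)"]) auto
  qed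
  then have "card (InvLat k) = card ?I" using card_image[OF inj] by simp
  also have "\<dots> = (\<Sum>m\<in>M. card (eroots m))"
    using finite_eroots assms by (subst card_SigmaI) (auto simp: M_def)
  finally have "int (card (InvLat k)) = (\<Sum>m\<in>M. int (card (eroots m)))" by simp
  also have "\<dots> = dconv (\<lambda>m. int (card (eroots m))) sq_ind k"
    unfolding dconv_def M_def sq_ind_def using assms
    by (intro sum.mono_neutral_cong_left) auto
  finally show "int (card (InvLat k)) = (\<Sum>d | d dvd k. chi3 d)" using dconv_eroots_eq[OF assms] by simp
qed

section \<open>Norm and principal ideals\<close>

lemma eis_norm: "(cmod (of_real x + of_real y * om))\<^sup>2 = x\<^sup>2 - x * y + y\<^sup>2"
proof -
  have "(cmod (of_real x + of_real y * om))\<^sup>2 = (x - y / 2)\<^sup>2 + (y * (sqrt 3 / 2))\<^sup>2"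
    by (simp add: cmod_power2 om_Re_Im)
  also have "(y * (sqrt 3 / 2))\<^sup>2 = 3 / 4 * y\<^sup>2" by (simp add: power_mult_distrib power_divide)
  finally show ?thesis by (simp add: power2_eq_square field_simps)
qed

lemma eis_norm_int: "(cmod (eis a b))\<^sup>2 = of_int (a\<^sup>2 - a * b + b\<^sup>2)"
  using eis_norm[of "of_int a" "of_int b"] by (simp add: eis_def)

lemma complex_om_coordinates: obtains x y where "z = of_real x + of_real y * om"
proof -
  define y where "y = Im z * 2 / sqrt 3"
  define x where "x = Re z + y / 2"
  have "z = of_real x + of_real y * om"
    by (simp add: complex_eq_iff om_Re_Im x_def y_def)
  then show ?thesis using that by blast
qed

text \<open>Rounding both coordinates leaves errors of at most 1/2 and hence a squared distance of
  at most 3/4; this is the Euclidean property.\<close>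

lemma eis_approx:
  obtains u where "u \<in> Eis" "cmod (z - u) < 1"
proof -
  obtain x y where z: "z = of_real x + of_real y * om" using complex_om_coordinates .
  define dx dy where "dx = x - of_int (round x)" and "dy = y - of_int (round y)"
  have d: "\<bar>dx\<bar> \<le> 1 / 2" "\<bar>dy\<bar> \<le> 1 / 2"
    using of_int_round_abs_le[of x] of_int_round_abs_le[of y] by (auto simp: dx_def dy_def abs_minus_commute)
  have "z - eis (round x) (round y) = of_real dx + of_real dy * om"
    by (simp add: z eis_def dx_def dy_def algebra_simps)
  then have "(cmod (z - eis (round x) (round y)))\<^sup>2 = dx\<^sup>2 - dx * dy + dy\<^sup>2" using eis_norm by simp
  also have "\<dots> \<le> \<bar>dx\<bar>\<^sup>2 + \<bar>dx\<bar> * \<bar>dy\<bar> + \<bar>dy\<bar>\<^sup>2"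
    using abs_ge_minus_self[of "dx * dy"] by (simp add: abs_mult)
  also have "\<dots> \<le> (1/2)\<^sup>2 + (1/2) * (1/2) + (1/2)\<^sup>2"
    using d by (intro add_mono power_mono mult_mono) auto
  also have "\<dots> < 1\<^sup>2" by (simp add: power2_eq_square)
  finally have "cmod (z - eis (round x) (round y)) < 1" by (rule power_less_imp_less_base) simp
  then show ?thesis using that[of "eis (round x) (round y)"] by simp
qed

lemma InvLat_mult:
  assumes "\<Lambda> \<in> InvLat k" "u \<in> \<Lambda>" "v \<in> Eis"
  shows "v * u \<in> \<Lambda>"
proof -
  have L: "sublattice \<Lambda>" and inv: "om * u \<in> \<Lambda>" using assms by (auto simp: InvLat_def Lat_def)
  obtain a b where "v = eis a b" using assms(3) Eis_E by blast
  then have "v * u = of_int a * u + of_int b * (om * u)" by (simp add: eis_def algebra_simps)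
  then show ?thesis using sublattice_of_int[OF L] sublatticeD(5)[OF L] assms(2) inv by simp
qed

text \<open>Division with remainder: a shortest nonzero vector generates.\<close>

lemma InvLat_principal:
  assumes "k > 0" "\<Lambda> \<in> InvLat k"
  obtains \<alpha> where "\<alpha> \<in> Eis" "\<alpha> \<noteq> 0" "\<Lambda> = (*) \<alpha> ` Eis"
proof -
  have L: "sublattice \<Lambda>" using assms by (auto simp: InvLat_def Lat_def)
  have "finite (cosets \<Lambda>)" using assms by (auto simp: InvLat_def Lat_def intro: card_ge_0_finite)
  then obtain n where "n > 0" "of_int n * 1 \<in> \<Lambda>" using finite_cosets_multiple[OF L, of 1] by auto
  then have ne: "of_int n \<in> \<Lambda> \<and> of_int n \<noteq> (0::complex)" by simp
  \<comment> \<open>The squared modulus as a natural number, so that a least value exists; the floor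
    is exact on Eisenstein integers.\<close>
  define N where "N u = nat \<lfloor>(cmod u)\<^sup>2\<rfloor>" for u
  have N: "real (N u) = (cmod u)\<^sup>2" if "u \<in> Eis" for u
  proof -
    obtain a b where u: "u = eis a b" using \<open>u \<in> Eis\<close> Eis_E by blast
    have "0 \<le> real_of_int (a\<^sup>2 - a * b + b\<^sup>2)" unfolding eis_norm_int[symmetric] by simp
    then show ?thesis unfolding N_def u eis_norm_int floor_of_int by linarith
  qed
  obtain \<alpha> where \<alpha>: "\<alpha> \<in> \<Lambda>" "\<alpha> \<noteq> 0" "\<And>v. v \<in> \<Lambda> \<Longrightarrow> v \<noteq> 0 \<Longrightarrow> N \<alpha> \<le> N v"
    using ex_has_least_nat[of "\<lambda>u. u \<in> \<Lambda> \<and> u \<noteq> 0", OF ne, of N] by blast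
  have \<alpha>E: "\<alpha> \<in> Eis" using \<alpha>(1) sublatticeD(1)[OF L] by blast
  have "\<Lambda> = (*) \<alpha> ` Eis"
  proof (intro equalityI subsetI)
    fix v assume v: "v \<in> \<Lambda>"
    obtain u where u: "u \<in> Eis" "cmod (v / \<alpha> - u) < 1" using eis_approx .
    define r where "r = v - u * \<alpha>"
    have r: "r \<in> \<Lambda>" using v InvLat_mult[OF assms(2) \<alpha>(1) u(1)] sublatticeD(3)[OF L] by (simp add: r_def)
    have "r = (v / \<alpha> - u) * \<alpha>" using \<alpha>(2) by (simp add: r_def field_simps)
    then have "cmod r = cmod (v / \<alpha> - u) * cmod \<alpha>" by (simp add: norm_mult)
    also have "\<dots> < 1 * cmod \<alpha>" using u(2) \<alpha>(2) by (intro mult_strict_right_mono) auto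
    finally have "(cmod r)\<^sup>2 < (cmod \<alpha>)\<^sup>2" by (intro power_strict_mono) auto
    then have "real (N r) < real (N \<alpha>)" using N[of r] N[OF \<alpha>E] sublatticeD(1)[OF L r] by simp
    then have "r = 0" using \<alpha>(3)[OF r] by fastforce
    then show "v \<in> (*) \<alpha> ` Eis" using u(1) by (auto simp: r_def mult.commute)
  qed (use InvLat_mult[OF assms(2) \<alpha>(1)] in \<open>auto simp: mult.commute\<close>)
  then show ?thesis using that \<alpha>E \<alpha>(2) by blast
qed

text \<open>Reduction modulo the prime \<open>1 - om\<close> above \<open>3\<close>, with values in \<open>{0, 1, 2}\<close>.\<close>

definition tau :: "complex \<Rightarrow> int" where
  "tau u = (THE t. \<exists>a b. u = eis a b \<and> t = (a + b) mod 3)"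

lemma tau_eis [simp]: "tau (eis a b) = (a + b) mod 3"
  unfolding tau_def by (rule the_equality) auto

lemma tau_add: "u \<in> Eis \<Longrightarrow> v \<in> Eis \<Longrightarrow> tau (u + v) = (tau u + tau v) mod 3"
  by (elim Eis_E) (simp add: eis_add mod_simps, simp add: algebra_simps)

lemma tau_diff: "u \<in> Eis \<Longrightarrow> v \<in> Eis \<Longrightarrow> tau (u - v) = (tau u - tau v) mod 3"
  by (elim Eis_E) (simp add: eis_diff mod_simps, simp add: algebra_simps)

text \<open>Modulo \<open>1 - om\<close> the number \<open>om\<close> becomes 1; in coordinates this
  is the congruence of \<open>- 2 * (b * d)\<close> and \<open>b * d\<close> modulo 3.\<close>

lemma tau_mult: "u \<in> Eis \<Longrightarrow> v \<in> Eis \<Longrightarrow> tau (u * v) = (tau u * tau v) mod 3"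
proof (elim Eis_E)
  fix a b c d assume [simp]: "u = eis a b" "v = eis c d"
  have "(a * c - b * d + (a * d + b * c - b * d)) mod 3 = ((a + b) * (c + d) - 3 * (b * d)) mod 3"
    by (simp add: algebra_simps)
  also have "\<dots> = ((a + b) * (c + d)) mod 3" by (simp add: mod_diff_eq[symmetric])
  also have "\<dots> = ((a + b) mod 3 * ((c + d) mod 3)) mod 3" by (simp add: mod_mult_eq)
  finally show ?thesis by (simp add: eis_mult)
qed

lemma tau_of_int [simp]: "tau (of_int k) = k mod 3" by (simp add: eis_of_int)

lemma tau_om [simp]: "tau om = 1" by (simp add: eis_om)

lemma tau_mod [simp]: "u \<in> Eis \<Longrightarrow> tau u mod 3 = tau u" by (auto elim!: Eis_E)

lemma tau_range: "u \<in> Eis \<Longrightarrow> 0 \<le> tau u \<and> tau u < 3" by (auto elim!: Eis_E)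

lemma tau_rot: "tau (om powi c) = 1"
proof -
  have "tau (- 1 - om) = 1" by (simp add: eis_om eis_1 eis_minus eis_diff)
  moreover have "tau 1 = 1" by (simp add: eis_1)
  ultimately show ?thesis using rot_cases[of c] by auto
qed

lemma tau_rot_mult: "u \<in> Eis \<Longrightarrow> tau (om powi c * u) = tau u"
  by (simp add: tau_mult tau_rot)

lemma tau_eq_0_iff:
  assumes "u \<in> Eis"
  shows "tau u = 0 \<longleftrightarrow> (\<exists>v\<in>Eis. u = (1 - om) * v)"
proof
  obtain a b where u: "u = eis a b" using assms Eis_E by blast
  assume "tau u = 0"
  then obtain k where "a + b = 3 * k" using u by auto
  \<comment> \<open>For the witness \<open>eis x y\<close> the equations are
    \<open>x + y = a\<close> and \<open>2 * y - x = b\<close>; adding them gives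
    \<open>3 * y = a + b\<close>.\<close>
  then have "u = (1 - om) * eis (a - k) k"
    unfolding u eis_om eis_1 eis_diff eis_mult by simp
  then show "\<exists>v\<in>Eis. u = (1 - om) * v" by blast
next
  assume "\<exists>v\<in>Eis. u = (1 - om) * v"
  then obtain v where v: "v \<in> Eis" "u = (1 - om) * v" by blast
  have "tau (1 - om) = 0" by (simp add: eis_om eis_1 eis_diff)
  then show "tau u = 0" using v tau_mult[of "1 - om" v] by simp
qed

text \<open>The numbers \<open>1 - om\<close> and \<open>1 - om * om\<close> are associates, with
  quotient \<open>- om\<close>, so rotations by either angle displace points by the same
  ideal.\<close>

lemma rot_diff_multiple:
  assumes c: "\<not> 3 dvd c" and u: "u \<in> Eis"
  shows "\<exists>v\<in>Eis. (1 - om) * u = (1 - om powi c) * v"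
proof -
  have "c mod 3 = 1 \<or> c mod 3 = 2" using c by presburger
  then show ?thesis
  proof
    assume "c mod 3 = 1"
    then have "om powi c = om" by (subst rot_mod3) simp
    then show ?thesis using u by auto
  next
    assume "c mod 3 = 2"
    then have "om powi c = om * om" by (subst rot_mod3) (simp add: power2_eq_square)
    moreover have "(1 - om * om) * (- om * u) = (1 - om) * u"
    proof -
      have "(1 - om * om) * (- om * u) = (om * (om * om) - om) * u" by (simp add: algebra_simps)
      then show ?thesis by (simp add: om_cubed)
    qed
    ultimately show ?thesis using u by (intro bexI[of _ "- om * u"]) auto
  qed
qed

text \<open>On the two basis vectors \<open>tau\<close> vanishes if and only if 3 divides
  \<open>d * m\<close> and \<open>d * (t + 1)\<close>. When 3 divides \<open>m\<close> the second
  condition follows, because \<open>t^2 - t + 1\<close> is \<open>(t + 1)^2\<close> modulo 3; thus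
  both amount to 3 dividing \<open>d\<close> or \<open>m\<close>.\<close>

lemma InvLat_tau_iff:
  assumes "k > 0" "\<Lambda> \<in> InvLat k"
  shows "(\<forall>u\<in>\<Lambda>. tau u = 0) \<longleftrightarrow> 3 dvd k"
proof -
  obtain d m t where *: "d > 0" "m > 0" "t \<in> eroots m" "\<Lambda> = hnf (int (d * m)) (int d) (int d * t)" "k = d\<^sup>2 * m"
    using InvLat_hnf[OF assms] by blast
  have "eis (int (d * m)) 0 \<in> \<Lambda>" unfolding *(4) eis_in_hnf by (rule exI[of _ 1], rule exI[of _ 0]) simp
  moreover have "eis (int d * t) (int d) \<in> \<Lambda>" unfolding *(4) eis_in_hnf by (rule exI[of _ 0], rule exI[of _ 1]) simp
  moreover have "\<forall>u\<in>\<Lambda>. tau u = 0" if "3 dvd int (d * m)" "3 dvd int d * t + int d"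
  proof
    fix u assume "u \<in> \<Lambda>"
    then obtain i j where u: "u = eis (i * int (d * m) + j * (int d * t)) (j * int d)" by (auto simp: *(4) hnf_def)
    have "3 dvd i * int (d * m) + j * (int d * t + int d)" by (rule dvd_add[OF dvd_mult[OF that(1)] dvd_mult[OF that(2)]])
    moreover have "i * int (d * m) + j * (int d * t) + j * int d = i * int (d * m) + j * (int d * t + int d)"
      by (simp add: algebra_simps)
    ultimately show "tau u = 0" unfolding u tau_eis dvd_eq_mod_eq_0 by metis
  qed
  ultimately have 1: "(\<forall>u\<in>\<Lambda>. tau u = 0) \<longleftrightarrow> 3 dvd int (d * m) \<and> 3 dvd int d * t + int d"
    by (metis (no_types, lifting) add.right_neutral dvd_eq_mod_eq_0 tau_eis)
  have p3: "prime (3::int)" by simp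
  have m3: "3 dvd t + 1" if "3 dvd int m"
  proof -
    have "int m dvd t^2 - t + 1" using *(3) by (simp add: eroots_def)
    then have "3 dvd t^2 - t + 1" using that dvd_trans by blast
    also have "t^2 - t + 1 = (t + 1) * (t + 1) - 3 * t" by (simp add: power2_eq_square algebra_simps)
    finally have "3 dvd (t + 1) * (t + 1)" by (simp add: dvd_diff_left_iff)
    then show ?thesis using p3 prime_dvd_mult_iff by blast
  qed
  have 2: "3 dvd int (d * m) \<longleftrightarrow> 3 dvd int d \<or> 3 dvd int m"
    using prime_dvd_mult_iff[OF p3] by simp
  have "int d * t + int d = int d * (t + 1)" by (simp add: algebra_simps)
  then have 3: "3 dvd int d * t + int d \<longleftrightarrow> 3 dvd int d \<or> 3 dvd t + 1"
    using prime_dvd_mult_iff[OF p3] by simp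
  have "3 dvd k \<longleftrightarrow> 3 dvd int k" by (metis of_nat_dvd_iff of_nat_numeral)
  also have "\<dots> \<longleftrightarrow> 3 dvd int d \<or> 3 dvd int m"
    using prime_dvd_mult_iff[OF p3] by (simp add: *(5) power2_eq_square)
  finally show ?thesis using 1 2 3 m3 by blast
qed

lemma InvLat_rot_image:
  assumes "\<Lambda> \<in> InvLat k"
  shows "(*) (om powi c) ` \<Lambda> = \<Lambda>"
proof (intro equalityI subsetI)
  fix u assume u: "u \<in> \<Lambda>"
  have "u = om powi c * (om powi (- c) * u)" by (simp add: rot_minus mult.assoc[symmetric])
  then show "u \<in> (*) (om powi c) ` \<Lambda>" using InvLat_mult[OF assms u rot_in] by blast
qed (use InvLat_mult[OF assms _ rot_in] in auto)

text \<open>The coset of \<open>v\<close> is fixed if and only if \<open>(1 - om) * v\<close> lies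
  in the ideal, generated by \<open>\<alpha>\<close>. If the prime \<open>1 - om\<close> does not
  divide \<open>\<alpha>\<close>, then \<open>v\<close> itself lies in the ideal. If
  \<open>\<alpha> = (1 - om) * \<beta>\<close>, the fixed cosets are those of the multiples of
  \<open>\<beta>\<close>, one for each residue modulo \<open>1 - om\<close>.\<close>

lemma card_fixed_cosets:
  assumes "k > 0" "\<Lambda> \<in> InvLat k"
  shows "card {C \<in> cosets \<Lambda>. (*) om ` C = C} = (if 3 dvd k then 3 else 1)"
proof -
  have L: "sublattice \<Lambda>" using assms by (auto simp: InvLat_def Lat_def)
  obtain \<alpha> where \<alpha>: "\<alpha> \<in> Eis" "\<alpha> \<noteq> 0" "\<Lambda> = (*) \<alpha> ` Eis" using InvLat_principal[OF assms] .
  have om\<Lambda>: "(*) om ` \<Lambda> = \<Lambda>" using InvLat_rot_image[OF assms(2), of 1] by simp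
  have img: "(*) om ` ((+) v ` \<Lambda>) = (+) (om * v) ` \<Lambda>" for v
  proof -
    have "(*) om ` ((+) v ` \<Lambda>) = (+) (om * v) ` ((*) om ` \<Lambda>)"
      unfolding image_image by (simp add: distrib_left)
    then show ?thesis using om\<Lambda> by simp
  qed
  have fixed: "{C \<in> cosets \<Lambda>. (*) om ` C = C} = (\<lambda>v. (+) v ` \<Lambda>) ` {v \<in> Eis. (1 - om) * v \<in> \<Lambda>}"
  proof -
    have "om * v - v \<in> \<Lambda> \<longleftrightarrow> (1 - om) * v \<in> \<Lambda>" for v
      using sublatticeD(4)[OF L, of "om * v - v"] sublatticeD(4)[OF L, of "v - om * v"]
      by (auto simp: algebra_simps)
    then have fx: "(*) om ` ((+) v ` \<Lambda>) = (+) v ` \<Lambda> \<longleftrightarrow> (1 - om) * v \<in> \<Lambda>" for v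
      unfolding img coset_eq_iff[OF L] .
    show ?thesis
    proof (intro Set.set_eqI iffI)
      fix C assume "C \<in> {C \<in> cosets \<Lambda>. (*) om ` C = C}"
      then obtain v where "v \<in> Eis" "C = (+) v ` \<Lambda>" "(*) om ` C = C" unfolding cosets_def by blast
      then show "C \<in> (\<lambda>v. (+) v ` \<Lambda>) ` {v \<in> Eis. (1 - om) * v \<in> \<Lambda>}" using fx by blast
    next
      fix C assume "C \<in> (\<lambda>v. (+) v ` \<Lambda>) ` {v \<in> Eis. (1 - om) * v \<in> \<Lambda>}"
      then obtain v where "v \<in> Eis" "C = (+) v ` \<Lambda>" "(1 - om) * v \<in> \<Lambda>" by blast
      then show "C \<in> {C \<in> cosets \<Lambda>. (*) om ` C = C}" using fx unfolding cosets_def by blast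
    qed
  qed
  have om1: "1 - om \<noteq> 0" by simp
  have tau\<alpha>: "tau \<alpha> = 0 \<longleftrightarrow> 3 dvd k"
    unfolding InvLat_tau_iff[OF assms, symmetric] \<alpha>(3)
  proof
    assume "\<forall>u\<in>(*) \<alpha> ` Eis. tau u = 0"
    then have "tau (\<alpha> * 1) = 0" using Eis_closed(2) by blast
    then show "tau \<alpha> = 0" by simp
  qed (use \<alpha>(1) in \<open>auto simp: tau_mult\<close>)
  show ?thesis
  proof (cases "3 dvd k")
    case False
    have "v \<in> \<Lambda>" if v: "v \<in> Eis" "(1 - om) * v \<in> \<Lambda>" for v
    proof -
      obtain u where u: "u \<in> Eis" "(1 - om) * v = \<alpha> * u" using v(2) \<alpha>(3) by auto
      have "tau (\<alpha> * u) = 0" using tau_eq_0_iff[of "\<alpha> * u"] u v(1) \<alpha>(1) by (metis Eis_closed(8))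
      then have "3 dvd tau \<alpha> * tau u" using u(1) \<alpha>(1) by (simp add: tau_mult dvd_eq_mod_eq_0)
      moreover have "\<not> 3 dvd tau \<alpha>" using False tau\<alpha> tau_mod[OF \<alpha>(1)] by (auto simp: dvd_eq_mod_eq_0)
      ultimately have "3 dvd tau u" using prime_dvd_mult_iff[of "3::int"] by simp
      then have "tau u = 0" using tau_mod[OF u(1)] by (simp add: dvd_eq_mod_eq_0)
      then obtain w where w: "w \<in> Eis" "u = (1 - om) * w" using tau_eq_0_iff[OF u(1)] by blast
      have "(1 - om) * v = (1 - om) * (\<alpha> * w)" using u(2) w(2) by simp
      then have "v = \<alpha> * w" using om1 mult_left_cancel by blast
      then show ?thesis using \<alpha>(3) w(1) by blast
    qed
    then have "{C \<in> cosets \<Lambda>. (*) om ` C = C} = {\<Lambda>}"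
      unfolding fixed using coset_eq_iff[OF L, of _ 0] sublatticeD(2)[OF L] by (auto intro: image_eqI[of _ _ 0])
    then show ?thesis using False by simp
  next
    case True
    then obtain \<beta> where \<beta>: "\<beta> \<in> Eis" "\<alpha> = (1 - om) * \<beta>" using tau\<alpha> tau_eq_0_iff[OF \<alpha>(1)] by blast
    have \<beta>0: "\<beta> \<noteq> 0" using \<beta> \<alpha>(2) by auto
    have inL: "\<beta> * u \<in> \<Lambda> \<longleftrightarrow> tau u = 0" if "u \<in> Eis" for u
    proof -
      have "\<beta> * u \<in> \<Lambda> \<longleftrightarrow> (\<exists>v\<in>Eis. \<beta> * u = \<beta> * ((1 - om) * v))"
        unfolding \<alpha>(3) \<beta>(2) by (auto simp: image_iff ac_simps)
      then show ?thesis using \<beta>0 tau_eq_0_iff[OF that] by simp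
    qed
    have "{C \<in> cosets \<Lambda>. (*) om ` C = C} = (\<lambda>j. (+) (\<beta> * of_int j) ` \<Lambda>) ` {0, 1, 2}"
    proof (intro equalityI subsetI)
      fix C assume "C \<in> {C \<in> cosets \<Lambda>. (*) om ` C = C}"
      then obtain v where v: "v \<in> Eis" "(1 - om) * v \<in> \<Lambda>" "C = (+) v ` \<Lambda>" unfolding fixed by auto
      obtain u where u: "u \<in> Eis" "(1 - om) * v = \<alpha> * u" using v(2) \<alpha>(3) by auto
      have "(1 - om) * v = (1 - om) * (\<beta> * u)" using u(2) \<beta>(2) by simp
      then have vu: "v = \<beta> * u" using om1 mult_left_cancel by blast
      have "tau (u - of_int (tau u)) = 0" using u(1) by (simp add: tau_diff)
      then have "\<beta> * (u - of_int (tau u)) \<in> \<Lambda>" using inL u(1) by simp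
      then have "C = (+) (\<beta> * of_int (tau u)) ` \<Lambda>"
        unfolding v(3) coset_eq_iff[OF L] vu by (simp add: algebra_simps)
      moreover have "tau u \<in> {0, 1, 2}" using tau_range[OF u(1)] by auto
      ultimately show "C \<in> (\<lambda>j. (+) (\<beta> * of_int j) ` \<Lambda>) ` {0, 1, 2}" by blast
    next
      fix C assume "C \<in> (\<lambda>j. (+) (\<beta> * of_int j) ` \<Lambda>) ` {0, 1, 2}"
      then obtain j :: int where j: "C = (+) (\<beta> * of_int j) ` \<Lambda>" by blast
      have "(1 - om) * (\<beta> * of_int j) = \<alpha> * of_int j" using \<beta>(2) by simp
      then have "(1 - om) * (\<beta> * of_int j) \<in> \<Lambda>" using \<alpha>(3) by auto
      then show "C \<in> {C \<in> cosets \<Lambda>. (*) om ` C = C}" unfolding fixed j using \<beta>(1) by blast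
    qed
    moreover have "inj_on (\<lambda>j. (+) (\<beta> * of_int j) ` \<Lambda>) {0, 1, 2}"
    proof (rule inj_onI)
      fix i j :: int assume ij: "i \<in> {0, 1, 2}" "j \<in> {0, 1, 2}"
        "(+) (\<beta> * of_int i) ` \<Lambda> = (+) (\<beta> * of_int j) ` \<Lambda>"
      then have "\<beta> * of_int (i - j) \<in> \<Lambda>" unfolding coset_eq_iff[OF L] by (simp add: algebra_simps)
      then have "(i - j) mod 3 = 0" using inL[of "of_int (i - j)"] tau_of_int[of "i - j"] by (simp del: of_int_diff tau_of_int)
      then show "i = j" using ij(1,2) by auto
    qed
    ultimately show ?thesis using True by (simp add: card_image)
  qed
qed

text \<open>If \<open>tau\<close> vanishes on the ideal, it is constant on each coset and separates
  them into three kinds; if not, adding multiples of one \<open>\<mu>\<close> with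
  \<open>tau \<mu> \<noteq> 0\<close> lets every coset take all three values.\<close>

lemma card_tau_cosets:
  assumes "k > 0" "\<Lambda> \<in> InvLat k"
  shows "card ((`) tau ` cosets \<Lambda>) = (if 3 dvd k then 3 else 1)"
proof -
  have L: "sublattice \<Lambda>" using assms by (auto simp: InvLat_def Lat_def)
  show ?thesis
  proof (cases "3 dvd k")
    case True
    have "tau ` ((+) v ` \<Lambda>) = {tau v}" if v: "v \<in> Eis" for v
    proof -
      have "tau (v + u) = tau v" if "u \<in> \<Lambda>" for u
        using InvLat_tau_iff[OF assms] True that v sublatticeD(1)[OF L] by (simp add: tau_add)
      then show ?thesis using sublatticeD(2)[OF L] by (auto simp: image_image)
    qed
    then have "(`) tau ` cosets \<Lambda> = (\<lambda>v. {tau v}) ` Eis"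
      unfolding cosets_def image_image by (intro image_cong) auto
    also have "\<dots> = (\<lambda>t. {t}) ` {0, 1, 2}"
    proof (intro equalityI subsetI)
      fix S assume "S \<in> (\<lambda>v. {tau v}) ` Eis"
      then show "S \<in> (\<lambda>t. {t}) ` {0, 1, 2}" using tau_range by fastforce
    next
      fix S :: "int set" assume "S \<in> (\<lambda>t. {t}) ` {0, 1, 2}"
      then obtain t :: int where t: "S = {t}" "t \<in> {0, 1, 2}" by blast
      then have "S = {tau (of_int t)}" by auto
      then show "S \<in> (\<lambda>v. {tau v}) ` Eis" by blast
    qed
    finally have "card ((`) tau ` cosets \<Lambda>) = card ((\<lambda>t. {t}) ` {0, 1, 2 :: int})" by simp
    also have "\<dots> = card {0, 1, 2 :: int}" by (rule card_image) (simp add: inj_on_def)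
    finally show ?thesis using True by simp
  next
    case False
    then obtain \<mu> where \<mu>: "\<mu> \<in> \<Lambda>" "tau \<mu> \<noteq> 0" using InvLat_tau_iff[OF assms] by blast
    have \<mu>E: "\<mu> \<in> Eis" using \<mu>(1) sublatticeD(1)[OF L] by blast
    have "tau ` C = {0, 1, 2}" if "C \<in> cosets \<Lambda>" for C
    proof (intro equalityI subsetI)
      obtain v where v: "v \<in> Eis" "C = (+) v ` \<Lambda>" using \<open>C \<in> cosets \<Lambda>\<close> by (auto simp: cosets_def)
      {
        fix t assume "t \<in> tau ` C"
        then obtain u where "u \<in> \<Lambda>" "t = tau (v + u)" using v(2) by auto
        then show "t \<in> {0, 1, 2}" using tau_range[of "v + u"] v(1) sublatticeD(1)[OF L] by force
      }
      fix t :: int assume t: "t \<in> {0, 1, 2}"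
      \<comment> \<open>A nonzero residue modulo 3 is its own inverse, so adding
        \<open>of_int j * \<mu>\<close> moves the value from \<open>tau v\<close> to
        \<open>t\<close>.\<close>
      define j where "j = (t - tau v) * tau \<mu>"
      have "tau \<mu> = 1 \<or> tau \<mu> = 2" using \<mu>(2) tau_range[OF \<mu>E] by auto
      then have sq: "(tau \<mu> * tau \<mu>) mod 3 = 1" by auto
      have "tau (v + of_int j * \<mu>) = (tau v + (t - tau v) * (tau \<mu> * tau \<mu>)) mod 3"
        using v(1) \<mu>E by (simp add: tau_add tau_mult j_def mod_simps mult.assoc del: of_int_mult of_int_diff)
      also have "\<dots> = (tau v + (t - tau v) * ((tau \<mu> * tau \<mu>) mod 3)) mod 3"
        by (metis mod_add_right_eq mod_mult_right_eq)
      also have "\<dots> = t" unfolding sq using t by auto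
      finally have "t = tau (v + of_int j * \<mu>)" by simp
      moreover have "of_int j * \<mu> \<in> \<Lambda>" using sublattice_of_int[OF L \<mu>(1)] .
      ultimately show "t \<in> tau ` C" using v(2) by blast
    qed
    moreover have "cosets \<Lambda> \<noteq> {}" by (auto simp: cosets_def)
    ultimately have "(`) tau ` cosets \<Lambda> = {{0, 1, 2}}" by auto
    then show ?thesis using False by simp
  qed
qed

section \<open>Subgroups of finite index\<close>

definition conj_set :: "('g, 'k) monoid_scheme \<Rightarrow> 'g \<Rightarrow> 'g set \<Rightarrow> 'g set" where
  "conj_set G g K = (\<lambda>k. g \<otimes>\<^bsub>G\<^esub> k \<otimes>\<^bsub>G\<^esub> inv\<^bsub>G\<^esub> g) ` K"

lemma conj_set_coset: "g <#\<^bsub>G\<^esub> K #>\<^bsub>G\<^esub> inv\<^bsub>G\<^esub> g = conj_set G g K"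
  unfolding conj_set_def l_coset_def r_coset_def by auto

lemma (in group) conj_set_comp:
  assumes "K \<subseteq> carrier G" "g \<in> carrier G" "h \<in> carrier G"
  shows "conj_set G g (conj_set G h K) = conj_set G (g \<otimes> h) K"
  unfolding conj_set_def image_image
proof (rule image_cong[OF HOL.refl])
  fix x assume "x \<in> K"
  then show "g \<otimes> (h \<otimes> x \<otimes> inv h) \<otimes> inv g = g \<otimes> h \<otimes> x \<otimes> inv (g \<otimes> h)"
    using assms by (auto simp: m_assoc inv_mult_group)
qed

text \<open>The relation in \<open>subgroup_classes\<close> relates arbitrary sets, so it is not an
  equivalence relation on subgroups as it stands. On subsets of the carrier, where conjugation by
  the unit is the identity, its classes still describe conjugacy.\<close>

lemma (in group) conj_class_eq_iff:
  assumes K: "K \<subseteq> carrier G" and L: "L \<subseteq> carrier G"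
  defines "R \<equiv> {(K, L). \<exists>g \<in> carrier G. L = g <# K #> inv g}"
  shows "R `` {K} = R `` {L} \<longleftrightarrow> (\<exists>g\<in>carrier G. L = conj_set G g K)"
proof -
  have R: "R `` {K} = (\<lambda>g. conj_set G g K) ` carrier G" for K
    unfolding R_def conj_set_coset by auto
  have one: "conj_set G \<one> K = K" if "K \<subseteq> carrier G" for K
  proof -
    have "(\<lambda>k. \<one> \<otimes> k \<otimes> inv \<one>) ` K = id ` K" by (rule image_cong) (use that in auto)
    then show ?thesis by (simp add: conj_set_def)
  qed
  have le: "R `` {L} \<subseteq> R `` {K}" if "K \<subseteq> carrier G" "g \<in> carrier G" "L = conj_set G g K" for K L g
    unfolding R using conj_set_comp[OF that(1) _ that(2)] that by auto
  show ?thesis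
  proof
    assume "R `` {K} = R `` {L}"
    moreover have "L \<in> R `` {L}" unfolding R using one[OF L] by (metis imageI one_closed)
    ultimately have "L \<in> R `` {K}" by blast
    then show "\<exists>g\<in>carrier G. L = conj_set G g K" unfolding R by blast
  next
    assume "\<exists>g\<in>carrier G. L = conj_set G g K"
    then obtain g where g: "g \<in> carrier G" "L = conj_set G g K" by blast
    have "K = conj_set G (inv g) L" unfolding g(2) using conj_set_comp[OF K inv_closed[OF g(1)] g(1)] g(1) one[OF K] by simp
    then show "R `` {K} = R `` {L}" using le[OF K g] le[OF L inv_closed[OF g(1)]] by blast
  qed
qed

text \<open>The pair \<open>(u, c)\<close> stands for the isometry that sends \<open>(w, t)\<close> to \<open>(om\<^sup>c w + u, t + c)\<close>.\<close>

definition EG :: "(complex \<times> int) monoid" where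
  "EG = \<lparr>carrier = Eis \<times> UNIV, monoid.mult = (\<lambda>(u, c) (v, e). (u + om powi c * v, c + e)), one = (0, 0)\<rparr>"

lemma carrier_EG [simp]: "carrier EG = Eis \<times> UNIV" by (simp add: EG_def)

lemma mult_EG [simp]: "(u, c) \<otimes>\<^bsub>EG\<^esub> (v, e) = (u + om powi c * v, c + e)" by (simp add: EG_def)

lemma one_EG [simp]: "\<one>\<^bsub>EG\<^esub> = (0, 0)" by (simp add: EG_def)

lemma group_EG: "group EG"
proof (rule groupI)
  fix x y z assume x: "x \<in> carrier EG" "y \<in> carrier EG" "z \<in> carrier EG"
  then show "x \<otimes>\<^bsub>EG\<^esub> y \<otimes>\<^bsub>EG\<^esub> z = x \<otimes>\<^bsub>EG\<^esub> (y \<otimes>\<^bsub>EG\<^esub> z)"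
    by (cases x; cases y; cases z) (simp add: rot_add algebra_simps)
next
  fix x y assume "x \<in> carrier EG" "y \<in> carrier EG"
  then show "x \<otimes>\<^bsub>EG\<^esub> y \<in> carrier EG" by (cases x; cases y) auto
next
  fix x assume x: "x \<in> carrier EG"
  then show "\<one>\<^bsub>EG\<^esub> \<otimes>\<^bsub>EG\<^esub> x = x" by (cases x) simp
  obtain u c where u: "x = (u, c)" "u \<in> Eis" using x by auto
  show "\<exists>y\<in>carrier EG. y \<otimes>\<^bsub>EG\<^esub> x = \<one>\<^bsub>EG\<^esub>"
    using u by (intro bexI[of _ "(- (om powi (- c) * u), - c)"]) auto
qed auto

interpretation EG: group EG by (rule group_EG)

lemma inv_EG: "u \<in> Eis \<Longrightarrow> inv\<^bsub>EG\<^esub> (u, c) = (- (om powi (- c) * u), - c)"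
  by (rule EG.inv_equality) auto

lemma EG_div: "u \<in> Eis \<Longrightarrow> v \<in> Eis \<Longrightarrow>
    (u, c) \<otimes>\<^bsub>EG\<^esub> inv\<^bsub>EG\<^esub> (v, e) = (u - om powi (c - e) * v, c - e)"
  using rot_add[of c "- e"] by (simp add: inv_EG)

text \<open>The term \<open>(1 - om powi e) * u\<close> is the only means by which a horizontal
  translation can move an element; it vanishes exactly when \<open>om powi e\<close> is 1 or
  \<open>u\<close> is 0.\<close>

lemma EG_conj: "u \<in> Eis \<Longrightarrow> v \<in> Eis \<Longrightarrow>
    (u, c) \<otimes>\<^bsub>EG\<^esub> (v, e) \<otimes>\<^bsub>EG\<^esub> inv\<^bsub>EG\<^esub> (u, c) = (om powi c * v + (1 - om powi e) * u, e)"
  using EG_div[of "u + om powi c * v" u "c + e" c] by (simp add: algebra_simps)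

lemma snd_int_pow: "x \<in> carrier EG \<Longrightarrow> snd (x [^]\<^bsub>EG\<^esub> (j::int)) = j * snd x"
proof (induction j rule: int_induct[of _ 0])
  case base
  then show ?case by simp
next
  case (step1 i)
  then have "x [^]\<^bsub>EG\<^esub> (i + 1) = x [^]\<^bsub>EG\<^esub> i \<otimes>\<^bsub>EG\<^esub> x" by (simp add: EG.int_pow_mult del: mult_EG)
  moreover obtain p q u c where "x [^]\<^bsub>EG\<^esub> i = (p, q)" "x = (u, c)" by (metis surj_pair)
  ultimately show ?case using step1 by (simp add: algebra_simps)
next
  case (step2 i)
  then have "x [^]\<^bsub>EG\<^esub> (i - 1) = x [^]\<^bsub>EG\<^esub> i \<otimes>\<^bsub>EG\<^esub> inv\<^bsub>EG\<^esub> x"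
    using EG.int_pow_mult[OF step2(3), of i "- 1"] by (simp add: EG.int_pow_neg)
  moreover obtain p q u c where "x [^]\<^bsub>EG\<^esub> i = (p, q)" "x = (u, c)" by (metis surj_pair)
  ultimately show ?case using step2 by (auto simp: inv_EG algebra_simps)
qed

section \<open>Height, lattice and top coset of a subgroup\<close>

definition height :: "(complex \<times> int) set \<Rightarrow> nat" where
  "height K = (LEAST m. m > 0 \<and> (\<exists>u. (u, int m) \<in> K))"

definition lat :: "(complex \<times> int) set \<Rightarrow> complex set" where "lat K = {u. (u, 0) \<in> K}"

definition top_coset :: "(complex \<times> int) set \<Rightarrow> complex set" where
  "top_coset K = {u. (u, int (height K)) \<in> K}"

lemma subgroupEG:
  assumes "subgroup K EG"
  shows "x \<in> K \<Longrightarrow> fst x \<in> Eis" "(0, 0) \<in> K" "x \<in> K \<Longrightarrow> y \<in> K \<Longrightarrow> x \<otimes>\<^bsub>EG\<^esub> y \<in> K"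
    "x \<in> K \<Longrightarrow> inv\<^bsub>EG\<^esub> x \<in> K"
    "(u, c) \<in> K \<Longrightarrow> (v, e) \<in> K \<Longrightarrow> (u - om powi (c - e) * v, c - e) \<in> K"
proof -
  interpret K: subgroup K EG by fact
  show *: "x \<in> K \<Longrightarrow> fst x \<in> Eis" for x using K.subset by fastforce
  show "(0, 0) \<in> K" using K.one_closed by simp
  show 1: "x \<in> K \<Longrightarrow> y \<in> K \<Longrightarrow> x \<otimes>\<^bsub>EG\<^esub> y \<in> K" for x y by simp
  show 2: "x \<in> K \<Longrightarrow> inv\<^bsub>EG\<^esub> x \<in> K" for x by simp
  show "(u, c) \<in> K \<Longrightarrow> (v, e) \<in> K \<Longrightarrow> (u - om powi (c - e) * v, c - e) \<in> K"
    using 1[OF _ 2, of "(u, c)" "(v, e)"] *[of "(u, c)"] *[of "(v, e)"] EG_div[of u v c e]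
    by (metis fst_conv)
qed

lemma sublattice_lat: assumes "subgroup K EG" shows "sublattice (lat K)"
  unfolding sublattice_def lat_def
proof (intro conjI ballI subsetI)
  fix u assume "u \<in> {u. (u, 0) \<in> K}"
  then show "u \<in> Eis" using subgroupEG(1)[OF assms, of "(u, 0)"] by simp
next
  fix u v assume "u \<in> {u. (u, 0) \<in> K}" "v \<in> {u. (u, 0) \<in> K}"
  then show "u - v \<in> {u. (u, 0) \<in> K}" using subgroupEG(5)[OF assms, of u 0 v 0] by simp
qed (use subgroupEG(2)[OF assms] in simp)

text \<open>For a subgroup this fails only when all its elements have second component 0; it makes
  the \<open>LEAST\<close> in \<open>height\<close> meaningful.\<close>

definition has_height :: "(complex \<times> int) set \<Rightarrow> bool" where
  "has_height K \<longleftrightarrow> (\<exists>m>0. \<exists>u. (u, int m) \<in> K)"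

lemma height_pos: assumes "has_height K" shows "height K > 0" "\<exists>u. (u, int (height K)) \<in> K"
  using LeastI_ex[OF assms[unfolded has_height_def]] by (auto simp: height_def)

lemma height_dvd:
  assumes K: "subgroup K EG" and h: "has_height K" and u: "(u, c) \<in> K"
  shows "int (height K) dvd c"
proof -
  let ?S = "{c. \<exists>u. (u, c) \<in> K}"
  obtain d where d: "d > 0" "\<And>x. x \<in> ?S \<longleftrightarrow> d dvd x"
  proof (rule int_subgroup_generator[of ?S])
    show "0 \<in> ?S" using subgroupEG(2)[OF K] by auto
    fix x y assume "x \<in> ?S" "y \<in> ?S"
    then show "x - y \<in> ?S" using subgroupEG(5)[OF K] by blast
  next
    show "\<exists>x\<in>?S. x \<noteq> 0" using height_pos[OF h] by fastforce
  qed (rule that)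
  have "nat d > 0 \<and> (\<exists>u. (u, int (nat d)) \<in> K)" using d by auto
  then have "height K \<le> nat d" unfolding height_def by (rule Least_le)
  moreover have "d dvd int (height K)" using d(2) height_pos(2)[OF h] by blast
  then have "d \<le> int (height K)" using height_pos(1)[OF h] by (simp add: zdvd_imp_le)
  ultimately have "int (height K) = d" using d(1) by linarith
  then show ?thesis using d(2) u by blast
qed

lemma top_coset_eq:
  assumes K: "subgroup K EG" and v: "v \<in> top_coset K"
  shows "top_coset K = (+) v ` lat K"
proof (intro Set.set_eqI)
  fix u
  have v': "(v, int (height K)) \<in> K" using v by (simp add: top_coset_def)
  have "(u, int (height K)) \<in> K \<longleftrightarrow> (u - v, 0) \<in> K"
    using subgroupEG(5)[OF K _ v', of u "int (height K)"] subgroupEG(3)[OF K _ v', of "(u - v, 0)"] by auto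
  then show "u \<in> top_coset K \<longleftrightarrow> u \<in> (+) v ` lat K"
    by (simp add: top_coset_def lat_def mem_coset)
qed

lemma lat_rot_invariant:
  assumes K: "subgroup K EG" and h: "has_height K" and u: "u \<in> lat K"
  shows "om powi (int (height K)) * u \<in> lat K"
proof -
  obtain v where v: "(v, int (height K)) \<in> K" using height_pos[OF h] by blast
  have u': "(u, 0) \<in> K" using u by (simp add: lat_def)
  have "(v, int (height K)) \<otimes>\<^bsub>EG\<^esub> (u, 0) \<otimes>\<^bsub>EG\<^esub> inv\<^bsub>EG\<^esub> (v, int (height K)) \<in> K"
    using subgroupEG(3,4)[OF K] v u' by blast
  then show ?thesis
    using EG_conj[of v u "int (height K)" 0] subgroupEG(1)[OF K v] subgroupEG(1)[OF K u'] by (simp add: lat_def)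
qed

text \<open>Conjugation by an element of height \<open>?l\<close> multiplies horizontal translations
  by \<open>om powi ?l\<close>, and \<open>om\<close> is the first or the second power of that
  number.\<close>

lemma lat_om_invariant:
  assumes K: "subgroup K EG" and h: "has_height K" and l: "\<not> 3 dvd height K" and u: "u \<in> lat K"
  shows "om * u \<in> lat K"
proof -
  let ?l = "int (height K)"
  have "?l mod 3 = 1 \<or> ?l mod 3 = 2" using l by presburger
  then show ?thesis
  proof
    assume "?l mod 3 = 1"
    then have "om powi ?l = om" by (subst rot_mod3) simp
    then show ?thesis using lat_rot_invariant[OF K h u] by simp
  next
    assume "?l mod 3 = 2"
    then have o: "om powi ?l = om * om" by (subst rot_mod3) (simp add: power2_eq_square)
    have "om powi ?l * (om powi ?l * u) \<in> lat K" using lat_rot_invariant[OF K h] u by blast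
    moreover have "om powi ?l * (om powi ?l * u) = (om * (om * om)) * (om * u)" unfolding o by (simp add: mult.assoc)
    ultimately have "(om * (om * om)) * (om * u) \<in> lat K" by (simp only:)
    then show ?thesis by (simp only: om_cubed mult_1)
  qed
qed

text \<open>If multiplication by \<open>om powi (int l)\<close> preserves \<Lambda>, the element
  \<open>(v, int l)\<close> normalises the translations by \<Lambda>, and these products form the
  subgroup generated by both.\<close>

definition lift_subgroup :: "nat \<Rightarrow> complex set \<Rightarrow> complex \<Rightarrow> (complex \<times> int) set" where
  "lift_subgroup l \<Lambda> v = {(\<kappa>, 0) \<otimes>\<^bsub>EG\<^esub> (v, int l) [^]\<^bsub>EG\<^esub> j |\<kappa> j::int. \<kappa> \<in> \<Lambda>}"

lemma subgroup_eq_lift_subgroup: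
  assumes K: "subgroup K EG" and h: "has_height K" and v: "v \<in> top_coset K"
  shows "K = lift_subgroup (height K) (lat K) v"
proof (intro equalityI subsetI)
  let ?g = "(v, int (height K))"
  have g: "?g \<in> K" using v by (simp add: top_coset_def)
  then have gE: "?g \<in> carrier EG" using subgroupEG(1)[OF K g] by simp
  have gp: "?g [^]\<^bsub>EG\<^esub> j \<in> K" for j :: int using EG.subgroup_int_pow_closed[OF K g] .
  {
    fix x assume x: "x \<in> K"
    obtain u c where uc: "x = (u, c)" by (cases x)
    then obtain j where j: "c = int (height K) * j" using height_dvd[OF K h] x by blast
    define y where "y = x \<otimes>\<^bsub>EG\<^esub> inv\<^bsub>EG\<^esub> (?g [^]\<^bsub>EG\<^esub> j)"
    have yK: "y \<in> K" unfolding y_def using subgroupEG(3,4)[OF K] x gp by blast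
    obtain p q where pq: "?g [^]\<^bsub>EG\<^esub> j = (p, q)" by (metis surj_pair)
    have p: "p \<in> Eis" using subgroupEG(1)[OF K gp[of j]] pq by simp
    have "q = c" using snd_int_pow[OF gE, of j] pq j by simp
    then have "snd y = 0" using p pq subgroupEG(1)[OF K x] uc unfolding y_def by (simp add: EG_div)
    then obtain \<kappa> where \<kappa>: "y = (\<kappa>, 0)" by (metis prod.collapse)
    have "x \<in> carrier EG" using subgroupEG(1)[OF K x] uc by simp
    then have "x = y \<otimes>\<^bsub>EG\<^esub> ?g [^]\<^bsub>EG\<^esub> j" unfolding y_def using gE EG.inv_solve_right' by (simp add: EG.m_assoc del: mult_EG carrier_EG one_EG)
    then show "x \<in> lift_subgroup (height K) (lat K) v"
      using yK \<kappa> unfolding lift_subgroup_def lat_def by blast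
  }
  fix x assume "x \<in> lift_subgroup (height K) (lat K) v"
  then show "x \<in> K" using subgroupEG(3)[OF K _ gp] unfolding lift_subgroup_def lat_def by blast
qed

lemma lift_subgroup_props:
  assumes l: "l > 0" and L: "sublattice \<Lambda>" and inv: "\<not> 3 dvd l \<Longrightarrow> \<Lambda> \<in> InvLat k" and v: "v \<in> Eis"
  defines "K \<equiv> lift_subgroup l \<Lambda> v"
  shows "subgroup K EG" "has_height K" "height K = l" "lat K = \<Lambda>" "top_coset K = (+) v ` \<Lambda>"
proof -
  let ?g = "(v, int l)"
  have gE: "?g \<in> carrier EG" using v by simp
  \<comment> \<open>The translation part of the powers of \<open>?g\<close>; its cocycle rule
    \<open>Padd\<close> is what closes \<open>K\<close> under multiplication and inversion.\<close>
  define P where "P j = fst (?g [^]\<^bsub>EG\<^esub> (j::int))" for j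
  have g: "?g [^]\<^bsub>EG\<^esub> (j::int) = (P j, j * int l)" for j
    using snd_int_pow[OF gE, of j] by (simp add: P_def prod_eq_iff)
  have PE: "P j \<in> Eis" for j using EG.int_pow_closed[OF gE, of j] g[of j] by simp
  have Padd: "P (i + j) = P i + om powi (i * int l) * P j" for i j
    using EG.int_pow_mult[OF gE, of i j] by (simp add: g)
  have P0: "P 0 = 0" using g[of 0] by simp
  have P1: "P 1 = v" using g[of 1] EG.int_pow_1[OF gE] by simp
  have K: "K = {(\<kappa> + P j, j * int l) |\<kappa> j. \<kappa> \<in> \<Lambda>}"
    unfolding K_def lift_subgroup_def g by simp
  have rotL: "om powi (i * int l) * u \<in> \<Lambda>" if "u \<in> \<Lambda>" for i u
  proof (cases "3 dvd l")
    case True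
    then have "3 dvd i * int l" by (metis dvd_mult of_nat_dvd_iff of_nat_numeral)
    then show ?thesis using that by (simp add: rot_eq_1_iff[THEN iffD2])
  next
    case False
    then show ?thesis using InvLat_mult[OF inv that] by blast
  qed
  show "subgroup K EG"
  proof (rule EG.subgroupI)
    show "K \<subseteq> carrier EG" unfolding K using PE sublatticeD(1)[OF L] by auto
    show "K \<noteq> {}" unfolding K using sublatticeD(2)[OF L] by auto
  next
    fix x assume "x \<in> K"
    then obtain \<kappa> j where x: "x = (\<kappa> + P j, j * int l)" "\<kappa> \<in> \<Lambda>" unfolding K by blast
    let ?w = "om powi (- (j * int l))"
    have "0 = P (- j) + ?w * P j" using Padd[of "- j" j] P0 by simp
    then have "P (- j) = - (?w * P j)" by (simp add: eq_neg_iff_add_eq_0)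
    then have "inv\<^bsub>EG\<^esub> x = (- (?w * \<kappa>) + P (- j), (- j) * int l)"
      unfolding x(1) using PE sublatticeD(1)[OF L x(2)] by (simp add: inv_EG algebra_simps)
    moreover have "- (?w * \<kappa>) \<in> \<Lambda>" using rotL[OF x(2), of "- j"] sublatticeD(4)[OF L] by simp
    ultimately show "inv\<^bsub>EG\<^esub> x \<in> K" unfolding K by blast
  next
    fix x y assume "x \<in> K" "y \<in> K"
    then obtain \<kappa> \<mu> i j where x: "x = (\<kappa> + P i, i * int l)" "\<kappa> \<in> \<Lambda>" "y = (\<mu> + P j, j * int l)" "\<mu> \<in> \<Lambda>"
      unfolding K by blast
    have "x \<otimes>\<^bsub>EG\<^esub> y = ((\<kappa> + om powi (i * int l) * \<mu>) + P (i + j), (i + j) * int l)"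
      unfolding x Padd by (simp add: algebra_simps)
    moreover have "\<kappa> + om powi (i * int l) * \<mu> \<in> \<Lambda>" using x rotL sublatticeD(5)[OF L] by blast
    ultimately show "x \<otimes>\<^bsub>EG\<^esub> y \<in> K" unfolding K by blast
  qed
  have vK: "(v, int l) \<in> K"
  proof -
    have "(0 + P 1, 1 * int l) \<in> K" unfolding K using sublatticeD(2)[OF L] by blast
    then show ?thesis by (simp add: P1)
  qed
  then show hh: "has_height K" using l unfolding has_height_def by blast
  show hl: "height K = l"
    unfolding height_def
  proof (rule Least_equality)
    show "l > 0 \<and> (\<exists>u. (u, int l) \<in> K)" using l vK by blast
    fix m assume m: "m > 0 \<and> (\<exists>u. (u, int m) \<in> K)"
    then obtain j where "int m = j * int l" unfolding K by blast
    then have "int l dvd int m" by simp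
    then show "l \<le> m" using m by (simp add: dvd_imp_le)
  qed
  show "lat K = \<Lambda>" unfolding lat_def K using l P0 by auto
  have "top_coset K = {u. (u, int l) \<in> K}" by (simp add: top_coset_def hl)
  also have "\<dots> = (+) v ` \<Lambda>" unfolding K
  proof (intro Set.set_eqI iffI)
    fix u assume "u \<in> (+) v ` \<Lambda>"
    then obtain \<kappa> where "\<kappa> \<in> \<Lambda>" "u = \<kappa> + P 1" using P1 by (auto simp: add.commute)
    then show "u \<in> {u. (u, int l) \<in> {(\<kappa> + P j, j * int l) |\<kappa> j. \<kappa> \<in> \<Lambda>}}"
      by (intro CollectI exI[of _ \<kappa>] exI[of _ 1]) simp
  qed (use l P1 in \<open>auto simp: image_iff ac_simps\<close>)
  finally show "top_coset K = (+) v ` \<Lambda>" .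
qed

lemma rcos_eq_iff:
  assumes K: "subgroup K EG" and x: "x \<in> carrier EG" "y \<in> carrier EG"
  shows "K #>\<^bsub>EG\<^esub> x = K #>\<^bsub>EG\<^esub> y \<longleftrightarrow> x \<otimes>\<^bsub>EG\<^esub> inv\<^bsub>EG\<^esub> y \<in> K"
  using subgroup.rcos_module[OF K group_EG x(2,1)] EG.repr_independence[OF _ x(2) K, of x]
    EG.repr_independenceD[OF K x(1), of y] by blast

text \<open>Multiplying by a power of an element at height \<open>?l\<close> brings the second
  component into the range from 0 to \<open>?l - 1\<close>; what then remains of the first component
  is its coset modulo the lattice.\<close>

lemma card_rcosets:
  assumes K: "subgroup K EG" and h: "has_height K"
  shows "card (rcosets\<^bsub>EG\<^esub> K) = height K * card (cosets (lat K))"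
proof -
  let ?l = "int (height K)" and ?I = "Eis \<times> {0..<int (height K)}"
  obtain v where v: "(v, ?l) \<in> K" using height_pos[OF h] by blast
  have vE: "v \<in> Eis" using subgroupEG(1)[OF K v] by simp
  have l: "?l > 0" using height_pos(1)[OF h] by simp
  have "rcosets\<^bsub>EG\<^esub> K = (\<lambda>(u, c). K #>\<^bsub>EG\<^esub> (u, c)) ` ?I"
  proof (intro equalityI subsetI)
    fix C assume "C \<in> rcosets\<^bsub>EG\<^esub> K"
    then obtain u c where uc: "u \<in> Eis" "C = K #>\<^bsub>EG\<^esub> (u, c)" by (auto simp: RCOSETS_def)
    define y where "y = inv\<^bsub>EG\<^esub> ((v, ?l) [^]\<^bsub>EG\<^esub> (c div ?l)) \<otimes>\<^bsub>EG\<^esub> (u, c)"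
    have gE: "(v, ?l) \<in> carrier EG" using vE by simp
    have gK: "(v, ?l) [^]\<^bsub>EG\<^esub> (c div ?l) \<in> K" using EG.subgroup_int_pow_closed[OF K v] .
    obtain p q where pq: "(v, ?l) [^]\<^bsub>EG\<^esub> (c div ?l) = (p, q)" by (metis surj_pair)
    have p: "p \<in> Eis" using subgroupEG(1)[OF K gK] pq by simp
    have q: "q = c div ?l * ?l" using snd_int_pow[OF gE, of "c div ?l"] pq by simp
    have uE: "(u, c) \<in> carrier EG" using uc by simp
    have yE: "y \<in> carrier EG" unfolding y_def using gE uE by (simp del: mult_EG carrier_EG)
    have "(u, c) \<otimes>\<^bsub>EG\<^esub> inv\<^bsub>EG\<^esub> y = (v, ?l) [^]\<^bsub>EG\<^esub> (c div ?l)"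
      unfolding y_def using gE uE
      by (simp add: EG.inv_mult_group EG.m_assoc[symmetric] del: mult_EG carrier_EG one_EG)
    then have "C = K #>\<^bsub>EG\<^esub> y" using rcos_eq_iff[OF K _ yE, of "(u, c)"] uc gK by simp
    moreover have "snd y = c mod ?l" unfolding y_def pq using p q by (simp add: inv_EG minus_div_mult_eq_mod[symmetric])
    then have "y \<in> ?I" using yE l by (cases y) auto
    ultimately show "C \<in> (\<lambda>(u, c). K #>\<^bsub>EG\<^esub> (u, c)) ` ?I" by (cases y) auto
  qed (auto simp: RCOSETS_def)
  moreover have "card ((\<lambda>(u, c). K #>\<^bsub>EG\<^esub> (u, c)) ` ?I) = card ((\<lambda>(u, c). (c, (+) u ` lat K)) ` ?I)"
  proof (rule card_image_same_kernel, clarify)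
    fix u c u' c' assume *: "u \<in> Eis" "c \<in> {0..<?l}" "u' \<in> Eis" "c' \<in> {0..<?l}"
    have "K #>\<^bsub>EG\<^esub> (u, c) = K #>\<^bsub>EG\<^esub> (u', c') \<longleftrightarrow> (u - om powi (c - c') * u', c - c') \<in> K"
      using rcos_eq_iff[OF K, of "(u, c)" "(u', c')"] * by (simp add: EG_div)
    also have "\<dots> \<longleftrightarrow> c = c' \<and> u - u' \<in> lat K"
    proof
      assume a: "(u - om powi (c - c') * u', c - c') \<in> K"
      then have "?l dvd c - c'" using height_dvd[OF K h] by blast
      then have "c = c'" using * by (metis atLeastLessThan_iff mod_eq_dvd_iff mod_pos_pos_trivial)
      then show "c = c' \<and> u - u' \<in> lat K" using a by (simp add: lat_def)
    qed (simp add: lat_def)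
    also have "\<dots> \<longleftrightarrow> (c, (+) u ` lat K) = (c', (+) u' ` lat K)"
      using coset_eq_iff[OF sublattice_lat[OF K]] by simp
    finally show "(K #>\<^bsub>EG\<^esub> (u, c) = K #>\<^bsub>EG\<^esub> (u', c')) = ((c, (+) u ` lat K) = (c', (+) u' ` lat K))" .
  qed
  moreover have "(\<lambda>(u, c). (c, (+) u ` lat K)) ` ?I = {0..<?l} \<times> cosets (lat K)"
    by (auto simp: cosets_def)
  ultimately show ?thesis by (simp add: card_cartesian_product)
qed

text \<open>Two of the infinitely many elements \<open>(0, i)\<close> lie in the same coset, and up
  to sign their quotient has positive height.\<close>

lemma finite_index_has_height:
  assumes K: "subgroup K EG" and f: "finite (rcosets\<^bsub>EG\<^esub> K)"
  shows "has_height K"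
proof -
  have "finite (range (\<lambda>i::nat. K #>\<^bsub>EG\<^esub> (0, int i)))"
    by (rule finite_subset[OF _ f]) (auto simp: RCOSETS_def)
  then have "\<not> inj (\<lambda>i::nat. K #>\<^bsub>EG\<^esub> (0, int i))" using finite_imageD infinite_UNIV_nat by blast
  then obtain i j :: nat where "i \<noteq> j" "K #>\<^bsub>EG\<^esub> (0, int i) = K #>\<^bsub>EG\<^esub> (0, int j)"
    unfolding inj_def by blast
  then have ij: "(0, int i - int j) \<in> K" "i \<noteq> j" using rcos_eq_iff[OF K] by (auto simp: EG_div)
  then have "(0, int j - int i) \<in> K" using subgroupEG(4)[OF K ij(1)] by (simp add: inv_EG)
  then have "(0, int (nat \<bar>int i - int j\<bar>)) \<in> K" using ij(1) by (auto simp: abs_if)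
  moreover have "nat \<bar>int i - int j\<bar> > 0" using ij(2) by simp
  ultimately show ?thesis unfolding has_height_def by blast
qed

definition IndexSub :: "nat \<Rightarrow> (complex \<times> int) set set" where
  "IndexSub n = {K. subgroup K EG \<and> card (rcosets\<^bsub>EG\<^esub> K) = n}"

lemma IndexSubD:
  assumes "n > 0" "K \<in> IndexSub n"
  shows "subgroup K EG" "has_height K" "height K > 0" "height K * card (cosets (lat K)) = n"
    "height K dvd n" "n div height K > 0" "lat K \<in> Lat (n div height K)"
    "\<not> 3 dvd height K \<Longrightarrow> lat K \<in> InvLat (n div height K)"
    "top_coset K \<in> cosets (lat K)"
proof -
  show K: "subgroup K EG" using assms by (simp add: IndexSub_def)
  have c: "card (rcosets\<^bsub>EG\<^esub> K) = n" using assms by (simp add: IndexSub_def)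
  then have "finite (rcosets\<^bsub>EG\<^esub> K)" using assms(1) card_ge_0_finite by metis
  then show h: "has_height K" using finite_index_has_height[OF K] by blast
  show hp: "height K > 0" using height_pos[OF h] by blast
  show e: "height K * card (cosets (lat K)) = n" using card_rcosets[OF K h] c by simp
  then show "height K dvd n" by auto
  have d: "n div height K = card (cosets (lat K))" using e hp by auto
  then show "n div height K > 0" using e assms(1) by (metis gr0I mult_0_right)
  show L: "lat K \<in> Lat (n div height K)" using sublattice_lat[OF K] d by (simp add: Lat_def)
  show "\<not> 3 dvd height K \<Longrightarrow> lat K \<in> InvLat (n div height K)"
    using L lat_om_invariant[OF K h] by (simp add: InvLat_def)
  obtain v where v: "(v, int (height K)) \<in> K" using height_pos[OF h] by blast
  then have "v \<in> Eis" using subgroupEG(1)[OF K v] by simp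
  moreover have "top_coset K = (+) v ` lat K" using top_coset_eq[OF K] v by (simp add: top_coset_def)
  ultimately show "top_coset K \<in> cosets (lat K)" by (simp add: cosets_def)
qed

lemma top_coset_ne: "has_height K \<Longrightarrow> \<exists>v. v \<in> top_coset K"
  using height_pos(2) by (auto simp: top_coset_def)

lemma subgroup_params_inj:
  assumes "subgroup K EG" "has_height K" "subgroup L EG" "has_height L"
    and "height K = height L" "lat K = lat L" "top_coset K = top_coset L"
  shows "K = L"
  using top_coset_ne[OF assms(2)] subgroup_eq_lift_subgroup[OF assms(1,2)] subgroup_eq_lift_subgroup[OF assms(3,4)] assms(5-)
  by metis

definition params :: "(complex \<times> int) set \<Rightarrow> nat \<times> complex set \<times> complex set" where
  "params K = (height K, lat K, top_coset K)"

lemma params_surj: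
  assumes n: "n > 0" and l: "l dvd n" and L: "\<Lambda> \<in> Lat (n div l)" and inv: "\<not> 3 dvd l \<Longrightarrow> \<Lambda> \<in> InvLat (n div l)"
    and C: "C \<in> cosets \<Lambda>"
  obtains K where "K \<in> IndexSub n" "params K = (l, \<Lambda>, C)"
proof -
  obtain v where v: "v \<in> Eis" "C = (+) v ` \<Lambda>" using C by (auto simp: cosets_def)
  have l0: "l > 0" using n l by (auto intro: dvd_pos_nat)
  have SL: "sublattice \<Lambda>" "card (cosets \<Lambda>) = n div l" using L by (auto simp: Lat_def)
  note p = lift_subgroup_props[OF l0 SL(1) inv v(1)]
  have "card (rcosets\<^bsub>EG\<^esub> (lift_subgroup l \<Lambda> v)) = n"
    using card_rcosets[OF p(1,2)] p(3,4) SL(2) l by simp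
  then show ?thesis using that[of "lift_subgroup l \<Lambda> v"] p v(2) by (simp add: IndexSub_def params_def)
qed

lemma inj_params: "n > 0 \<Longrightarrow> inj_on params (IndexSub n)"
  by (intro inj_onI subgroup_params_inj) (auto simp: params_def IndexSubD)

definition TransSub :: "nat \<Rightarrow> (complex \<times> int) set set" where "TransSub n = {K \<in> IndexSub n. 3 dvd height K}"
definition ScrewSub :: "nat \<Rightarrow> (complex \<times> int) set set" where "ScrewSub n = {K \<in> IndexSub n. \<not> 3 dvd height K}"

section \<open>Conjugation in terms of the parameters\<close>

abbreviation conjEG :: "complex \<times> int \<Rightarrow> (complex \<times> int) set \<Rightarrow> (complex \<times> int) set" where
  "conjEG \<equiv> conj_set EG"

lemma conjEG_eq:
  assumes "subgroup K EG" "u \<in> Eis"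
  shows "conjEG (u, c) K = (\<lambda>(v, e). (om powi c * v + (1 - om powi e) * u, e)) ` K"
  unfolding conj_set_def
proof (rule image_cong[OF HOL.refl])
  fix x assume x: "x \<in> K"
  obtain v e where "x = (v, e)" by (cases x)
  then show "(u, c) \<otimes>\<^bsub>EG\<^esub> x \<otimes>\<^bsub>EG\<^esub> inv\<^bsub>EG\<^esub> (u, c) = (case x of (v, e) \<Rightarrow> (om powi c * v + (1 - om powi e) * u, e))"
    using EG_conj[OF assms(2), of v c e] subgroupEG(1)[OF assms(1) x] by simp
qed

lemma conjEG_comp:
  assumes "subgroup K EG" "g \<in> carrier EG" "h \<in> carrier EG"
  shows "conjEG g (conjEG h K) = conjEG (g \<otimes>\<^bsub>EG\<^esub> h) K"
  using EG.conj_set_comp[OF subgroup.subset[OF assms(1)] assms(2,3)] .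

lemma conjEG_one: assumes "subgroup K EG" shows "conjEG (0, 0) K = K"
  using conjEG_eq[OF assms, of 0 0] by auto

lemma subgroup_conjEG:
  assumes K: "subgroup K EG" and g: "g \<in> carrier EG"
  shows "subgroup (conjEG g K) EG"
proof (rule EG.subgroupI)
  have KE: "x \<in> carrier EG" if "x \<in> K" for x using K that subgroup.subset by blast
  show "conjEG g K \<subseteq> carrier EG" using g KE by (auto simp: conj_set_def simp del: carrier_EG)
  show "conjEG g K \<noteq> {}" using subgroupEG(2)[OF K] by (auto simp: conj_set_def)
  fix x assume "x \<in> conjEG g K"
  then obtain k where k: "k \<in> K" "x = g \<otimes>\<^bsub>EG\<^esub> k \<otimes>\<^bsub>EG\<^esub> inv\<^bsub>EG\<^esub> g" by (auto simp: conj_set_def)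
  then have "inv\<^bsub>EG\<^esub> x = g \<otimes>\<^bsub>EG\<^esub> inv\<^bsub>EG\<^esub> k \<otimes>\<^bsub>EG\<^esub> inv\<^bsub>EG\<^esub> g"
    using KE g by (simp add: EG.inv_mult_group EG.m_assoc del: carrier_EG mult_EG)
  then show "inv\<^bsub>EG\<^esub> x \<in> conjEG g K" using subgroupEG(4)[OF K k(1)] by (auto simp: conj_set_def)
  fix y assume "y \<in> conjEG g K"
  then obtain k' where k': "k' \<in> K" "y = g \<otimes>\<^bsub>EG\<^esub> k' \<otimes>\<^bsub>EG\<^esub> inv\<^bsub>EG\<^esub> g" by (auto simp: conj_set_def)
  have cancel: "inv\<^bsub>EG\<^esub> g \<otimes>\<^bsub>EG\<^esub> (g \<otimes>\<^bsub>EG\<^esub> z) = z" if "z \<in> carrier EG" for z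
    using that g by (simp add: EG.m_assoc[symmetric] del: carrier_EG mult_EG)
      (metis EG.l_one one_EG)
  have "x \<otimes>\<^bsub>EG\<^esub> y = g \<otimes>\<^bsub>EG\<^esub> (k \<otimes>\<^bsub>EG\<^esub> k') \<otimes>\<^bsub>EG\<^esub> inv\<^bsub>EG\<^esub> g"
    unfolding k(2) k'(2) using KE[OF k(1)] KE[OF k'(1)] g
    by (simp add: EG.m_assoc cancel del: carrier_EG mult_EG)
  then show "x \<otimes>\<^bsub>EG\<^esub> y \<in> conjEG g K" using subgroupEG(3)[OF K k(1) k'(1)] by (auto simp: conj_set_def)
qed

lemma conjEG_params:
  fixes c :: int
  assumes K: "subgroup K EG" and h: "has_height K" and u: "u \<in> Eis"
  defines "K' \<equiv> conjEG (u, c) K"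
  shows "has_height K'" "height K' = height K" "lat K' = (*) (om powi c) ` lat K"
    "top_coset K' = (\<lambda>v. om powi c * v + (1 - om powi (int (height K))) * u) ` top_coset K"
proof -
  have K': "K' = (\<lambda>(v, e). (om powi c * v + (1 - om powi e) * u, e)) ` K"
    unfolding K'_def using conjEG_eq[OF K u] .
  have lev: "(\<exists>u. (u, e) \<in> K') \<longleftrightarrow> (\<exists>u. (u, e) \<in> K)" for e unfolding K' by force
  show "has_height K'" using h unfolding has_height_def lev .
  show hh: "height K' = height K" unfolding height_def lev ..
  show "lat K' = (*) (om powi c) ` lat K" unfolding lat_def K' by force
  show "top_coset K' = (\<lambda>v. om powi c * v + (1 - om powi (int (height K))) * u) ` top_coset K"
  proof -
    have "top_coset K' = {w. (w, int (height K)) \<in> K'}" by (simp add: top_coset_def hh)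
    then show ?thesis unfolding top_coset_def K' by force
  qed
qed

lemma card_cosets_rot:
  shows "card (cosets ((*) (om powi c) ` \<Lambda>)) = card (cosets \<Lambda>)"
proof -
  have r: "(*) (om powi c) ` (+) v ` \<Lambda> = (+) (om powi c * v) ` (*) (om powi c) ` \<Lambda>" for v c \<Lambda>
    unfolding image_image by (simp add: distrib_left)
  have E: "(*) (om powi c) ` Eis = Eis"
  proof (intro equalityI subsetI)
    fix u assume u: "u \<in> Eis"
    have "u = om powi c * (om powi (- c) * u)" by (simp add: rot_minus mult.assoc[symmetric])
    then show "u \<in> (*) (om powi c) ` Eis" using u by blast
  qed auto
  have "cosets ((*) (om powi c) ` \<Lambda>) = (\<lambda>v. (+) v ` (*) (om powi c) ` \<Lambda>) ` (*) (om powi c) ` Eis"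
    unfolding cosets_def E ..
  also have "\<dots> = (`) ((*) (om powi c)) ` cosets \<Lambda>"
    unfolding cosets_def image_image[of _ _ Eis] r ..
  finally have eq: "cosets ((*) (om powi c) ` \<Lambda>) = (`) ((*) (om powi c)) ` cosets \<Lambda>" .
  have "inj ((*) (om powi c))" by (auto simp: inj_def)
  then have "inj_on ((`) ((*) (om powi c))) (cosets \<Lambda>)" by (meson inj_image_eq_iff inj_onI)
  then show ?thesis unfolding eq by (rule card_image)
qed

lemma conjEG_IndexSub:
  assumes n: "n > 0" and K: "K \<in> IndexSub n" and g: "g \<in> carrier EG"
  shows "conjEG g K \<in> IndexSub n"
proof -
  obtain u c where g': "g = (u, c)" "u \<in> Eis" using g by auto
  note S = IndexSubD[OF n K]
  note p = conjEG_params[OF S(1,2) g'(2), of c]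
  have "card (rcosets\<^bsub>EG\<^esub> (conjEG g K)) = n"
    using card_rcosets[OF subgroup_conjEG[OF S(1) g]] p S(4) unfolding g' by (simp add: card_cosets_rot)
  then show ?thesis using subgroup_conjEG[OF S(1) g] by (simp add: IndexSub_def)
qed

section \<open>Counting conjugacy classes\<close>

text \<open>Burnside's count for a cyclic group of order 3, cleared of the denominator: orbits have
  one or three elements, and those with one are the fixed points.\<close>

lemma card_orbits_order_3:
  assumes fin: "finite S" and f: "\<And>x. x \<in> S \<Longrightarrow> f x \<in> S" and f3: "\<And>x. x \<in> S \<Longrightarrow> f (f (f x)) = x"
  shows "3 * card ((\<lambda>x. {x, f x, f (f x)}) ` S) = card S + 2 * card {x \<in> S. f x = x}"
proof -
  define O3 where "O3 x = {x, f x, f (f x)}" for x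
  define F where "F = {x \<in> S. f x = x}"
  have same: "O3 x = O3 y" if "x \<in> S" "y \<in> O3 x" for x y
    using that f3[OF that(1)] by (auto simp: O3_def)
  have sub: "O3 x \<subseteq> S" if "x \<in> S" for x using that f by (auto simp: O3_def)
  have self: "x \<in> O3 x" for x by (simp add: O3_def)
  have Un: "\<Union>(O3 ` S) = S" using sub self by blast
  have disj: "A \<inter> B = {}" if AB: "A \<in> O3 ` S" "B \<in> O3 ` S" "A \<noteq> B" for A B
  proof (rule ccontr)
    assume "A \<inter> B \<noteq> {}"
    then obtain z where z: "z \<in> A" "z \<in> B" by blast
    obtain x y where "x \<in> S" "A = O3 x" "y \<in> S" "B = O3 y" using AB by blast
    then have "A = O3 z" "B = O3 z" using same z by blast+
    then show False using AB(3) by simp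
  qed
  have "card S = (\<Sum>B\<in>O3 ` S. card B)"
    by (subst Un[symmetric], rule card_Union_disjoint)
      (use disj finite_subset[OF sub fin] in \<open>auto simp: pairwise_def disjnt_def\<close>)
  also have "\<dots> = (\<Sum>B\<in>O3 ` S. if B \<in> O3 ` F then 1 else 3)"
  proof (rule sum.cong[OF HOL.refl])
    fix B assume "B \<in> O3 ` S"
    then obtain x where x: "x \<in> S" "B = O3 x" by blast
    show "card B = (if B \<in> O3 ` F then 1 else 3)"
    proof (cases "B \<in> O3 ` F")
      case True
      then obtain y where "f y = y" "B = O3 y" by (auto simp: F_def)
      then have "B = {y}" by (simp add: O3_def)
      then show ?thesis using True by simp
    next
      case False
      then have "x \<notin> F" using x(2) by blast
      then have n1: "f x \<noteq> x" using x(1) by (simp add: F_def)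
      moreover have "f (f x) \<noteq> x" using f3[OF x(1)] n1 by metis
      moreover have "f (f x) \<noteq> f x" using f3[OF x(1)] n1 by metis
      ultimately have "card B = 3" using x(2) by (simp add: O3_def eq_commute)
      then show ?thesis using False by simp
    qed
  qed
  also have "\<dots> = card (O3 ` F) + 3 * card (O3 ` S - O3 ` F)"
  proof -
    have FS: "O3 ` S = O3 ` F \<union> (O3 ` S - O3 ` F)" by (auto simp: F_def)
    have "(\<Sum>B\<in>O3 ` F \<union> (O3 ` S - O3 ` F). if B \<in> O3 ` F then 1 else 3)
      = (\<Sum>B\<in>O3 ` F. if B \<in> O3 ` F then 1 else 3) + (\<Sum>B\<in>O3 ` S - O3 ` F. if B \<in> O3 ` F then 1 else (3::nat))"
      by (rule sum.union_disjoint) (use fin in \<open>auto simp: F_def\<close>)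
    also have "(\<Sum>B\<in>O3 ` F. if B \<in> O3 ` F then 1 else (3::nat)) = (\<Sum>B\<in>O3 ` F. 1)"
      by (rule sum.cong) auto
    also have "(\<Sum>B\<in>O3 ` S - O3 ` F. if B \<in> O3 ` F then 1 else (3::nat)) = (\<Sum>B\<in>O3 ` S - O3 ` F. 3)"
      by (rule sum.cong) auto
    finally show ?thesis unfolding FS[symmetric] by simp
  qed
  finally have 1: "card S = card (O3 ` F) + 3 * card (O3 ` S - O3 ` F)" .
  have "inj_on O3 F" by (auto simp: inj_on_def F_def O3_def)
  then have "card (O3 ` F) = card F" by (rule card_image)
  moreover have "card (O3 ` S - O3 ` F) = card (O3 ` S) - card (O3 ` F)"
    by (rule card_Diff_subset) (use fin in \<open>auto simp: F_def\<close>)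
  moreover have "card (O3 ` F) \<le> card (O3 ` S)" by (rule card_mono) (use fin in \<open>auto simp: F_def\<close>)
  ultimately show ?thesis using 1 unfolding O3_def F_def by linarith
qed

text \<open>In the applications \<open>x\<close> is a height, \<open>y\<close> a lattice and
  \<open>C x y\<close> a set of cosets, whose number is governed by the index and therefore by the
  height alone.\<close>

lemma card_Sigma_Sigma:
  assumes "finite A" "\<And>x. x \<in> A \<Longrightarrow> finite (B x)" "\<And>x y. x \<in> A \<Longrightarrow> y \<in> B x \<Longrightarrow> finite (C x y) \<and> card (C x y) = c x"
  shows "card (SIGMA x:A. SIGMA y:B x. C x y) = (\<Sum>x\<in>A. card (B x) * c x)"
    "finite (SIGMA x:A. SIGMA y:B x. C x y)"
  using assms by (auto intro!: sum.cong finite_SigmaI)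

lemma finite_cosets: "k > 0 \<Longrightarrow> \<Lambda> \<in> Lat k \<Longrightarrow> finite (cosets \<Lambda>) \<and> card (cosets \<Lambda>) = k"
  by (auto simp: Lat_def intro: card_ge_0_finite)

lemma divisor_pos: "n > 0 \<Longrightarrow> l dvd n \<Longrightarrow> (l::nat) > 0 \<and> n div l > 0"
  by (auto intro: dvd_pos_nat simp: div_greater_zero_iff dvd_imp_le)

lemma params_TransSub:
  assumes n: "n > 0"
  shows "params ` TransSub n = (SIGMA l:{l. l dvd n \<and> 3 dvd l}. SIGMA \<Lambda>:Lat (n div l). cosets \<Lambda>)"
proof (intro equalityI subsetI)
  fix x assume "x \<in> params ` TransSub n"
  then obtain K where "K \<in> IndexSub n" "3 dvd height K" "x = params K" by (auto simp: TransSub_def)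
  then show "x \<in> (SIGMA l:{l. l dvd n \<and> 3 dvd l}. SIGMA \<Lambda>:Lat (n div l). cosets \<Lambda>)"
    using IndexSubD[OF n] by (auto simp: params_def)
next
  fix x assume "x \<in> (SIGMA l:{l. l dvd n \<and> 3 dvd l}. SIGMA \<Lambda>:Lat (n div l). cosets \<Lambda>)"
  then obtain l \<Lambda> C where x: "x = (l, \<Lambda>, C)" "l dvd n" "3 dvd l" "\<Lambda> \<in> Lat (n div l)" "C \<in> cosets \<Lambda>" by auto
  then obtain K where "K \<in> IndexSub n" "params K = (l, \<Lambda>, C)" using params_surj[OF n x(2,4) _ x(5)] by blast
  then show "x \<in> params ` TransSub n" using x by (auto simp: TransSub_def params_def intro!: image_eqI[of _ _ K])
qed

lemma card_TransSub:
  assumes n: "n > 0"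
  shows "card (TransSub n) = (\<Sum>l | l dvd n \<and> 3 dvd l. card (Lat (n div l)) * (n div l))" "finite (TransSub n)"
proof -
  have inj: "inj_on params (TransSub n)" using inj_params[OF n] by (rule inj_on_subset) (auto simp: TransSub_def)
  have fin: "finite {l. l dvd n \<and> 3 dvd l}" using n by simp
  note c = card_Sigma_Sigma[OF fin, of "\<lambda>l. Lat (n div l)" "\<lambda>l \<Lambda>. cosets \<Lambda>" "\<lambda>l. n div l"]
  have *: "finite (Lat (n div l))" "\<Lambda> \<in> Lat (n div l) \<Longrightarrow> finite (cosets \<Lambda>) \<and> card (cosets \<Lambda>) = n div l"
    if "l \<in> {l. l dvd n \<and> 3 dvd l}" for l \<Lambda>
    using that divisor_pos[OF n, of l] card_Lat(2) finite_cosets by auto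
  show "card (TransSub n) = (\<Sum>l | l dvd n \<and> 3 dvd l. card (Lat (n div l)) * (n div l))"
    using c(1) * card_image[OF inj] unfolding params_TransSub[OF n] by simp
  have "finite (params ` TransSub n)" using c(2) * unfolding params_TransSub[OF n] by simp
  then show "finite (TransSub n)" using inj finite_imageD by blast
qed

text \<open>Here \<open>om powi (int (height K))\<close> is 1, so conjugation by a horizontal
  translation fixes the top coset and only the rotation, an element of order 3, is left.\<close>

lemma TransSub_conj:
  assumes n: "n > 0" and K: "K \<in> TransSub n" and u: "u \<in> Eis"
  shows "conjEG (u, c) K = conjEG (0, c mod 3) K" "conjEG (u, c) K \<in> TransSub n"
proof -
  have K': "K \<in> IndexSub n" "3 dvd height K" using K by (auto simp: TransSub_def)
  note S = IndexSubD[OF n K'(1)]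
  have u0: "(u, c) \<in> carrier EG" "(0, c mod 3) \<in> carrier EG" using u by auto
  note p = conjEG_params[OF S(1,2) u, of c] and q = conjEG_params[OF S(1,2), of 0 "c mod 3"]
  have "int 3 dvd int (height K)" using K'(2) by (simp only: of_nat_dvd_iff)
  then have "om powi (int (height K)) = 1" by (simp only: rot_eq_1_iff of_nat_numeral)
  then show "conjEG (u, c) K = conjEG (0, c mod 3) K"
    using p q subgroup_conjEG[OF S(1) u0(1)] subgroup_conjEG[OF S(1) u0(2)] rot_mod3[of c]
    by (intro subgroup_params_inj) simp_all
  show "conjEG (u, c) K \<in> TransSub n"
    using conjEG_IndexSub[OF n K'(1) u0(1)] p(2) K'(2) by (simp add: TransSub_def)
qed

definition conj_rel :: "((complex \<times> int) set \<times> (complex \<times> int) set) set" where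
  "conj_rel = {(K, L). \<exists>g \<in> carrier EG. L = conjEG g K}"

lemma conj_rel_TransSub:
  assumes n: "n > 0" and K: "K \<in> TransSub n"
  shows "conj_rel `` {K} = {K, conjEG (0, 1) K, conjEG (0, 1) (conjEG (0, 1) K)}"
    "conjEG (0, 1) (conjEG (0, 1) (conjEG (0, 1) K)) = K"
proof -
  have S: "subgroup K EG" using IndexSubD(1)[OF n] K by (auto simp: TransSub_def)
  have z: "(0, 1) \<in> carrier EG" "(0, 2) \<in> carrier EG" by auto
  have z2: "conjEG (0, 1) (conjEG (0, 1) K) = conjEG (0, 2) K" using conjEG_comp[OF S z(1,1)] by simp
  have "conjEG (0, 1) (conjEG (0, 2) K) = conjEG (0, 3) K" using conjEG_comp[OF S z] by simp
  also have "\<dots> = K" using TransSub_conj(1)[OF n K, of 0 3] conjEG_one[OF S] by simp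
  finally show "conjEG (0, 1) (conjEG (0, 1) (conjEG (0, 1) K)) = K" using z2 by simp
  have "conj_rel `` {K} = (\<lambda>g. conjEG g K) ` carrier EG" by (auto simp: conj_rel_def)
  also have "\<dots> = (\<lambda>c. conjEG (0, c) K) ` {0, 1, 2}"
  proof (intro equalityI subsetI)
    fix L assume "L \<in> (\<lambda>g. conjEG g K) ` carrier EG"
    then obtain u c where "u \<in> Eis" "L = conjEG (u, c) K" by auto
    then have "L = conjEG (0, c mod 3) K" using TransSub_conj(1)[OF n K, of u c] by (simp only:)
    moreover have "c mod 3 = 0 \<or> c mod 3 = 1 \<or> c mod 3 = 2" by presburger
    then have "c mod 3 \<in> {0, 1, 2}" by simp
    ultimately show "L \<in> (\<lambda>c. conjEG (0, c) K) ` {0, 1, 2}" by (intro image_eqI)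
  qed auto
  finally show "conj_rel `` {K} = {K, conjEG (0, 1) K, conjEG (0, 1) (conjEG (0, 1) K)}"
    using z2 conjEG_one[OF S] by simp
qed

text \<open>A subgroup is fixed if and only if \<open>om\<close> preserves its lattice, which is
  then an ideal, and its top coset; the weight counts the latter.\<close>

lemma card_TransSub_fixed:
  assumes n: "n > 0"
  shows "card {K \<in> TransSub n. conjEG (0, 1) K = K} =
    (\<Sum>l | l dvd n \<and> 3 dvd l. card (InvLat (n div l)) * (if 3 dvd n div l then 3 else 1))"
proof -
  let ?F = "{K \<in> TransSub n. conjEG (0, 1) K = K}"
  have inj: "inj_on params ?F" using inj_params[OF n] by (rule inj_on_subset) (auto simp: TransSub_def)
  have fix_iff: "conjEG (0, 1) K = K \<longleftrightarrow> (*) om ` lat K = lat K \<and> (*) om ` top_coset K = top_coset K"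
    if K: "K \<in> TransSub n" for K
  proof -
    have S: "subgroup K EG" "has_height K" using IndexSubD(1,2)[OF n] K by (auto simp: TransSub_def)
    have p: "has_height (conjEG (0, 1) K)" "height (conjEG (0, 1) K) = height K"
      "lat (conjEG (0, 1) K) = (*) om ` lat K" "top_coset (conjEG (0, 1) K) = (*) om ` top_coset K"
      using conjEG_params[OF S, of 0 1] by simp_all
    have "subgroup (conjEG (0, 1) K) EG" using subgroup_conjEG[OF S(1)] by simp
    then show ?thesis using subgroup_params_inj[OF _ p(1) S] p by metis
  qed
  have "params ` ?F = (SIGMA l:{l. l dvd n \<and> 3 dvd l}. SIGMA \<Lambda>:InvLat (n div l). {C \<in> cosets \<Lambda>. (*) om ` C = C})"
  proof (intro equalityI subsetI)
    fix x assume "x \<in> params ` ?F"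
    then obtain K where K: "K \<in> TransSub n" "conjEG (0, 1) K = K" "x = params K" by blast
    have "K \<in> IndexSub n" "3 dvd height K" using K(1) by (auto simp: TransSub_def)
    note S = IndexSubD[OF n this(1)]
    have e: "(*) om ` lat K = lat K" "(*) om ` top_coset K = top_coset K" using fix_iff[OF K(1)] K(2) by auto
    then have "lat K \<in> InvLat (n div height K)" using S(7) by (auto simp: InvLat_def)
    then show "x \<in> (SIGMA l:{l. l dvd n \<and> 3 dvd l}. SIGMA \<Lambda>:InvLat (n div l). {C \<in> cosets \<Lambda>. (*) om ` C = C})"
      using K(3) S \<open>3 dvd height K\<close> e by (simp add: params_def)
  next
    fix x assume "x \<in> (SIGMA l:{l. l dvd n \<and> 3 dvd l}. SIGMA \<Lambda>:InvLat (n div l). {C \<in> cosets \<Lambda>. (*) om ` C = C})"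
    then obtain l \<Lambda> C where x: "x = (l, \<Lambda>, C)" "l dvd n" "3 dvd l" "\<Lambda> \<in> InvLat (n div l)" "C \<in> cosets \<Lambda>" "(*) om ` C = C"
      by auto
    have "\<Lambda> \<in> Lat (n div l)" using x(4) by (simp add: InvLat_def)
    then have "x \<in> params ` TransSub n" unfolding params_TransSub[OF n] using x by simp
    then obtain K where K: "K \<in> TransSub n" "x = params K" by blast
    have "(*) om ` \<Lambda> = \<Lambda>" using InvLat_rot_image[OF x(4), of 1] by simp
    then have "conjEG (0, 1) K = K" using fix_iff[OF K(1)] K(2) x(1,6) by (simp add: params_def)
    then show "x \<in> params ` ?F" using K by blast
  qed
  moreover have "card (SIGMA l:{l. l dvd n \<and> 3 dvd l}. SIGMA \<Lambda>:InvLat (n div l). {C \<in> cosets \<Lambda>. (*) om ` C = C})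
    = (\<Sum>l | l dvd n \<and> 3 dvd l. card (InvLat (n div l)) * (if 3 dvd n div l then 3 else 1))"
  proof (rule card_Sigma_Sigma)
    show "finite {l. l dvd n \<and> 3 dvd l}" using n by simp
    fix l assume "l \<in> {l. l dvd n \<and> 3 dvd l}"
    then have k: "n div l > 0" using divisor_pos[OF n] by blast
    show "finite (InvLat (n div l))" using card_InvLat(2)[OF k] .
    fix \<Lambda> assume L: "\<Lambda> \<in> InvLat (n div l)"
    then have "\<Lambda> \<in> Lat (n div l)" by (simp add: InvLat_def)
    then have "finite {C \<in> cosets \<Lambda>. (*) om ` C = C}" using finite_cosets[OF k] by simp
    then show "finite {C \<in> cosets \<Lambda>. (*) om ` C = C} \<and>
       card {C \<in> cosets \<Lambda>. (*) om ` C = C} = (if 3 dvd n div l then 3 else 1)"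
      using card_fixed_cosets[OF k L] by blast
  qed
  ultimately show ?thesis using card_image[OF inj] by simp
qed

lemma card_TransSub_classes:
  assumes n: "n > 0"
  shows "3 * card (TransSub n // conj_rel) =
    (\<Sum>l | l dvd n \<and> 3 dvd l. card (Lat (n div l)) * (n div l)) +
    2 * (\<Sum>l | l dvd n \<and> 3 dvd l. card (InvLat (n div l)) * (if 3 dvd n div l then 3 else 1))"
    "finite (TransSub n // conj_rel)"
proof -
  let ?f = "conjEG (0, 1)"
  have "TransSub n // conj_rel = (\<lambda>K. conj_rel `` {K}) ` TransSub n" by (auto simp: quotient_def)
  also have "\<dots> = (\<lambda>K. {K, ?f K, ?f (?f K)}) ` TransSub n"
    by (rule image_cong[OF HOL.refl]) (use conj_rel_TransSub[OF n] in simp)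
  finally have q: "TransSub n // conj_rel = (\<lambda>K. {K, ?f K, ?f (?f K)}) ` TransSub n" .
  show "finite (TransSub n // conj_rel)" unfolding q using card_TransSub(2)[OF n] by simp
  have "3 * card (TransSub n // conj_rel) = card (TransSub n) + 2 * card {K \<in> TransSub n. ?f K = K}"
    unfolding q
    by (rule card_orbits_order_3) (use card_TransSub(2)[OF n] TransSub_conj(2)[OF n] conj_rel_TransSub(2)[OF n] in auto)
  then show "3 * card (TransSub n // conj_rel) =
    (\<Sum>l | l dvd n \<and> 3 dvd l. card (Lat (n div l)) * (n div l)) +
    2 * (\<Sum>l | l dvd n \<and> 3 dvd l. card (InvLat (n div l)) * (if 3 dvd n div l then 3 else 1))"
    unfolding card_TransSub(1)[OF n] card_TransSub_fixed[OF n] .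
qed

lemma conj_rel_eq: "{(K, L). \<exists>g \<in> carrier EG. L = g <#\<^bsub>EG\<^esub> K #>\<^bsub>EG\<^esub> inv\<^bsub>EG\<^esub> g} = conj_rel"
  unfolding conj_rel_def conj_set_coset ..

lemma conj_rel_class_eq_iff:
  assumes "subgroup K EG" "subgroup L EG"
  shows "conj_rel `` {K} = conj_rel `` {L} \<longleftrightarrow> (\<exists>g\<in>carrier EG. L = conjEG g K)"
  using EG.conj_class_eq_iff[OF subgroup.subset[OF assms(1)] subgroup.subset[OF assms(2)]]
  unfolding conj_rel_eq .

text \<open>Conjugation multiplies the top coset by powers of \<open>om\<close> and shifts it by
  multiples of \<open>1 - om powi ?l\<close>, both invisible to \<open>tau\<close>, and the lattice
  is an ideal. Conversely, elements of the two top cosets with equal \<open>tau\<close> differ by a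
  multiple of \<open>1 - om\<close>, hence of \<open>1 - om powi ?l\<close>, and a horizontal
  translation conjugates one subgroup to the other.\<close>

lemma ScrewSub_conj_iff:
  assumes n: "n > 0" and K: "K \<in> ScrewSub n" and L: "L \<in> ScrewSub n"
  shows "(\<exists>g\<in>carrier EG. L = conjEG g K) \<longleftrightarrow>
    (height K, lat K, tau ` top_coset K) = (height L, lat L, tau ` top_coset L)"
proof
  have K': "K \<in> IndexSub n" "\<not> 3 dvd height K" and L': "L \<in> IndexSub n" "\<not> 3 dvd height L"
    using K L by (auto simp: ScrewSub_def)
  note S = IndexSubD[OF n K'(1)] and T = IndexSubD[OF n L'(1)]
  have tE: "v \<in> Eis" if "v \<in> top_coset M" "subgroup M EG" for v M
    using subgroupEG(1)[OF that(2)] that(1) by (fastforce simp: top_coset_def)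
  let ?l = "int (height K)"
  have l3: "\<not> 3 dvd ?l" using K'(2) by (metis of_nat_dvd_iff of_nat_numeral)
  {
    assume "\<exists>g\<in>carrier EG. L = conjEG g K"
    then obtain u c where g: "u \<in> Eis" "L = conjEG (u, c) K" by auto
    note p = conjEG_params[OF S(1,2) g(1), of c]
    have "tau (om powi c * v + (1 - om powi ?l) * u) = tau v" if "v \<in> top_coset K" for v
    proof -
      have "tau (1 - om powi ?l) = 0" using tau_diff[of 1 "om powi ?l"] tau_rot[of 0] tau_rot[of ?l] by (simp del: power_int_of_nat)
      then have "tau ((1 - om powi ?l) * u) = 0" using g(1) tau_mult[of "1 - om powi ?l" u] by (simp del: power_int_of_nat)
      then show ?thesis
        using g(1) tE[OF that S(1)] tau_add[of "om powi c * v" "(1 - om powi ?l) * u"]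
          tau_rot_mult[of v c] by (simp del: power_int_of_nat)
    qed
    then have "tau ` top_coset L = tau ` top_coset K"
      unfolding g(2) p(4) image_image by (intro image_cong) auto
    moreover have "lat L = lat K" unfolding g(2) p(3) using InvLat_rot_image[OF S(8)[OF K'(2)]] .
    ultimately show "(height K, lat K, tau ` top_coset K) = (height L, lat L, tau ` top_coset L)"
      using p(2) g(2) by simp
  }
  assume eq: "(height K, lat K, tau ` top_coset K) = (height L, lat L, tau ` top_coset L)"
  obtain v where v: "v \<in> top_coset K" using top_coset_ne[OF S(2)] by blast
  then obtain v' where v': "v' \<in> top_coset L" "tau v' = tau v" using eq by (metis imageE imageI prod.inject)
  have vE: "v \<in> Eis" "v' \<in> Eis" using tE v v' S(1) T(1) by auto
  then have "tau (v' - v) = 0" using v'(2) by (simp add: tau_diff)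
  then obtain w where w: "w \<in> Eis" "v' - v = (1 - om) * w" using tau_eq_0_iff[of "v' - v"] vE by auto
  obtain u where u: "u \<in> Eis" "v' - v = (1 - om powi ?l) * u" using rot_diff_multiple[OF l3 w(1)] w(2) by auto
  note p = conjEG_params[OF S(1,2) u(1), of 0]
  have u0: "(u, 0) \<in> carrier EG" using u(1) by simp
  have "v' \<in> top_coset (conjEG (u, 0) K)"
    unfolding p(4) using v u(2) by (intro image_eqI[of _ _ v]) (auto simp: algebra_simps)
  then have "top_coset (conjEG (u, 0) K) = (+) v' ` lat K"
    using top_coset_eq[OF subgroup_conjEG[OF S(1) u0]] p(3) by simp
  moreover have "top_coset L = (+) v' ` lat L" using top_coset_eq[OF T(1) v'(1)] .
  ultimately have "L = conjEG (u, 0) K"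
    using eq p subgroup_conjEG[OF S(1) u0] T(1,2) by (intro subgroup_params_inj) auto
  then show "\<exists>g\<in>carrier EG. L = conjEG g K" using u0 by blast
qed

lemma card_ScrewSub_classes:
  assumes n: "n > 0"
  shows "card (ScrewSub n // conj_rel) =
    (\<Sum>l | l dvd n \<and> \<not> 3 dvd l. card (InvLat (n div l)) * (if 3 dvd n div l then 3 else 1))"
    "finite (ScrewSub n // conj_rel)"
proof -
  let ?p = "\<lambda>K. (height K, lat K, tau ` top_coset K)"
  let ?D = "SIGMA l:{l. l dvd n \<and> \<not> 3 dvd l}. SIGMA \<Lambda>:InvLat (n div l). (`) tau ` cosets \<Lambda>"
  have q: "ScrewSub n // conj_rel = (\<lambda>K. conj_rel `` {K}) ` ScrewSub n" by (auto simp: quotient_def)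
  have "card ((\<lambda>K. conj_rel `` {K}) ` ScrewSub n) = card (?p ` ScrewSub n)"
  proof (rule card_image_same_kernel)
    fix K L assume KL: "K \<in> ScrewSub n" "L \<in> ScrewSub n"
    then have "subgroup K EG" "subgroup L EG" using IndexSubD(1)[OF n] by (auto simp: ScrewSub_def)
    then show "(conj_rel `` {K} = conj_rel `` {L}) = (?p K = ?p L)"
      using conj_rel_class_eq_iff ScrewSub_conj_iff[OF n KL] by simp
  qed
  moreover have im: "?p ` ScrewSub n = ?D"
  proof (intro equalityI subsetI)
    fix x assume "x \<in> ?p ` ScrewSub n"
    then obtain K where K: "K \<in> IndexSub n" "\<not> 3 dvd height K" "x = ?p K" by (auto simp: ScrewSub_def)
    show "x \<in> ?D" using IndexSubD[OF n K(1)] K by simp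
  next
    fix x assume "x \<in> ?D"
    then obtain l \<Lambda> C where x: "x = (l, \<Lambda>, tau ` C)" "l dvd n" "\<not> 3 dvd l" "\<Lambda> \<in> InvLat (n div l)" "C \<in> cosets \<Lambda>" by auto
    then have "\<Lambda> \<in> Lat (n div l)" by (simp add: InvLat_def)
    then obtain K where "K \<in> IndexSub n" "params K = (l, \<Lambda>, C)"
      using params_surj[OF n x(2) _ _ x(5)] x(4) by blast
    then show "x \<in> ?p ` ScrewSub n" using x by (auto simp: ScrewSub_def params_def intro!: image_eqI[of _ _ K])
  qed
  moreover have D: "card ?D = (\<Sum>l | l dvd n \<and> \<not> 3 dvd l. card (InvLat (n div l)) * (if 3 dvd n div l then 3 else 1))"
    "finite ?D"
  proof -
    have *: "finite {l. l dvd n \<and> \<not> 3 dvd l}" "\<And>l. l \<in> {l. l dvd n \<and> \<not> 3 dvd l} \<Longrightarrow> finite (InvLat (n div l))"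
      using n divisor_pos[OF n] card_InvLat(2) by auto
    have **: "finite ((`) tau ` cosets \<Lambda>) \<and> card ((`) tau ` cosets \<Lambda>) = (if 3 dvd n div l then 3 else 1)"
      if "l \<in> {l. l dvd n \<and> \<not> 3 dvd l}" "\<Lambda> \<in> InvLat (n div l)" for l \<Lambda>
    proof -
      have k: "n div l > 0" using divisor_pos[OF n] that by blast
      have "\<Lambda> \<in> Lat (n div l)" using that(2) by (simp add: InvLat_def)
      then have "finite ((`) tau ` cosets \<Lambda>)" using finite_cosets[OF k] by simp
      then show ?thesis using card_tau_cosets[OF k that(2)] by blast
    qed
    show "card ?D = (\<Sum>l | l dvd n \<and> \<not> 3 dvd l. card (InvLat (n div l)) * (if 3 dvd n div l then 3 else 1))"
      by (rule card_Sigma_Sigma(1)[OF *]) (use ** in auto)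
    show "finite ?D" by (rule card_Sigma_Sigma(2)[OF *]) (use ** in auto)
  qed
  ultimately show "card (ScrewSub n // conj_rel) =
    (\<Sum>l | l dvd n \<and> \<not> 3 dvd l. card (InvLat (n div l)) * (if 3 dvd n div l then 3 else 1))"
    unfolding q by simp
  \<comment> \<open>Equal cardinalities do not give finiteness, because \<open>card\<close> is 0 on
    infinite sets; the classes are recovered from their finitely many labels by choosing
    representatives.\<close>
  have "finite (?p ` ScrewSub n)" using im D(2) by simp
  moreover have "(\<lambda>K. conj_rel `` {K}) ` ScrewSub n = (\<lambda>x. conj_rel `` {inv_into (ScrewSub n) ?p x}) ` ?p ` ScrewSub n"
    unfolding image_image
  proof (rule image_cong[OF HOL.refl])
    fix K assume K: "K \<in> ScrewSub n"
    define L where "L = inv_into (ScrewSub n) ?p (?p K)"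
    have L: "L \<in> ScrewSub n" "?p L = ?p K" unfolding L_def using K by (meson imageI inv_into_into, metis (no_types, lifting) K f_inv_into_f imageI)
    have "subgroup K EG" "subgroup L EG" using IndexSubD(1)[OF n] K L by (auto simp: ScrewSub_def)
    then show "conj_rel `` {K} = conj_rel `` {inv_into (ScrewSub n) ?p (?p K)}"
      unfolding L_def[symmetric] using conj_rel_class_eq_iff ScrewSub_conj_iff[OF n K L(1)] L(2) by simp
  qed
  ultimately show "finite (ScrewSub n // conj_rel)" unfolding q using finite_imageI by (simp only:)
qed

section \<open>Evaluation of the divisor sums\<close>

definition Theta :: "nat \<Rightarrow> int" where "Theta k = (\<Sum>d | d dvd k. chi3 d)"

lemma pos_divisors_of_nat: "n > 0 \<Longrightarrow> pos_divisors (of_nat n) = {k. k dvd n}"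
  by (auto simp: pos_divisors_def)

lemma pos_divisors_div:
  assumes "m > 0"
  shows "pos_divisors (of_nat n / of_nat m) = (if n > 0 \<and> m dvd n then {k. k dvd n div m} else {})"
proof -
  have "(of_nat n / of_nat m :: rat) = of_nat j \<longleftrightarrow> n = j * m" for j
  proof -
    have "(of_nat n / of_nat m :: rat) = of_nat j \<longleftrightarrow> (of_nat n :: rat) = of_nat (j * m)"
      using assms by (simp add: field_simps)
    then show ?thesis by (simp only: of_nat_eq_iff)
  qed
  then show ?thesis using assms by (auto simp: pos_divisors_def)
qed

lemma theta_of_nat: "k > 0 \<Longrightarrow> theta (of_nat k) = of_int (Theta k)"
  by (simp add: theta_def pos_divisors_of_nat Theta_def chi3_def)

text \<open>The new divisors are multiples of 3, where the character vanishes.\<close>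

lemma Theta_mult3:
  assumes "k > 0" shows "Theta (3 * k) = Theta k"
  unfolding Theta_def
proof (rule sum.mono_neutral_right)
  show "finite {d. d dvd 3 * k}" using assms by simp
  show "\<forall>d\<in>{d. d dvd 3 * k} - {d. d dvd k}. chi3 d = 0"
  proof
    fix d assume d: "d \<in> {d. d dvd 3 * k} - {d. d dvd k}"
    have "3 dvd d"
    proof (rule ccontr)
      assume "\<not> 3 dvd d"
      then have "coprime d 3" using prime_imp_coprime[of "3::nat" d] by (simp add: coprime_commute)
      then show False using d by (auto simp: coprime_dvd_mult_right_iff)
    qed
    then show "chi3 d = 0" by (simp add: chi3_eq)
  qed
qed auto

lemma sum_theta:
  assumes "m > 0" "n > 0"
  shows "(\<Sum>k\<in>pos_divisors (of_nat n / of_nat m). theta (of_nat k)) =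
    (if m dvd n then of_int (\<Sum>k | k dvd n div m. Theta k) else 0)"
proof (cases "m dvd n")
  case True
  then have "n div m > 0" using divisor_pos[OF assms(2)] by blast
  then have "(\<Sum>k | k dvd n div m. theta (of_nat k)) = (\<Sum>k | k dvd n div m. of_int (Theta k))"
    by (intro sum.cong theta_of_nat) (auto intro: dvd_pos_nat)
  then show ?thesis using True assms by (simp add: pos_divisors_div)
qed (use assms in \<open>simp add: pos_divisors_div\<close>)

lemma sum_divisors_mult3:
  fixes n :: nat
  assumes "n > 0"
  shows "(\<Sum>k | k dvd n \<and> 3 dvd k. f k) = (if 3 dvd n then (\<Sum>k | k dvd n div 3. f (3 * k)) else (0::int))"
proof (cases "3 dvd n")
  case True
  then obtain m where m: "n = 3 * m" by blast
  have "{k. k dvd n \<and> 3 dvd k} = (*) 3 ` {k. k dvd m}" by (auto simp: m)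
  then show ?thesis by (simp add: m sum.reindex inj_on_def)
next
  case False
  then have "{k. k dvd n \<and> 3 dvd k} = {}" using dvd_trans by blast
  then show ?thesis using False by (simp only: sum.empty if_False)
qed

lemma sum_complementary_divisors:
  fixes n :: nat
  assumes "n > 0"
  shows "(\<Sum>l | l dvd n \<and> P l. f (n div l)) = (\<Sum>k | k dvd n \<and> P (n div k). f k)"
  by (rule sum.reindex_bij_witness[of _ "\<lambda>k. n div k" "\<lambda>k. n div k"])
    (use assms in \<open>auto elim!: dvdE\<close>)

definition weighted :: "nat \<Rightarrow> int" where
  "weighted n = (\<Sum>k | k dvd n. Theta k * (if 3 dvd k then 3 else 1))"

text \<open>The excess weight 2 sits on the divisors \<open>3 * k\<close>, and \<open>Theta\<close>
  does not see the factor 3.\<close>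

lemma weighted_eq:
  assumes "n > 0"
  shows "weighted n = (\<Sum>k | k dvd n. Theta k) + 2 * (if 3 dvd n then (\<Sum>k | k dvd n div 3. Theta k) else 0)"
proof -
  have "weighted n = (\<Sum>k | k dvd n. Theta k + (if 3 dvd k then 2 * Theta k else 0))"
    unfolding weighted_def by (rule sum.cong) auto
  also have "\<dots> = (\<Sum>k | k dvd n. Theta k) + 2 * (\<Sum>k | k dvd n \<and> 3 dvd k. Theta k)"
    using assms by (simp add: sum.distrib sum.inter_filter[symmetric] sum_distrib_left)
  also have "(\<Sum>k | k dvd n \<and> 3 dvd k. Theta k) = (if 3 dvd n then (\<Sum>k | k dvd n div 3. Theta (3 * k)) else 0)"
    using sum_divisors_mult3[OF assms] .
  also have "\<dots> = (if 3 dvd n then (\<Sum>k | k dvd n div 3. Theta k) else 0)"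
    using assms divisor_pos[OF assms, of 3] by (auto intro!: sum.cong Theta_mult3 intro: dvd_pos_nat)
  finally show ?thesis .
qed

lemma divisors_third:
  assumes "n > 0"
  shows "{k. k dvd n \<and> 3 dvd n div k} = (if 3 dvd n then {k. k dvd n div (3::nat)} else {})"
proof (cases "3 dvd n")
  case True
  then obtain m where m: "n = 3 * m" by blast
  have "k dvd 3 * m \<and> 3 dvd 3 * m div k \<longleftrightarrow> k dvd m" for k
  proof
    assume *: "k dvd 3 * m \<and> 3 dvd 3 * m div k"
    then obtain j where "3 * m div k = 3 * j" by blast
    then have "3 * m = 3 * j * k" using * by (metis dvd_div_mult_self)
    then show "k dvd m" by simp
  next
    assume "k dvd m"
    then obtain j where "m = k * j" by blast
    then show "k dvd 3 * m \<and> 3 dvd 3 * m div k" using assms m by (auto simp: mult.left_commute)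
  qed
  then show ?thesis by (simp add: m)
next
  case False
  then show ?thesis by (metis (mono_tags, lifting) Collect_empty_eq dvd_div_mult_self dvd_mult2)
qed

lemma sum_InvLat_TransSub:
  assumes n: "n > 0"
  shows "int (\<Sum>l | l dvd n \<and> 3 dvd l. card (InvLat (n div l)) * (if 3 dvd n div l then 3 else 1))
    = (if 3 dvd n then weighted (n div 3) else 0)"
proof -
  have "int (\<Sum>l | l dvd n \<and> 3 dvd l. card (InvLat (n div l)) * (if 3 dvd n div l then 3 else 1))
    = (\<Sum>l | l dvd n \<and> 3 dvd l. Theta (n div l) * (if 3 dvd n div l then 3 else 1))"
    unfolding of_nat_sum
    by (rule sum.cong[OF HOL.refl]) (use divisor_pos[OF n] card_InvLat(1) in \<open>auto simp: Theta_def\<close>)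
  also have "\<dots> = (\<Sum>k | k dvd n \<and> 3 dvd n div k. Theta k * (if 3 dvd k then 3 else 1))"
    by (rule sum_complementary_divisors[OF n, where f = "\<lambda>k. Theta k * (if 3 dvd k then 3 else 1)"])
  finally show ?thesis unfolding divisors_third[OF n] by (simp add: weighted_def)
qed

text \<open>The sum over all heights minus the sum over the multiples of 3; the subtraction produces
  the negative term with n/9 in formula (i).\<close>

lemma sum_InvLat_ScrewSub:
  assumes n: "n > 0"
  shows "int (\<Sum>l | l dvd n \<and> \<not> 3 dvd l. card (InvLat (n div l)) * (if 3 dvd n div l then 3 else 1))
    = weighted n - (if 3 dvd n then weighted (n div 3) else 0)"
proof -
  let ?f = "\<lambda>l. card (InvLat (n div l)) * (if 3 dvd n div l then 3 else 1)"
  have "int (\<Sum>l | l dvd n. ?f l) = (\<Sum>l | l dvd n \<and> True. Theta (n div l) * (if 3 dvd n div l then 3 else 1))"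
    unfolding of_nat_sum
    by (rule sum.cong) (use divisor_pos[OF n] card_InvLat(1) in \<open>auto simp: Theta_def\<close>)
  also have "\<dots> = weighted n"
    by (subst sum_complementary_divisors[OF n, where f = "\<lambda>k. Theta k * (if 3 dvd k then 3 else 1)"])
      (simp add: weighted_def)
  finally have 1: "int (\<Sum>l | l dvd n. ?f l) = weighted n" .
  have "(\<Sum>l | l dvd n. ?f l) = (\<Sum>l | l dvd n \<and> 3 dvd l. ?f l) + (\<Sum>l | l dvd n \<and> \<not> 3 dvd l. ?f l)"
    by (subst sum.union_disjoint[symmetric]) (use n in \<open>auto intro: sum.cong\<close>)
  then have "int (\<Sum>l | l dvd n \<and> \<not> 3 dvd l. ?f l) = weighted n - int (\<Sum>l | l dvd n \<and> 3 dvd l. ?f l)"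
    using 1 by simp
  then show ?thesis unfolding sum_InvLat_TransSub[OF n] .
qed

text \<open>As the height runs over the multiples of 3 dividing \<open>n\<close>, the index
  \<open>k\<close> of the lattice runs over the divisors of n/3. Each of the lattices, as many as
  the divisor sum of \<open>k\<close>, has \<open>k\<close> cosets.\<close>

lemma sum_Lat_TransSub:
  assumes n: "n > 0"
  shows "of_nat (\<Sum>l | l dvd n \<and> 3 dvd l. card (Lat (n div l)) * (n div l)) = omega (of_nat n / 3)"
proof -
  have "(\<Sum>l | l dvd n \<and> 3 dvd l. card (Lat (n div l)) * (n div l)) =
     (\<Sum>l | l dvd n \<and> 3 dvd l. (\<lambda>k. (\<Sum>a | a dvd k. a) * k) (n div l))"
    by (rule sum.cong[OF HOL.refl]) (use divisor_pos[OF n] card_Lat(1) in auto)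
  also have "\<dots> = (\<Sum>k | k dvd n \<and> 3 dvd n div k. (\<Sum>a | a dvd k. a) * k)"
    by (rule sum_complementary_divisors[OF n])
  finally have 1: "(\<Sum>l | l dvd n \<and> 3 dvd l. card (Lat (n div l)) * (n div l)) =
    (\<Sum>k | k dvd n \<and> 3 dvd n div k. (\<Sum>a | a dvd k. a) * k)" .
  have p: "pos_divisors (of_nat n / 3) = {k. k dvd n \<and> 3 dvd n div k}"
    using pos_divisors_div[of 3 n] n unfolding divisors_third[OF n] by simp
  have "omega (of_nat n / 3) = (\<Sum>k | k dvd n \<and> 3 dvd n div k. of_nat ((\<Sum>a | a dvd k. a) * k))"
    unfolding omega_def p
  proof (rule sum.cong[OF HOL.refl])
    fix k assume "k \<in> {k. k dvd n \<and> 3 dvd n div k}"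
    then have "k > 0" using divisor_pos[OF n] by blast
    then show "of_nat k * sigma1 (of_nat k) = of_nat ((\<Sum>a | a dvd k. a) * k)"
      by (simp add: sigma1_def pos_divisors_of_nat)
  qed
  then show ?thesis unfolding 1 by simp
qed

theorem card_ScrewSub_classes_formula:
  assumes n: "n > 0"
  shows "of_nat (card (ScrewSub n // conj_rel))
       = (\<Sum>k \<in> pos_divisors (of_nat n). theta (of_nat k))
         + (\<Sum>k \<in> pos_divisors (of_nat n / 3). theta (of_nat k))
         - 2 * (\<Sum>k \<in> pos_divisors (of_nat n / 9). theta (of_nat k))"
proof -
  have "int (card (ScrewSub n // conj_rel)) = weighted n - (if 3 dvd n then weighted (n div 3) else 0)"
    unfolding card_ScrewSub_classes(1)[OF n] by (rule sum_InvLat_ScrewSub[OF n])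
  then have "(of_nat (card (ScrewSub n // conj_rel)) :: rat) = of_int (weighted n - (if 3 dvd n then weighted (n div 3) else 0))"
    by (metis of_int_of_nat_eq)
  moreover have "n div 3 div 3 = n div 9" "3 dvd n \<Longrightarrow> 3 dvd n div 3 \<longleftrightarrow> 9 dvd n" by (simp_all add: div_mult2_eq[symmetric]) (auto elim!: dvdE)
  moreover have "9 dvd n \<Longrightarrow> 3 dvd n" by (auto elim!: dvdE)
  moreover have "3 dvd n \<Longrightarrow> n div 3 > 0" using divisor_pos[OF n, of 3] by blast
  ultimately show ?thesis
    using sum_theta[of 1 n] sum_theta[of 3 n] sum_theta[of 9 n] n
    by (auto simp: weighted_eq)
qed

theorem card_TransSub_classes_formula:
  assumes n: "n > 0"
  shows "of_nat (card (TransSub n // conj_rel))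
       = 1 / 3 * (omega (of_nat n / 3)
         + 2 * (\<Sum>k \<in> pos_divisors (of_nat n / 3). theta (of_nat k))
         + 4 * (\<Sum>k \<in> pos_divisors (of_nat n / 9). theta (of_nat k)))"
proof -
  have "3 * (of_nat (card (TransSub n // conj_rel)) :: rat) = of_nat (3 * card (TransSub n // conj_rel))" by simp
  also have "\<dots> = omega (of_nat n / 3) + 2 * of_int (int
    (\<Sum>l | l dvd n \<and> 3 dvd l. card (InvLat (n div l)) * (if 3 dvd n div l then 3 else 1)))"
    unfolding card_TransSub_classes(1)[OF n] sum_Lat_TransSub[OF n, symmetric] by simp
  also have "\<dots> = omega (of_nat n / 3) + 2 * of_int (if 3 dvd n then weighted (n div 3) else 0)"
    unfolding sum_InvLat_TransSub[OF n] ..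
  finally have "3 * (of_nat (card (TransSub n // conj_rel)) :: rat) = \<dots>" .
  moreover have "n div 3 div 3 = n div 9" "3 dvd n \<Longrightarrow> 3 dvd n div 3 \<longleftrightarrow> 9 dvd n" by (simp_all add: div_mult2_eq[symmetric]) (auto elim!: dvdE)
  moreover have "9 dvd n \<Longrightarrow> 3 dvd n" by (auto elim!: dvdE)
  moreover have "3 dvd n \<Longrightarrow> n div 3 > 0" using divisor_pos[OF n, of 3] by blast
  ultimately show ?thesis
    using sum_theta[of 3 n] sum_theta[of 9 n] n
    by (auto simp: weighted_eq)
qed

section \<open>The presented group\<close>

definition word_class :: "('g word \<times> 'g word) set \<Rightarrow> 'g word \<Rightarrow> 'g word set" where
  "word_class R w = {v. word_equiv R w v}"

lemma word_class_eq_iff: "word_class R u = word_class R v \<longleftrightarrow> word_equiv R u v"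
  unfolding word_class_def
  by (auto intro: word_equiv.refl word_equiv.sym word_equiv.trans)

lemma word_equiv_context:
  "word_equiv R u v \<Longrightarrow> word_equiv R (a @ u @ b) (a @ v @ b)"
proof (induction rule: word_equiv.induct)
  case (cancel u g c v)
  then show ?case using word_equiv.cancel[of R "a @ u" g c "v @ b"] by simp
next
  case (relation l r u v)
  then show ?case using word_equiv.relation[OF relation, of "a @ u" "v @ b"] by simp
qed (auto intro: word_equiv.intros)

lemma word_equiv_append:
  assumes "word_equiv R u u'" "word_equiv R v v'"
  shows "word_equiv R (u @ v) (u' @ v')"
  using word_equiv_context[OF assms(1), of "[]" v] word_equiv_context[OF assms(2), of u' "[]"]
  by (auto intro: word_equiv.trans)

definition word_inv :: "'g word \<Rightarrow> 'g word" where
  "word_inv w = rev (map (\<lambda>(g, b). (g, \<not> b)) w)"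

lemma word_inv_right: "word_equiv R (w @ word_inv w) []"
proof (induction w)
  case Nil
  then show ?case by (simp add: word_inv_def word_equiv.refl)
next
  case (Cons x w)
  obtain g b where x: "x = (g, b)" by (cases x)
  have "word_equiv R ([(g, b)] @ (w @ word_inv w) @ [(g, \<not> b)]) ([(g, b)] @ [] @ [(g, \<not> b)])"
    by (rule word_equiv_context[OF Cons.IH])
  moreover have "word_equiv R ([(g, b)] @ [] @ [(g, \<not> b)]) []"
    using word_equiv.cancel[of R "[]" g b "[]"] by simp
  ultimately have "word_equiv R ([(g, b)] @ (w @ word_inv w) @ [(g, \<not> b)]) []"
    by (rule word_equiv.trans)
  then show ?case by (simp add: x word_inv_def)
qed

lemma word_inv_inv: "word_inv (word_inv w) = w"
  by (simp add: word_inv_def rev_map o_def case_prod_unfold)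

lemma word_inv_left: "word_equiv R (word_inv w @ w) []"
  using word_inv_right[of R "word_inv w"] by (simp add: word_inv_inv)

lemma carrier_presented_group: "carrier (presented_group R) = range (word_class R)"
  by (auto simp: presented_group_def quotient_def word_class_def)

lemma one_presented_group: "\<one>\<^bsub>presented_group R\<^esub> = word_class R []"
  by (simp add: presented_group_def word_class_def)

lemma mult_presented_group: "word_class R u \<otimes>\<^bsub>presented_group R\<^esub> word_class R v = word_class R (u @ v)"
proof -
  have "word_class R u \<otimes>\<^bsub>presented_group R\<^esub> word_class R v =
     {w. \<exists>a. word_equiv R u a \<and> (\<exists>b. word_equiv R v b \<and> word_equiv R (a @ b) w)}"
    by (auto simp: presented_group_def word_class_def)
  also have "\<dots> = word_class R (u @ v)"
    unfolding word_class_def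
    by (auto intro: word_equiv.refl word_equiv.trans[OF word_equiv_append])
  finally show ?thesis .
qed

lemma group_presented_group: "group (presented_group R)"
proof (rule groupI)
  fix x assume "x \<in> carrier (presented_group R)"
  then obtain w where w: "x = word_class R w" by (auto simp: carrier_presented_group)
  show "\<one>\<^bsub>presented_group R\<^esub> \<otimes>\<^bsub>presented_group R\<^esub> x = x"
    by (simp add: w one_presented_group mult_presented_group)
  show "\<exists>y\<in>carrier (presented_group R). y \<otimes>\<^bsub>presented_group R\<^esub> x = \<one>\<^bsub>presented_group R\<^esub>"
    by (rule bexI[of _ "word_class R (word_inv w)"])
      (use word_inv_left in \<open>auto simp add: w one_presented_group mult_presented_group carrier_presented_group word_class_eq_iff\<close>)
qed (auto simp: carrier_presented_group mult_presented_group one_presented_group)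

section \<open>Evaluation of words in the semidirect product\<close>

fun letter :: "gen \<times> bool \<Rightarrow> complex \<times> int" where
  "letter (X, b) = ((if b then 1 else - 1), 0)"
| "letter (Y, b) = ((if b then om else - om), 0)"
| "letter (Z, b) = (0, (if b then 1 else - 1))"

lemma letter_in: "letter a \<in> carrier EG"
  by (cases a rule: letter.cases) auto

lemma letter_cancel: "letter (g, b) \<otimes>\<^bsub>EG\<^esub> letter (g, \<not> b) = \<one>\<^bsub>EG\<^esub>"
  by (cases g) auto

fun eval_word :: "gen word \<Rightarrow> complex \<times> int" where
  "eval_word [] = (0, 0)"
| "eval_word (a # w) = letter a \<otimes>\<^bsub>EG\<^esub> eval_word w"

lemma eval_word_in: "eval_word w \<in> carrier EG"
proof (induction w)
  case (Cons a w)
  then show ?case using EG.m_closed[OF letter_in] by (simp del: carrier_EG mult_EG)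
qed auto

lemma eval_word_append: "eval_word (u @ v) = eval_word u \<otimes>\<^bsub>EG\<^esub> eval_word v"
proof (induction u)
  case Nil
  have "(0, 0) \<otimes>\<^bsub>EG\<^esub> eval_word v = eval_word v" using EG.l_one[OF eval_word_in] by simp
  then show ?case by (simp del: mult_EG)
qed (simp add: EG.m_assoc letter_in eval_word_in del: carrier_EG mult_EG)

abbreviation G3_relations :: "(gen word \<times> gen word) set" where
  "G3_relations \<equiv> {([(X, True), (Y, True), (X, False), (Y, False)], []),
      ([(Z, True), (X, True), (Z, False)], [(Y, True)]),
      ([(Z, True), (Y, True), (Z, False)], [(Y, False), (X, False)])}"

lemma eval_word_sound: "word_equiv G3_relations u v \<Longrightarrow> eval_word u = eval_word v"
proof (induction rule: word_equiv.induct)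
  case (cancel u g b v)
  have "eval_word [(g, b), (g, \<not> b)] = (0, 0)" using letter_cancel[of g b] EG.r_one[OF letter_in] by simp
  then show ?case using EG.l_one[OF eval_word_in] by (simp only: eval_word_append one_EG)
next
  case (relation l r u v)
  \<comment> \<open>The third relation amounts to \<open>om * om = - 1 - om\<close>; the other two
    are immediate.\<close>
  then have "eval_word l = eval_word r" using om_sq by auto
  then show ?case by (simp only: eval_word_append)
qed auto

abbreviation "wc \<equiv> word_class G3_relations"

text \<open>A normal form for the presented group, used to show that words with equal value in
  \<open>EG\<close> are already equivalent.\<close>

definition nform :: "int \<Rightarrow> int \<Rightarrow> int \<Rightarrow> gen word set" where
  "nform a b c = wc [(X, True)] [^]\<^bsub>pi1_G3\<^esub> a \<otimes>\<^bsub>pi1_G3\<^esub> wc [(Y, True)] [^]\<^bsub>pi1_G3\<^esub> b \<otimes>\<^bsub>pi1_G3\<^esub> wc [(Z, True)] [^]\<^bsub>pi1_G3\<^esub> c"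

lemma group_pi1_G3: "group pi1_G3" unfolding pi1_G3_def by (rule group_presented_group)

interpretation P: group pi1_G3 by (rule group_pi1_G3)

lemma (in group) conj_int_pow:
  assumes g: "g \<in> carrier G" and x: "x \<in> carrier G"
  shows "g \<otimes> (x [^] (a::int)) \<otimes> inv g = (g \<otimes> x \<otimes> inv g) [^] a"
proof -
  have "(\<lambda>u. g \<otimes> u \<otimes> inv g) \<in> hom G G"
  proof (rule homI)
    fix u v assume uv: "u \<in> carrier G" "v \<in> carrier G"
    have "inv g \<otimes> (g \<otimes> z) = z" if "z \<in> carrier G" for z
      using that g by (simp add: m_assoc[symmetric])
    then show "g \<otimes> (u \<otimes> v) \<otimes> inv g = (g \<otimes> u \<otimes> inv g) \<otimes> (g \<otimes> v \<otimes> inv g)"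
      using uv g by (simp add: m_assoc)
  qed (use g in auto)
  from hom_int_pow[OF this x is_group is_group] show ?thesis .
qed

text \<open>The exponents change as the pair \<open>(eis a b, c)\<close> does when multiplied by the
  corresponding letter. For the third generator the pair \<open>- b\<close>, \<open>a - b\<close>
  gives the coordinates of \<open>om * eis a b\<close>.\<close>

lemma nform_step:
  shows "wc [(X, True)] \<otimes>\<^bsub>pi1_G3\<^esub> nform a b c = nform (a + 1) b c"
    "wc [(Y, True)] \<otimes>\<^bsub>pi1_G3\<^esub> nform a b c = nform a (b + 1) c"
    "wc [(Z, True)] \<otimes>\<^bsub>pi1_G3\<^esub> nform a b c = nform (- b) (a - b) (c + 1)"
proof -
  define x y z where "x = wc [(X, True)]" and "y = wc [(Y, True)]" and "z = wc [(Z, True)]"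
  have C: "wc w \<in> carrier pi1_G3" for w by (simp add: pi1_G3_def carrier_presented_group)
  have xyz: "x \<in> carrier pi1_G3" "y \<in> carrier pi1_G3" "z \<in> carrier pi1_G3" unfolding x_def y_def z_def using C by auto
  have m: "wc u \<otimes>\<^bsub>pi1_G3\<^esub> wc v = wc (u @ v)" for u v by (simp add: pi1_G3_def mult_presented_group)
  have o: "\<one>\<^bsub>pi1_G3\<^esub> = wc []" by (simp add: pi1_G3_def one_presented_group)
  have rel: "wc l = wc r" if "(l, r) \<in> G3_relations" for l r
    using word_equiv.relation[OF that, of "[]" "[]"] by (simp add: word_class_eq_iff)
  have iv: "inv\<^bsub>pi1_G3\<^esub> (wc [(g, True)]) = wc [(g, False)]" for g
  proof (rule P.inv_equality)
    show "wc [(g, False)] \<otimes>\<^bsub>pi1_G3\<^esub> wc [(g, True)] = \<one>\<^bsub>pi1_G3\<^esub>"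
      using word_equiv.cancel[of G3_relations "[]" g False "[]"] by (simp add: m o word_class_eq_iff)
  qed (use C in auto)
  have "x \<otimes>\<^bsub>pi1_G3\<^esub> y \<otimes>\<^bsub>pi1_G3\<^esub> inv\<^bsub>pi1_G3\<^esub> x \<otimes>\<^bsub>pi1_G3\<^esub> inv\<^bsub>pi1_G3\<^esub> y = \<one>\<^bsub>pi1_G3\<^esub>"
    unfolding x_def y_def iv m o by (rule rel[of _ "[]", simplified]) simp
  then have "x \<otimes>\<^bsub>pi1_G3\<^esub> y \<otimes>\<^bsub>pi1_G3\<^esub> inv\<^bsub>pi1_G3\<^esub> x = y"
    using P.inv_equality[of "x \<otimes>\<^bsub>pi1_G3\<^esub> y \<otimes>\<^bsub>pi1_G3\<^esub> inv\<^bsub>pi1_G3\<^esub> x" "inv\<^bsub>pi1_G3\<^esub> y"] xyz by simp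
  then have xy: "x \<otimes>\<^bsub>pi1_G3\<^esub> y = y \<otimes>\<^bsub>pi1_G3\<^esub> x"
    using P.inv_solve_right'[of y "x \<otimes>\<^bsub>pi1_G3\<^esub> y" x] xyz by simp
  have zx: "z \<otimes>\<^bsub>pi1_G3\<^esub> x \<otimes>\<^bsub>pi1_G3\<^esub> inv\<^bsub>pi1_G3\<^esub> z = y"
    unfolding x_def y_def z_def iv m using rel[of "[(Z, True), (X, True), (Z, False)]" "[(Y, True)]"] by simp
  have zy: "z \<otimes>\<^bsub>pi1_G3\<^esub> y \<otimes>\<^bsub>pi1_G3\<^esub> inv\<^bsub>pi1_G3\<^esub> z = inv\<^bsub>pi1_G3\<^esub> y \<otimes>\<^bsub>pi1_G3\<^esub> inv\<^bsub>pi1_G3\<^esub> x"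
    unfolding x_def y_def z_def iv m using rel[of "[(Z, True), (Y, True), (Z, False)]" "[(Y, False), (X, False)]"] by simp
  have yxp: "y \<otimes>\<^bsub>pi1_G3\<^esub> x [^]\<^bsub>pi1_G3\<^esub> i = x [^]\<^bsub>pi1_G3\<^esub> i \<otimes>\<^bsub>pi1_G3\<^esub> y" for i :: int
  proof -
    have "y \<otimes>\<^bsub>pi1_G3\<^esub> x \<otimes>\<^bsub>pi1_G3\<^esub> inv\<^bsub>pi1_G3\<^esub> y = x" using xy xyz by (metis P.inv_solve_right' P.m_closed)
    then have "y \<otimes>\<^bsub>pi1_G3\<^esub> x [^]\<^bsub>pi1_G3\<^esub> i \<otimes>\<^bsub>pi1_G3\<^esub> inv\<^bsub>pi1_G3\<^esub> y = x [^]\<^bsub>pi1_G3\<^esub> i"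
      using P.conj_int_pow[OF xyz(2,1), of i] by simp
    then show ?thesis using xyz by (metis P.inv_solve_right' P.m_closed P.int_pow_closed)
  qed
  have xpyp: "x [^]\<^bsub>pi1_G3\<^esub> i \<otimes>\<^bsub>pi1_G3\<^esub> y [^]\<^bsub>pi1_G3\<^esub> j = y [^]\<^bsub>pi1_G3\<^esub> j \<otimes>\<^bsub>pi1_G3\<^esub> x [^]\<^bsub>pi1_G3\<^esub> i" for i j :: int
  proof -
    have xi: "x [^]\<^bsub>pi1_G3\<^esub> i \<in> carrier pi1_G3" using xyz by simp
    have "x [^]\<^bsub>pi1_G3\<^esub> i \<otimes>\<^bsub>pi1_G3\<^esub> y \<otimes>\<^bsub>pi1_G3\<^esub> inv\<^bsub>pi1_G3\<^esub> (x [^]\<^bsub>pi1_G3\<^esub> i) = y"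
      using yxp[of i] xyz xi by (metis P.inv_solve_right' P.m_closed)
    then have "x [^]\<^bsub>pi1_G3\<^esub> i \<otimes>\<^bsub>pi1_G3\<^esub> y [^]\<^bsub>pi1_G3\<^esub> j \<otimes>\<^bsub>pi1_G3\<^esub> inv\<^bsub>pi1_G3\<^esub> (x [^]\<^bsub>pi1_G3\<^esub> i) = y [^]\<^bsub>pi1_G3\<^esub> j"
      using P.conj_int_pow[OF xi xyz(2), of j] by simp
    then show ?thesis using xyz xi by (metis P.inv_solve_right' P.m_closed P.int_pow_closed)
  qed
  note nf = nform_def[folded x_def y_def z_def]
  show "wc [(X, True)] \<otimes>\<^bsub>pi1_G3\<^esub> nform a b c = nform (a + 1) b c"
    unfolding x_def[symmetric] nf using xyz P.int_pow_mult[OF xyz(1), of 1 a]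
    by (simp add: P.m_assoc add.commute)
  have "y \<otimes>\<^bsub>pi1_G3\<^esub> nform a b c = (y \<otimes>\<^bsub>pi1_G3\<^esub> x [^]\<^bsub>pi1_G3\<^esub> a) \<otimes>\<^bsub>pi1_G3\<^esub> y [^]\<^bsub>pi1_G3\<^esub> b \<otimes>\<^bsub>pi1_G3\<^esub> z [^]\<^bsub>pi1_G3\<^esub> c"
    unfolding nf using xyz by (simp add: P.m_assoc)
  also have "\<dots> = x [^]\<^bsub>pi1_G3\<^esub> a \<otimes>\<^bsub>pi1_G3\<^esub> (y \<otimes>\<^bsub>pi1_G3\<^esub> y [^]\<^bsub>pi1_G3\<^esub> b) \<otimes>\<^bsub>pi1_G3\<^esub> z [^]\<^bsub>pi1_G3\<^esub> c"
    unfolding yxp using xyz by (simp add: P.m_assoc)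
  also have "\<dots> = nform a (b + 1) c"
    unfolding nf using xyz P.int_pow_mult[OF xyz(2), of 1 b] by (simp add: add.commute)
  finally show "wc [(Y, True)] \<otimes>\<^bsub>pi1_G3\<^esub> nform a b c = nform a (b + 1) c" unfolding y_def .
  have zc: "z \<otimes>\<^bsub>pi1_G3\<^esub> u = (z \<otimes>\<^bsub>pi1_G3\<^esub> u \<otimes>\<^bsub>pi1_G3\<^esub> inv\<^bsub>pi1_G3\<^esub> z) \<otimes>\<^bsub>pi1_G3\<^esub> z" if "u \<in> carrier pi1_G3" for u
    using that xyz by (simp add: P.m_assoc)
  have zxa: "z \<otimes>\<^bsub>pi1_G3\<^esub> x [^]\<^bsub>pi1_G3\<^esub> a = y [^]\<^bsub>pi1_G3\<^esub> a \<otimes>\<^bsub>pi1_G3\<^esub> z"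
    using zc[of "x [^]\<^bsub>pi1_G3\<^esub> a"] xyz unfolding P.conj_int_pow[OF xyz(3,1)] zx by simp
  have yxi: "inv\<^bsub>pi1_G3\<^esub> y \<otimes>\<^bsub>pi1_G3\<^esub> inv\<^bsub>pi1_G3\<^esub> x = inv\<^bsub>pi1_G3\<^esub> x \<otimes>\<^bsub>pi1_G3\<^esub> inv\<^bsub>pi1_G3\<^esub> y"
    using xy xyz by (metis P.inv_mult_group)
  have ineg: "inv\<^bsub>pi1_G3\<^esub> u [^]\<^bsub>pi1_G3\<^esub> i = u [^]\<^bsub>pi1_G3\<^esub> (- i)" if "u \<in> carrier pi1_G3" for u and i :: int
    using that P.int_pow_neg[OF that, of i] P.int_pow_inv[OF that, of i] by simp
  have zyb: "z \<otimes>\<^bsub>pi1_G3\<^esub> y [^]\<^bsub>pi1_G3\<^esub> b = y [^]\<^bsub>pi1_G3\<^esub> (- b) \<otimes>\<^bsub>pi1_G3\<^esub> x [^]\<^bsub>pi1_G3\<^esub> (- b) \<otimes>\<^bsub>pi1_G3\<^esub> z"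
    using zc[of "y [^]\<^bsub>pi1_G3\<^esub> b"] xyz P.int_pow_mult_distrib[OF yxi, of b] ineg
    unfolding P.conj_int_pow[OF xyz(3,2)] zy by simp
  have "z \<otimes>\<^bsub>pi1_G3\<^esub> nform a b c = (z \<otimes>\<^bsub>pi1_G3\<^esub> x [^]\<^bsub>pi1_G3\<^esub> a) \<otimes>\<^bsub>pi1_G3\<^esub> y [^]\<^bsub>pi1_G3\<^esub> b \<otimes>\<^bsub>pi1_G3\<^esub> z [^]\<^bsub>pi1_G3\<^esub> c"
    unfolding nf using xyz by (simp add: P.m_assoc)
  also have "\<dots> = y [^]\<^bsub>pi1_G3\<^esub> a \<otimes>\<^bsub>pi1_G3\<^esub> (z \<otimes>\<^bsub>pi1_G3\<^esub> y [^]\<^bsub>pi1_G3\<^esub> b) \<otimes>\<^bsub>pi1_G3\<^esub> z [^]\<^bsub>pi1_G3\<^esub> c"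
    unfolding zxa using xyz by (simp add: P.m_assoc)
  also have "\<dots> = (y [^]\<^bsub>pi1_G3\<^esub> a \<otimes>\<^bsub>pi1_G3\<^esub> y [^]\<^bsub>pi1_G3\<^esub> (- b)) \<otimes>\<^bsub>pi1_G3\<^esub> x [^]\<^bsub>pi1_G3\<^esub> (- b) \<otimes>\<^bsub>pi1_G3\<^esub> (z \<otimes>\<^bsub>pi1_G3\<^esub> z [^]\<^bsub>pi1_G3\<^esub> c)"
    unfolding zyb using xyz by (simp add: P.m_assoc)
  also have "y [^]\<^bsub>pi1_G3\<^esub> a \<otimes>\<^bsub>pi1_G3\<^esub> y [^]\<^bsub>pi1_G3\<^esub> (- b) = y [^]\<^bsub>pi1_G3\<^esub> (a - b)"
    using P.int_pow_mult[OF xyz(2), of a "- b"] by simp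
  also have "y [^]\<^bsub>pi1_G3\<^esub> (a - b) \<otimes>\<^bsub>pi1_G3\<^esub> x [^]\<^bsub>pi1_G3\<^esub> (- b) = x [^]\<^bsub>pi1_G3\<^esub> (- b) \<otimes>\<^bsub>pi1_G3\<^esub> y [^]\<^bsub>pi1_G3\<^esub> (a - b)"
    by (rule xpyp[symmetric])
  also have "z \<otimes>\<^bsub>pi1_G3\<^esub> z [^]\<^bsub>pi1_G3\<^esub> c = z [^]\<^bsub>pi1_G3\<^esub> (c + 1)"
    using P.int_pow_mult[OF xyz(3), of 1 c] xyz by (simp add: add.commute)
  finally have "z \<otimes>\<^bsub>pi1_G3\<^esub> nform a b c = nform (- b) (a - b) (c + 1)"
    unfolding nf .
  then show "wc [(Z, True)] \<otimes>\<^bsub>pi1_G3\<^esub> nform a b c = nform (- b) (a - b) (c + 1)" unfolding z_def .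
qed

text \<open>The value in \<open>EG\<close> and the normal form carry the same exponents, so the
  value determines the class: the three relations suffice to present the group.\<close>

lemma word_class_nform:
  "\<exists>a b c. eval_word w = (eis a b, c) \<and> wc w = nform a b c"
proof (induction w)
  case Nil
  have "wc [] = nform 0 0 0"
    by (simp add: nform_def) (simp add: pi1_G3_def one_presented_group)
  then show ?case using eis_0 by (intro exI[of _ 0]) simp
next
  case (Cons l w)
  then obtain a b c where IH: "eval_word w = (eis a b, c)" "wc w = nform a b c" by blast
  obtain g s where l: "l = (g, s)" by (cases l)
  have C: "wc u \<in> carrier pi1_G3" for u by (simp add: pi1_G3_def carrier_presented_group)
  have m: "wc u \<otimes>\<^bsub>pi1_G3\<^esub> wc v = wc (u @ v)" for u v by (simp add: pi1_G3_def mult_presented_group)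
  have o: "\<one>\<^bsub>pi1_G3\<^esub> = wc []" by (simp add: pi1_G3_def one_presented_group)
  have lw: "wc (l # w) = wc [l] \<otimes>\<^bsub>pi1_G3\<^esub> nform a b c" unfolding IH(2)[symmetric] m by simp
  have nC: "nform i j k \<in> carrier pi1_G3" for i j k unfolding nform_def using C by simp
  \<comment> \<open>Inverse letters are treated by undoing the step of the positive letter.\<close>
  have unstep: "wc [(g, False)] \<otimes>\<^bsub>pi1_G3\<^esub> n = n'"
    if "wc [(g, True)] \<otimes>\<^bsub>pi1_G3\<^esub> n' = n" "n' \<in> carrier pi1_G3" for g n n'
  proof -
    have "wc [(g, False)] \<otimes>\<^bsub>pi1_G3\<^esub> wc [(g, True)] = \<one>\<^bsub>pi1_G3\<^esub>"
      using word_equiv.cancel[of G3_relations "[]" g False "[]"] by (simp add: m o word_class_eq_iff)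
    then show ?thesis using that C by (metis P.l_one P.m_assoc)
  qed
  show ?case
  proof (cases g)
    case X
    then show ?thesis
    proof (cases s)
      case True
      have "eval_word (l # w) = (eis (a + 1) b, c)" by (simp add: l X True IH eis_def)
      moreover have "wc (l # w) = wc [(X, True)] \<otimes>\<^bsub>pi1_G3\<^esub> nform a b c" using lw by (simp only: l X True)
      ultimately show ?thesis unfolding nform_step by blast
    next
      case False
      have "eval_word (l # w) = (eis (a - 1) b, c)" by (simp add: l X False IH eis_def)
      moreover have "wc [(X, False)] \<otimes>\<^bsub>pi1_G3\<^esub> nform a b c = nform (a - 1) b c"
        by (rule unstep) (use nform_step(1)[of "a - 1" b c] nC in auto)
      moreover have "wc (l # w) = wc [(X, False)] \<otimes>\<^bsub>pi1_G3\<^esub> nform a b c" using lw by (simp only: l X False)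
      ultimately show ?thesis by blast
    qed
  next
    case Y
    then show ?thesis
    proof (cases s)
      case True
      have "eval_word (l # w) = (eis a (b + 1), c)" by (simp add: l Y True IH eis_def algebra_simps)
      moreover have "wc (l # w) = wc [(Y, True)] \<otimes>\<^bsub>pi1_G3\<^esub> nform a b c" using lw by (simp only: l Y True)
      ultimately show ?thesis unfolding nform_step by blast
    next
      case False
      have "eval_word (l # w) = (eis a (b - 1), c)" by (simp add: l Y False IH eis_def algebra_simps)
      moreover have "wc [(Y, False)] \<otimes>\<^bsub>pi1_G3\<^esub> nform a b c = nform a (b - 1) c"
        by (rule unstep) (use nform_step(2)[of a "b - 1" c] nC in auto)
      moreover have "wc (l # w) = wc [(Y, False)] \<otimes>\<^bsub>pi1_G3\<^esub> nform a b c" using lw by (simp only: l Y False)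
      ultimately show ?thesis by blast
    qed
  next
    case Z
    then show ?thesis
    proof (cases s)
      case True
      have "eval_word (l # w) = (eis (- b) (a - b), c + 1)" by (simp add: l Z True IH om_mult_eis add.commute)
      moreover have "wc (l # w) = wc [(Z, True)] \<otimes>\<^bsub>pi1_G3\<^esub> nform a b c" using lw by (simp only: l Z True)
      ultimately show ?thesis unfolding nform_step by blast
    next
      case False
      have "inverse om = om * om" using om_cubed by (intro inverse_unique) simp
      then have "inverse om * eis a b = eis (b - a) (- a)" by (simp only: mult.assoc om_mult_eis) simp
      moreover have "om powi (- 1) = inverse om" by (simp add: power_int_minus)
      ultimately have "om powi (- 1) * eis a b = eis (b - a) (- a)" by simp
      then have "eval_word (l # w) = (eis (b - a) (- a), c - 1)"
        unfolding l Z eval_word.simps letter.simps IH mult_EG by (simp add: False)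
      moreover have "wc [(Z, False)] \<otimes>\<^bsub>pi1_G3\<^esub> nform a b c = nform (b - a) (- a) (c - 1)"
        by (rule unstep) (use nform_step(3)[of "b - a" "- a" "c - 1"] nC in auto)
      moreover have "wc (l # w) = wc [(Z, False)] \<otimes>\<^bsub>pi1_G3\<^esub> nform a b c" using lw by (simp only: l Z False)
      ultimately show ?thesis by blast
    qed
  qed
qed

lemma eval_word_eq_iff: "eval_word u = eval_word v \<longleftrightarrow> wc u = wc v"
proof
  obtain a b c where u: "eval_word u = (eis a b, c)" "wc u = nform a b c" using word_class_nform by blast
  obtain a' b' c' where v: "eval_word v = (eis a' b', c')" "wc v = nform a' b' c'" using word_class_nform by blast
  assume "eval_word u = eval_word v"
  then show "wc u = wc v" using u v by simp
next
  assume "wc u = wc v"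
  then show "eval_word u = eval_word v" using eval_word_sound by (simp add: word_class_eq_iff)
qed

lemma eval_word_surj: assumes "e \<in> carrier EG" shows "e \<in> range eval_word"
proof -
  let ?S = "range eval_word"
  have gen: "letter l \<in> ?S" for l
    using EG.r_one[OF letter_in, of l] by (intro image_eqI[of _ _ "[l]"]) auto
  have S: "subgroup ?S EG"
  proof (rule EG.subgroupI)
    show "?S \<subseteq> carrier EG" using eval_word_in by blast
    fix x y assume "x \<in> ?S" "y \<in> ?S"
    then obtain u v where "x = eval_word u" "y = eval_word v" by blast
    then have "x \<otimes>\<^bsub>EG\<^esub> y = eval_word (u @ v)" by (simp only: eval_word_append)
    then show "x \<otimes>\<^bsub>EG\<^esub> y \<in> ?S" by blast
  next
    fix x assume "x \<in> ?S"
    then obtain w where w: "x = eval_word w" by blast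
    have "eval_word (word_inv w) \<otimes>\<^bsub>EG\<^esub> eval_word w = eval_word []"
      unfolding eval_word_append[symmetric] using word_inv_left eval_word_sound by blast
    then have "inv\<^bsub>EG\<^esub> x = eval_word (word_inv w)"
      unfolding w by (intro EG.inv_equality eval_word_in) simp
    then show "inv\<^bsub>EG\<^esub> x \<in> ?S" by blast
  qed auto
  obtain a b c where e: "e = (eis a b, c)" using assms by (auto elim!: Eis_E)
  have nat: "(of_nat n * u, 0) \<in> ?S" if "(u, 0) \<in> ?S" for u and n :: nat
  proof (induction n)
    case 0
    have "(0, 0) = eval_word []" by simp
    then show ?case by (metis mult_zero_left of_nat_0 rangeI)
  next
    case (Suc n)
    then have "(u, 0) \<otimes>\<^bsub>EG\<^esub> (of_nat n * u, 0) \<in> ?S" using subgroupEG(3)[OF S that] by blast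
    then show ?case by (simp add: algebra_simps)
  qed
  have int: "(of_int k * u, 0) \<in> ?S" if u: "(u, 0) \<in> ?S" "u \<in> Eis" for u k
  proof (cases k rule: int_cases2)
    case (nonneg n)
    then show ?thesis using nat[OF u(1), of n] by simp
  next
    case (nonpos n)
    have "inv\<^bsub>EG\<^esub> (of_nat n * u, 0) \<in> ?S" using subgroupEG(4)[OF S nat[OF u(1)]] .
    moreover have "of_nat n * u \<in> Eis" using u(2) Eis_closed(8)[OF Eis_closed(4), of u "int n"] by simp
    ultimately show ?thesis using nonpos by (simp add: inv_EG)
  qed
  have "(of_int a * 1, 0) \<in> ?S" using gen[of "(X, True)"] by (intro int) auto
  moreover have "(of_int b * om, 0) \<in> ?S" using gen[of "(Y, True)"] by (intro int) auto
  moreover have "(0, c) \<in> ?S"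
  proof -
    have z: "(0, 1) \<in> ?S" using gen[of "(Z, True)"] by simp
    have "(0, 1) [^]\<^bsub>EG\<^esub> c \<in> ?S" by (rule EG.subgroup_int_pow_closed[OF S z])
    moreover have "(0, 1) [^]\<^bsub>EG\<^esub> c = (0, c)"
    proof (induction c rule: int_induct[of _ 0])
      case (step1 i)
      then show ?case using EG.int_pow_mult[of "(0, 1)" i 1] by simp
    next
      case (step2 i)
      then show ?case using EG.int_pow_mult[of "(0, 1)" i "- 1"] EG.int_pow_neg[of "(0,1)" 1] by (simp add: inv_EG)
    qed simp
    ultimately show ?thesis by simp
  qed
  ultimately have "(of_int a * 1, 0) \<otimes>\<^bsub>EG\<^esub> (of_int b * om, 0) \<otimes>\<^bsub>EG\<^esub> (0, c) \<in> ?S"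
    using subgroupEG(3)[OF S] by blast
  then show ?thesis by (simp add: e eis_def)
qed

text \<open>The inverse of evaluation; the chosen word does not matter by
  \<open>eval_word_eq_iff\<close>.\<close>

definition of_EG :: "complex \<times> int \<Rightarrow> gen word set" where
  "of_EG e = wc (SOME w. eval_word w = e)"

lemma of_EG_eval: "of_EG (eval_word w) = wc w"
proof -
  have "eval_word (SOME v. eval_word v = eval_word w) = eval_word w"
    by (rule someI) (rule HOL.refl)
  then show ?thesis unfolding of_EG_def eval_word_eq_iff .
qed

lemma of_EG_iso: "of_EG \<in> iso EG pi1_G3"
proof (rule isoI)
  show "of_EG \<in> hom EG pi1_G3"
  proof (rule homI)
    fix x y assume "x \<in> carrier EG" "y \<in> carrier EG"
    then obtain u v where uv: "x = eval_word u" "y = eval_word v" using eval_word_surj by blast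
    show "of_EG (x \<otimes>\<^bsub>EG\<^esub> y) = of_EG x \<otimes>\<^bsub>pi1_G3\<^esub> of_EG y"
      unfolding uv eval_word_append[symmetric] of_EG_eval by (simp add: pi1_G3_def mult_presented_group)
  qed (auto simp: of_EG_def pi1_G3_def carrier_presented_group)
  show "bij_betw of_EG (carrier EG) (carrier pi1_G3)"
    unfolding bij_betw_def
  proof
    show "inj_on of_EG (carrier EG)"
      by (rule inj_onI) (metis eval_word_eq_iff eval_word_surj of_EG_eval rangeE)
    show "of_EG ` carrier EG = carrier pi1_G3"
    proof (intro equalityI subsetI)
      fix A assume "A \<in> carrier pi1_G3"
      then obtain w where "A = wc w" by (auto simp: pi1_G3_def carrier_presented_group)
      then show "A \<in> of_EG ` carrier EG" using of_EG_eval eval_word_in by (metis imageI)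
    qed (auto simp: of_EG_def pi1_G3_def carrier_presented_group)
  qed
qed

lemma quotient_transfer:
  assumes f: "\<And>x. x \<in> S \<Longrightarrow> f x \<in> S'"
    and surj: "\<And>y. y \<in> S' \<Longrightarrow> \<exists>x\<in>S. R' `` {y} = R' `` {f x}"
    and eq: "\<And>x y. x \<in> S \<Longrightarrow> y \<in> S \<Longrightarrow> R `` {x} = R `` {y} \<longleftrightarrow> R' `` {f x} = R' `` {f y}"
  shows "card (S // R) = card (S' // R')" "finite (S // R) \<Longrightarrow> finite (S' // R')"
proof -
  have 1: "S // R = (\<lambda>x. R `` {x}) ` S" "S' // R' = (\<lambda>x. R' `` {f x}) ` S"
  proof -
    show "S // R = (\<lambda>x. R `` {x}) ` S" by (auto simp: quotient_def)
    show "S' // R' = (\<lambda>x. R' `` {f x}) ` S"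
    proof (intro equalityI subsetI)
      fix C assume "C \<in> S' // R'"
      then obtain y where y: "y \<in> S'" "C = R' `` {y}" by (auto simp: quotient_def)
      then obtain x where "x \<in> S" "R' `` {y} = R' `` {f x}" using surj by blast
      then show "C \<in> (\<lambda>x. R' `` {f x}) ` S" using y by blast
    qed (use f in \<open>auto simp: quotient_def\<close>)
  qed
  then show "card (S // R) = card (S' // R')"
    using card_image_same_kernel[of S "\<lambda>x. R `` {x}" "\<lambda>x. R' `` {f x}"] eq by simp
  assume "finite (S // R)"
  moreover have "S' // R' = (\<lambda>C. R' `` {f (SOME x. x \<in> S \<and> R `` {x} = C)}) ` (S // R)"
    unfolding 1 image_image
  proof (rule image_cong[OF HOL.refl])
    fix x assume x: "x \<in> S"
    define y where "y = (SOME y. y \<in> S \<and> R `` {y} = R `` {x})"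
    have "y \<in> S \<and> R `` {y} = R `` {x}" unfolding y_def by (rule someI) (use x in simp)
    then show "R' `` {f x} = R' `` {f (SOME y. y \<in> S \<and> R `` {y} = R `` {x})}"
      unfolding y_def[symmetric] using eq x by blast
  qed
  ultimately show "finite (S' // R')" by simp
qed

section \<open>The geometric action\<close>

definition act :: "complex \<times> int \<Rightarrow> E3 \<Rightarrow> E3" where
  "act = (\<lambda>(u, c) (w, t). (om powi c * w + u, t + of_int c))"

lemma act_simp: "act (u, c) (w, t) = (om powi c * w + u, t + of_int c)"
  by (simp add: act_def)

lemma act_mult: "act (x \<otimes>\<^bsub>EG\<^esub> y) = act x \<circ> act y"
  by (rule ext) (auto simp: act_def rot_add algebra_simps split: prod.splits)

lemma act_one [simp]: "act (0, 0) = id"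
  by (rule ext) (auto simp: act_def split: prod.splits)

lemma act_inj: "act x = act y \<longleftrightarrow> x = y"
proof
  assume "act x = act y"
  then have "act x (0, 0) = act y (0, 0)" by simp
  then show "x = y" by (cases x; cases y) (simp add: act_simp)
qed simp

lemma act_inv: "x \<in> carrier EG \<Longrightarrow> act x \<circ> act (inv\<^bsub>EG\<^esub> x) = id \<and> act (inv\<^bsub>EG\<^esub> x) \<circ> act x = id"
  unfolding act_mult[symmetric] by (simp only: EG.l_inv EG.r_inv one_EG act_one simp_thms)

lemma continuous_act: "continuous_on UNIV (act x)"
proof (cases x)
  case (Pair u c)
  then have "act x = (\<lambda>p. (om powi c * fst p + u, snd p + of_int c))" by (auto simp: act_def)
  then show ?thesis by (auto intro!: continuous_intros)
qed

lemma norm_Eis_ge_1: "u \<in> Eis \<Longrightarrow> u \<noteq> 0 \<Longrightarrow> cmod u \<ge> 1"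
proof -
  assume "u \<in> Eis" "u \<noteq> 0"
  then obtain a b where u: "u = eis a b" using Eis_E by blast
  have "0 < (cmod u)\<^sup>2" using \<open>u \<noteq> 0\<close> by simp
  then have "(0::real) < of_int (a\<^sup>2 - a * b + b\<^sup>2)" unfolding u eis_norm_int .
  then have "1 \<le> a\<^sup>2 - a * b + b\<^sup>2" by (simp only: of_int_0_less_iff)
  then have "(1::real) \<le> of_int (a\<^sup>2 - a * b + b\<^sup>2)" by (simp only: of_int_1_le_iff)
  then have "1\<^sup>2 \<le> (cmod u)\<^sup>2" using u eis_norm_int[of a b] by simp
  then show ?thesis by (rule power2_le_imp_le) simp
qed

text \<open>A nontrivial element either shifts the height by a nonzero integer or translates
  horizontally by a nonzero Eisenstein integer, whose squared modulus is a positive integer.\<close>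

lemma act_displacement:
  assumes x: "x \<in> carrier EG" and ne: "act x \<noteq> id"
  shows "1 \<le> dist p (act x p)"
proof -
  obtain u c where uc: "x = (u, c)" "u \<in> Eis" using x by auto
  obtain w t where p: "p = (w, t)" by (cases p)
  show ?thesis
  proof (cases "c = 0")
    case True
    then have "u \<noteq> 0" using ne uc by auto
    then have "1 \<le> cmod u" using norm_Eis_ge_1 uc by blast
    also have "cmod u = dist (fst p) (fst (act x p))" by (simp add: uc p True act_simp dist_norm)
    also have "\<dots> \<le> dist p (act x p)" by (rule dist_fst_le)
    finally show ?thesis .
  next
    case False
    then have "1 \<le> \<bar>c\<bar>" by simp
    then have "1 \<le> \<bar>real_of_int c\<bar>" by linarith
    also have "\<dots> = dist (snd p) (snd (act x p))" by (simp add: uc p act_simp dist_norm)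
    also have "\<dots> \<le> dist p (act x p)" by (rule dist_snd_le)
    finally show ?thesis .
  qed
qed

lemma deck_group_act:
  assumes K: "subgroup K EG"
  shows "deck_group (act ` K)"
proof
  have KE: "x \<in> carrier EG" if "x \<in> K" for x using that K subgroup.subset by blast
  show "id \<in> act ` K" using subgroupEG(2)[OF K] act_one by (metis imageI)
  fix g assume "g \<in> act ` K"
  then obtain x where x: "x \<in> K" "g = act x" by blast
  show "\<exists>h\<in>act ` K. g \<circ> h = id \<and> h \<circ> g = id"
    using act_inv[OF KE[OF x(1)]] subgroupEG(4)[OF K x(1)] x(2) by blast
  show "continuous_on UNIV g" using continuous_act x by simp
  fix h assume "h \<in> act ` K"
  then obtain y where y: "y \<in> K" "h = act y" by blast
  show "g \<circ> h \<in> act ` K"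
    using subgroupEG(3)[OF K x(1) y(1)] x(2) y(2) act_mult by (metis imageI)
next
  show "\<exists>r>0. \<forall>g\<in>act ` K. g \<noteq> id \<longrightarrow> (\<forall>x. r \<le> dist x (g x))"
  proof (intro exI[of _ 1] conjI ballI impI allI)
    fix g x assume "g \<in> act ` K" "g \<noteq> id"
    then show "1 \<le> dist x (g x)" using act_displacement subsetD[OF subgroup.subset[OF K]] by blast
  qed simp
qed

lemma subgroup_carrier_EG: "subgroup (carrier EG) EG"
  by (rule EG.subgroup_self)

lemma G3_generators: "G3_x = act (1, 0)" "G3_y = act (om, 0)" "G3_z = act (0, 1)"
  by (auto simp: G3_x_def G3_y_def G3_z_def act_def om_def)

lemma generate_EG: "generate EG {(1, 0), (om, 0), (0, 1)} = carrier EG"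
proof
  show "generate EG {(1, 0), (om, 0), (0, 1)} \<subseteq> carrier EG"
    by (rule EG.generate_incl) auto
  have S: "subgroup (generate EG {(1, 0), (om, 0), (0, 1)}) EG"
    by (rule EG.generate_is_subgroup) auto
  have "letter a \<in> generate EG {(1, 0), (om, 0), (0, 1)}" for a
  proof -
    have 1: "letter (g, True) \<in> generate EG {(1, 0), (om, 0), (0, 1)}" for g
      by (cases g) (auto intro: generate.incl)
    have "letter (g, False) = inv\<^bsub>EG\<^esub> (letter (g, True))" for g
      by (cases g) (auto simp: inv_EG)
    then have "letter (g, False) \<in> generate EG {(1, 0), (om, 0), (0, 1)}" for g
      using subgroupEG(4)[OF S 1] by metis
    then show ?thesis using 1 by (cases a) (metis (full_types))
  qed
  then have "eval_word w \<in> generate EG {(1, 0), (om, 0), (0, 1)}" for w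
    by (induction w) (use subgroupEG(2,3)[OF S] in \<open>auto simp del: mult_EG\<close>)
  then show "carrier EG \<subseteq> generate EG {(1, 0), (om, 0), (0, 1)}" using eval_word_surj by blast
qed

lemma generate_G3: "generate (BijGroup UNIV) {G3_x, G3_y, G3_z} = act ` carrier EG"
proof -
  have B: "act x \<in> Bij UNIV" if "x \<in> carrier EG" for x
    using act_inv[OF that] unfolding Bij_def by (auto simp: extensional_def intro: o_bij)
  have h: "act \<in> hom EG (BijGroup UNIV)"
    by (rule homI) (use B EG.m_closed act_mult in \<open>auto simp: BijGroup_def compose_def o_def simp del: carrier_EG mult_EG\<close>)
  interpret A: group_hom EG "BijGroup UNIV" act
    using h group_EG group_BijGroup by (simp add: group_hom_def group_hom_axioms_def)
  have "generate (BijGroup UNIV) (act ` {(1, 0), (om, 0), (0, 1)}) = act ` generate EG {(1, 0), (om, 0), (0, 1)}"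
    by (rule A.generate_img) auto
  then show ?thesis unfolding generate_EG by (simp add: G3_generators)
qed

lemma manifold_G3_eq: "manifold_G3 = orbit_space (act ` carrier EG)"
  unfolding manifold_G3_def generate_G3 ..

lemma card_rcosets_act:
  assumes K: "subgroup K EG"
  shows "card ((\<lambda>g. (\<lambda>k. k \<circ> g) ` act ` K) ` act ` carrier EG) = card (rcosets\<^bsub>EG\<^esub> K)"
proof -
  have r: "rcosets\<^bsub>EG\<^esub> K = (\<lambda>x. K #>\<^bsub>EG\<^esub> x) ` carrier EG" by (auto simp: RCOSETS_def)
  have "(\<lambda>k. k \<circ> act x) ` act ` K = act ` (K #>\<^bsub>EG\<^esub> x)" for x
    by (auto simp: r_coset_def act_mult image_iff)
  then have l: "(\<lambda>g. (\<lambda>k. k \<circ> g) ` act ` K) ` act ` carrier EG = (`) act ` (\<lambda>x. K #>\<^bsub>EG\<^esub> x) ` carrier EG"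
    by (simp only: image_image)
  have "inj act" using act_inj by (auto simp: inj_def)
  then have "inj_on ((`) act) A" for A by (meson inj_image_eq_iff inj_onI)
  then show ?thesis unfolding r l by (rule card_image)
qed

lemma lift_subgroup_exists:
  assumes n: "n > 0" and K: "K \<in> IndexSub n"
  obtains v where "v \<in> Eis" "K = lift_subgroup (height K) (lat K) v"
proof -
  note S = IndexSubD[OF n K]
  obtain v where v: "v \<in> top_coset K" using top_coset_ne[OF S(2)] by blast
  then have "v \<in> Eis" using subgroupEG(1)[OF S(1)] by (fastforce simp: top_coset_def)
  then show ?thesis using that subgroup_eq_lift_subgroup[OF S(1,2) v] by blast
qed

text \<open>The map \<open>A\<close> takes the vertical axis to the axis of the screw motion
  \<open>?g\<close>, stretches heights by \<open>l\<close>, and multiplies horizontally by the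
  generator \<open>\<alpha>\<close> of the ideal, after a reflection if needed. Conjugation by it
  yields the homeomorphism of orbit spaces and the isomorphism of groups at once.\<close>

lemma ScrewSub_model:
  assumes n: "n > 0" and K: "K \<in> ScrewSub n"
  obtains A B where "continuous_on UNIV A" "continuous_on UNIV B" "A \<circ> B = id" "B \<circ> A = id"
    "act ` K = (\<lambda>k. A \<circ> k \<circ> B) ` act ` carrier EG" "EG \<cong> EG\<lparr>carrier := K\<rparr>"
proof -
  have K': "K \<in> IndexSub n" "\<not> 3 dvd height K" using K by (auto simp: ScrewSub_def)
  note S = IndexSubD[OF n K'(1)]
  define l where "l = height K"
  have l: "l > 0" "\<not> 3 dvd l" using S(3) K'(2) by (auto simp: l_def)
  obtain \<alpha> where \<alpha>: "\<alpha> \<in> Eis" "\<alpha> \<noteq> 0" "lat K = (*) \<alpha> ` Eis"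
    using InvLat_principal[OF S(6) S(8)[OF K'(2)]] .
  obtain v where v: "v \<in> Eis" "K = lift_subgroup l (lat K) v" using lift_subgroup_exists[OF n K'(1)] l_def by blast
  let ?g = "(v, int l)"
  have gE: "?g \<in> carrier EG" using v(1) by simp
  have l3: "\<not> 3 dvd int l" using l(2) by (metis of_nat_dvd_iff of_nat_numeral)
  define \<zeta> where "\<zeta> = om powi (int l)"
  have \<zeta>1: "\<zeta> \<noteq> 1" unfolding \<zeta>_def using l3 rot_eq_1_iff by blast
  define \<beta> where "\<beta> = v / (1 - \<zeta>)"
  have \<beta>: "\<beta> = \<zeta> * \<beta> + v" using \<zeta>1 by (simp add: \<beta>_def field_simps)
  \<comment> \<open>\<open>\<beta>\<close> is on the axis of the screw motion \<open>?g\<close>; if that rotates by \<open>om\<^sup>2\<close>, orientation is reversed.\<close>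
  define \<sigma> :: "complex \<Rightarrow> complex" where "\<sigma> = (if int l mod 3 = 1 then id else cnj)"
  have om_cnj: "cnj om = om * om" using om_sq by (simp add: complex_eq_iff om_Re_Im)
  have \<sigma>: "\<sigma> (w + u) = \<sigma> w + \<sigma> u" "\<sigma> (\<sigma> w) = w" "continuous_on UNIV \<sigma>" for w u
    by (auto simp: \<sigma>_def intro: continuous_intros)
  have \<sigma>om: "\<sigma> (om * w) = \<zeta> * \<sigma> w" for w
  proof (cases "int l mod 3 = 1")
    case True
    then have "\<zeta> = om" unfolding \<zeta>_def by (subst rot_mod3) simp
    then show ?thesis using True by (simp add: \<sigma>_def)
  next
    case False
    then have "int l mod 3 = 2" using l3 by presburger
    then have "\<zeta> = om * om" unfolding \<zeta>_def by (subst rot_mod3) (simp add: power2_eq_square)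
    then show ?thesis using False om_cnj by (simp add: \<sigma>_def)
  qed
  have \<sigma>E: "\<sigma> u \<in> Eis" if "u \<in> Eis" for u
  proof -
    obtain a b where u: "u = eis a b" using \<open>u \<in> Eis\<close> Eis_E by blast
    have "cnj u = of_int a + of_int b * (om * om)" by (simp add: u eis_def om_cnj)
    then have "cnj u \<in> Eis" by auto
    then show ?thesis using that by (simp add: \<sigma>_def)
  qed
  define A where "A = (\<lambda>(w, t). (\<alpha> * \<sigma> w + \<beta>, real l * t))"
  define B where "B = (\<lambda>(w, t). (\<sigma> ((w - \<beta>) / \<alpha>), t / real l))"
  have "A = (\<lambda>p. (\<alpha> * \<sigma> (fst p) + \<beta>, real l * snd p))" by (auto simp: A_def)
  then have cA: "continuous_on UNIV A"
    by (auto intro!: continuous_intros continuous_on_compose2[OF \<sigma>(3)])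
  have "B = (\<lambda>p. (\<sigma> ((fst p - \<beta>) / \<alpha>), snd p / real l))" by (auto simp: B_def)
  then have cB: "continuous_on UNIV B"
    using \<alpha>(2) l(1) by (auto intro!: continuous_intros continuous_on_compose2[OF \<sigma>(3)])
  have AB: "A \<circ> B = id" "B \<circ> A = id"
    using \<alpha>(2) l(1) by (auto simp: A_def B_def \<sigma>(2) fun_eq_iff)
  \<comment> \<open>Conjugation by \<open>A\<close> written in the coordinates of \<open>EG\<close>:
    a translation by \<open>\<mu>\<close> becomes one by \<open>\<alpha> * \<sigma> \<mu>\<close>,
    and the unit screw motion becomes \<open>?g\<close>.\<close>
  define \<Phi> where "\<Phi> = (\<lambda>(\<mu>, c). (\<alpha> * \<sigma> \<mu>, 0) \<otimes>\<^bsub>EG\<^esub> ?g [^]\<^bsub>EG\<^esub> (c::int))"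
  have step: "act ?g \<circ> A = A \<circ> act (0, 1)"
  proof (rule ext)
    fix p :: E3
    obtain w t where p: "p = (w, t)" by (cases p)
    have 1: "act ?g (A (w, t)) = (\<zeta> * (\<alpha> * \<sigma> w + \<beta>) + v, real l * t + real l)"
      unfolding A_def prod.case act_simp \<zeta>_def by simp
    have "A (act (0, 1) (w, t)) = (\<alpha> * \<sigma> (om * w) + \<beta>, real l * (t + 1))"
      unfolding act_simp A_def prod.case by simp
    also have "\<dots> = (\<alpha> * (\<zeta> * \<sigma> w) + (\<zeta> * \<beta> + v), real l * (t + 1))" unfolding \<sigma>om using \<beta> by metis
    finally show "(act ?g \<circ> A) p = (A \<circ> act (0, 1)) p" using 1 by (simp add: p algebra_simps)
  qed
  have step': "act (inv\<^bsub>EG\<^esub> ?g) \<circ> A = A \<circ> act (0, - 1)"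
  proof -
    have "act (0, 1) \<circ> act (0, - 1) = id" unfolding act_mult[symmetric] by simp
    then have "act (inv\<^bsub>EG\<^esub> ?g) \<circ> A = act (inv\<^bsub>EG\<^esub> ?g) \<circ> (A \<circ> act (0, 1)) \<circ> act (0, - 1)"
      by (simp add: comp_assoc)
    also have "\<dots> = (act (inv\<^bsub>EG\<^esub> ?g) \<circ> act ?g) \<circ> A \<circ> act (0, - 1)" unfolding step[symmetric] by (simp only: comp_assoc)
    finally show ?thesis using act_inv[OF gE] by simp
  qed
  have vert: "act (?g [^]\<^bsub>EG\<^esub> (c::int)) \<circ> A = A \<circ> act (0, c)" for c
  proof (induction c rule: int_induct[of _ 0])
    case base
    then show ?case by simp
  next
    case (step1 i)
    have "?g [^]\<^bsub>EG\<^esub> (i + 1) = ?g [^]\<^bsub>EG\<^esub> i \<otimes>\<^bsub>EG\<^esub> ?g" using EG.int_pow_mult[OF gE, of i 1] EG.int_pow_1[OF gE] by metis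
    then have "act (?g [^]\<^bsub>EG\<^esub> (i + 1)) \<circ> A = act (?g [^]\<^bsub>EG\<^esub> i) \<circ> (act ?g \<circ> A)" by (simp only: act_mult comp_assoc)
    also have "\<dots> = A \<circ> (act (0, i) \<circ> act (0, 1))" unfolding step using step1.IH by (metis comp_assoc)
    finally show ?case unfolding act_mult[symmetric] by simp
  next
    case (step2 i)
    have "?g [^]\<^bsub>EG\<^esub> (i - 1) = ?g [^]\<^bsub>EG\<^esub> i \<otimes>\<^bsub>EG\<^esub> inv\<^bsub>EG\<^esub> ?g"
      using EG.int_pow_mult[OF gE, of i "- 1"] EG.int_pow_neg[OF gE, of 1] EG.int_pow_1[OF gE] by simp
    then have "act (?g [^]\<^bsub>EG\<^esub> (i - 1)) \<circ> A = act (?g [^]\<^bsub>EG\<^esub> i) \<circ> (act (inv\<^bsub>EG\<^esub> ?g) \<circ> A)" by (simp only: act_mult comp_assoc)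
    also have "\<dots> = A \<circ> (act (0, i) \<circ> act (0, - 1))" unfolding step' using step2.IH by (metis comp_assoc)
    finally show ?case unfolding act_mult[symmetric] by simp
  qed
  have \<Phi>A: "act (\<Phi> e) \<circ> A = A \<circ> act e" for e
  proof -
    obtain \<mu> c where e: "e = (\<mu>, c)" by (cases e)
    have "act (\<alpha> * \<sigma> \<mu>, 0) \<circ> A = A \<circ> act (\<mu>, 0)"
      by (auto simp: fun_eq_iff act_simp A_def \<sigma>(1) algebra_simps)
    then have "act (\<Phi> e) \<circ> A = A \<circ> (act (\<mu>, 0) \<circ> act (0, c))"
      unfolding \<Phi>_def e prod.case act_mult using vert[of c] by (metis comp_assoc)
    then show ?thesis unfolding e act_mult[symmetric] by simp
  qed
  have \<Phi>B: "act (\<Phi> e) = A \<circ> act e \<circ> B" for e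
    using \<Phi>A[of e] AB(1) by (metis comp_assoc comp_id)
  have \<Phi>im: "\<Phi> ` carrier EG = K"
  proof -
    have "\<Phi> ` carrier EG = {(\<kappa>, 0) \<otimes>\<^bsub>EG\<^esub> ?g [^]\<^bsub>EG\<^esub> j |\<kappa> j::int. \<kappa> \<in> lat K}"
    proof (intro equalityI subsetI)
      fix x assume "x \<in> {(\<kappa>, 0) \<otimes>\<^bsub>EG\<^esub> ?g [^]\<^bsub>EG\<^esub> j |\<kappa> j::int. \<kappa> \<in> lat K}"
      then obtain u j where u: "u \<in> Eis" "x = (\<alpha> * u, 0) \<otimes>\<^bsub>EG\<^esub> ?g [^]\<^bsub>EG\<^esub> (j::int)" unfolding \<alpha>(3) by blast
      then have "x = \<Phi> (\<sigma> u, j)" by (simp add: \<Phi>_def \<sigma>(2))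
      then show "x \<in> \<Phi> ` carrier EG" using \<sigma>E[OF u(1)] by simp
    next
      fix x assume "x \<in> \<Phi> ` carrier EG"
      then obtain \<mu> c where "\<mu> \<in> Eis" "x = (\<alpha> * \<sigma> \<mu>, 0) \<otimes>\<^bsub>EG\<^esub> ?g [^]\<^bsub>EG\<^esub> (c::int)" by (auto simp: \<Phi>_def)
      then show "x \<in> {(\<kappa>, 0) \<otimes>\<^bsub>EG\<^esub> ?g [^]\<^bsub>EG\<^esub> j |\<kappa> j::int. \<kappa> \<in> lat K}" unfolding \<alpha>(3) using \<sigma>E by blast
    qed
    then show ?thesis using v(2) by (simp add: lift_subgroup_def)
  qed
  have eq: "act ` K = (\<lambda>k. A \<circ> k \<circ> B) ` act ` carrier EG"
    unfolding \<Phi>im[symmetric] image_image \<Phi>B ..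
  have "\<Phi> \<in> iso EG (EG\<lparr>carrier := K\<rparr>)"
  proof (rule isoI)
    show "\<Phi> \<in> hom EG (EG\<lparr>carrier := K\<rparr>)"
    proof (rule homI)
      fix x y
      \<comment> \<open>Since \<open>act\<close> is faithful, the homomorphism law can be checked on
        the maps, where \<open>\<Phi>\<close> is conjugation by \<open>A\<close>.\<close>
      have "act (\<Phi> (x \<otimes>\<^bsub>EG\<^esub> y)) = A \<circ> act x \<circ> (B \<circ> A) \<circ> act y \<circ> B" unfolding \<Phi>B act_mult AB(2) by (simp add: comp_assoc)
      also have "\<dots> = act (\<Phi> x \<otimes>\<^bsub>EG\<^esub> \<Phi> y)" unfolding act_mult \<Phi>B by (simp only: comp_assoc)
      finally show "\<Phi> (x \<otimes>\<^bsub>EG\<^esub> y) = \<Phi> x \<otimes>\<^bsub>EG\<lparr>carrier := K\<rparr>\<^esub> \<Phi> y" unfolding act_inj by simp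
    qed (use \<Phi>im in auto)
    have "inj_on \<Phi> (carrier EG)"
    proof (rule inj_onI)
      fix x y assume "\<Phi> x = \<Phi> y"
      then have "B \<circ> (A \<circ> act x) = B \<circ> (A \<circ> act y)" using \<Phi>A by metis
      then have "act x = act y" using AB(2) by (metis comp_assoc id_comp)
      then show "x = y" unfolding act_inj .
    qed
    then show "bij_betw \<Phi> (carrier EG) (carrier (EG\<lparr>carrier := K\<rparr>))" using \<Phi>im by (simp add: bij_betw_def)
  qed
  then show ?thesis using that cA cB AB eq is_isoI by blast
qed

lemma ScrewSub_homeomorphic:
  assumes "n > 0" "K \<in> ScrewSub n"
  shows "orbit_space (act ` K) homeomorphic_space manifold_G3"
proof -
  obtain A B where *: "continuous_on UNIV A" "continuous_on UNIV B" "A \<circ> B = id" "B \<circ> A = id"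
    "act ` K = (\<lambda>k. A \<circ> k \<circ> B) ` act ` carrier EG" "EG \<cong> EG\<lparr>carrier := K\<rparr>"
    using ScrewSub_model[OF assms] .
  have "homeomorphic_maps manifold_G3 (orbit_space (act ` K)) ((`) A) ((`) B)"
    unfolding manifold_G3_eq by (rule conj_homeomorphic_maps(1)[OF *(1-5)])
  then show ?thesis using homeomorphic_space_sym homeomorphic_space_def by blast
qed

section \<open>Translation subgroups and the torus\<close>

lemma int_pow_translation:
  assumes "3 dvd l" "v \<in> Eis"
  shows "(v, int l) [^]\<^bsub>EG\<^esub> (j::int) = (of_int j * v, j * int l)"
proof -
  have gE: "(v, int l) \<in> carrier EG" using assms(2) by simp
  have r: "om powi (i * int l) = 1" for i
    using assms(1) by (metis dvd_mult of_nat_dvd_iff of_nat_numeral rot_eq_1_iff)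
  have r': "om powi (- int l) = 1" "om powi (int l) = 1" using r[of "- 1"] r[of 1] by simp_all
  show ?thesis
  proof (induction j rule: int_induct[of _ 0])
    case base
    then show ?case by simp
  next
    case (step1 i)
    have "(v, int l) [^]\<^bsub>EG\<^esub> (i + 1) = (v, int l) [^]\<^bsub>EG\<^esub> i \<otimes>\<^bsub>EG\<^esub> (v, int l)"
      using EG.int_pow_mult[OF gE, of i 1] EG.int_pow_1[OF gE] by metis
    then show ?case unfolding step1.IH mult_EG r by (simp add: algebra_simps)
  next
    case (step2 i)
    have "(v, int l) [^]\<^bsub>EG\<^esub> (i - 1) = (v, int l) [^]\<^bsub>EG\<^esub> i \<otimes>\<^bsub>EG\<^esub> inv\<^bsub>EG\<^esub> (v, int l)"
      using EG.int_pow_mult[OF gE, of i "- 1"] EG.int_pow_neg[OF gE, of 1] EG.int_pow_1[OF gE] by simp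
    then show ?case unfolding step2.IH inv_EG[OF assms(2)] mult_EG r r' by (simp add: algebra_simps)
  qed
qed

text \<open>An explicit basis over the integers: the two vectors of the Hermite normal form and one
  translation at the height of \<open>K\<close>.\<close>

lemma TransSub_elements:
  assumes n: "n > 0" and K: "K \<in> TransSub n"
  obtains a d s v where "a > 0" "d > 0" "v \<in> Eis"
    "K = {(eis (i * a + j * s) (j * d) + of_int k * v, k * int (height K)) |i j k. True}"
proof -
  have K': "K \<in> IndexSub n" "3 dvd height K" using K by (auto simp: TransSub_def)
  note S = IndexSubD[OF n K'(1)]
  obtain a d s where ads: "a > 0" "d > 0" "lat K = hnf a d s" using Lat_hnf[OF S(6,7)] by metis
  obtain v where v: "v \<in> Eis" "K = lift_subgroup (height K) (lat K) v" using lift_subgroup_exists[OF n K'(1)] by blast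
  have "K = {(\<kappa> + of_int k * v, k * int (height K)) |\<kappa> k. \<kappa> \<in> hnf a d s}"
    by (subst v(2)) (simp add: lift_subgroup_def int_pow_translation[OF K'(2) v(1)] ads(3))
  also have "\<dots> = {(eis (i * a + j * s) (j * d) + of_int k * v, k * int (height K)) |i j k. True}"
    unfolding hnf_def by blast
  finally show ?thesis using that ads v by blast
qed

lemma TransSub_rot:
  assumes "K \<in> TransSub n" shows "om powi (k * int (height K)) = 1"
proof -
  have "3 dvd height K" using assms by (simp add: TransSub_def)
  then show ?thesis by (metis dvd_mult of_nat_dvd_iff of_nat_numeral rot_eq_1_iff)
qed

lemma TransSub_iso:
  assumes n: "n > 0" and K: "K \<in> TransSub n"
  shows "EG\<lparr>carrier := K\<rparr> \<cong> int_cubed"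
proof -
  have S: "subgroup K EG" "height K > 0" using IndexSubD[OF n] K by (auto simp: TransSub_def)
  obtain a d s v where *: "a > 0" "d > 0" "v \<in> Eis"
    "K = {(eis (i * a + j * s) (j * d) + of_int k * v, k * int (height K)) |i j k. True}"
    using TransSub_elements[OF n K] .
  define f where "f = (\<lambda>(i, j, k). (eis (i * a + j * s) (j * d) + of_int k * v, k * int (height K)))"
  have "f \<in> iso int_cubed (EG\<lparr>carrier := K\<rparr>)"
  proof (rule isoI)
    have im: "f ` UNIV = K"
    proof (subst *(4), intro Set.set_eqI iffI)
      fix x assume "x \<in> f ` UNIV"
      then obtain i j k where "x = f (i, j, k)" by (metis imageE prod_cases3)
      then show "x \<in> {(eis (i * a + j * s) (j * d) + of_int k * v, k * int (height K)) |i j k. True}"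
        unfolding f_def prod.case by blast
    next
      fix x assume "x \<in> {(eis (i * a + j * s) (j * d) + of_int k * v, k * int (height K)) |i j k. True}"
      then obtain i j k where "x = (eis (i * a + j * s) (j * d) + of_int k * v, k * int (height K))" by blast
      then have "x = f (i, j, k)" by (simp add: f_def)
      then show "x \<in> f ` UNIV" by blast
    qed
    show "f \<in> hom int_cubed (EG\<lparr>carrier := K\<rparr>)"
    proof (rule homI)
      fix x y :: "int \<times> int \<times> int"
      obtain i j k i' j' k' where x: "x = (i, j, k)" "y = (i', j', k')" by (metis prod_cases3)
      have "f (x \<otimes>\<^bsub>int_cubed\<^esub> y) = (eis (i * a + j * s) (j * d) + of_int k * v + (eis (i' * a + j' * s) (j' * d) + of_int k' * v),
          (k + k') * int (height K))"
        unfolding x f_def int_cubed_def by (simp add: eis_def algebra_simps)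
      also have "\<dots> = f x \<otimes>\<^bsub>EG\<^esub> f y"
        unfolding x f_def prod.case mult_EG TransSub_rot[OF K] by (simp add: algebra_simps)
      finally show "f (x \<otimes>\<^bsub>int_cubed\<^esub> y) = f x \<otimes>\<^bsub>EG\<lparr>carrier := K\<rparr>\<^esub> f y" by simp
    qed (use im in auto)
    have "inj f"
    proof (rule injI)
      fix x y assume eq: "f x = f y"
      obtain i j k i' j' k' where x: "x = (i, j, k)" "y = (i', j', k')" by (metis prod_cases3)
      have "k = k'" using eq S(2) by (simp add: x f_def)
      then have "i * a + j * s = i' * a + j' * s" "j * d = j' * d" using eq by (auto simp: x f_def)
      then show "x = y" using *(1,2) \<open>k = k'\<close> x by simp
    qed
    moreover have "carrier int_cubed = UNIV" by (simp add: int_cubed_def integer_group_def)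
    ultimately show "bij_betw f (carrier int_cubed) (carrier (EG\<lparr>carrier := K\<rparr>))"
      using im by (simp add: bij_betw_def)
  qed
  then have "int_cubed \<cong> EG\<lparr>carrier := K\<rparr>" by (rule is_isoI)
  moreover have "group int_cubed"
    unfolding int_cubed_def by (intro DirProd_group group_integer_group)
  ultimately show ?thesis by (simp add: group.iso_sym)
qed

lemma TransSub_commute:
  assumes n: "n > 0" and K: "K \<in> TransSub n" and x: "x \<in> K" "y \<in> K"
  shows "x \<otimes>\<^bsub>EG\<^esub> y = y \<otimes>\<^bsub>EG\<^esub> x"
proof -
  have S: "subgroup K EG" "has_height K" "3 dvd height K" using IndexSubD[OF n] K by (auto simp: TransSub_def)
  have r: "om powi c = 1" if "(u, c) \<in> K" for u c
    using height_dvd[OF S(1,2) that] TransSub_rot[OF K] by (metis dvdE mult.commute)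
  show ?thesis using x r by (cases x; cases y) simp
qed

text \<open>In real coordinates with respect to the basis of \<open>K\<close> the group acts by
  integer shifts, so exponentiating each coordinate induces a continuous bijection onto the torus;
  it goes from a compact space to a Hausdorff space.\<close>

lemma TransSub_homeomorphic:
  assumes n: "n > 0" and K: "K \<in> TransSub n"
  shows "orbit_space (act ` K) homeomorphic_space manifold_G1"
proof -
  have S: "subgroup K EG" "height K > 0" using IndexSubD[OF n] K by (auto simp: TransSub_def)
  obtain a d s v where *: "a > 0" "d > 0" "v \<in> Eis"
    "K = {(eis (i * a + j * s) (j * d) + of_int k * v, k * int (height K)) |i j k. True}"
    using TransSub_elements[OF n K] .
  define l where "l = real (height K)"
  have l: "l > 0" using S(2) by (simp add: l_def)
  define cy where "cy w = Im w * 2 / sqrt 3" for w :: complex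
  define cx where "cx w = Re w + cy w / 2" for w
  have cxy: "of_real (cx w) + of_real (cy w) * om = w" for w
    by (simp add: complex_eq_iff om_Re_Im cx_def cy_def)
  have cxy': "cy (of_real x + of_real y * om) = y" "cx (of_real x + of_real y * om) = x" for x y
    by (simp_all add: cx_def cy_def om_Re_Im)
  define P where "P = (\<lambda>(i::real, j::real, k::real).
     (of_real (i * of_int a + j * of_int s) + of_real (j * of_int d) * om + of_real k * v, k * l))"
  \<comment> \<open>The coordinates \<open>k3\<close>, \<open>k2\<close> and \<open>k1\<close>,
    found in this order, invert the triangular map \<open>P\<close>.\<close>
  define k3 where "k3 p = snd p / l" for p :: E3
  define w0 where "w0 p = fst p - of_real (k3 p) * v" for p
  define k2 where "k2 p = cy (w0 p) / of_int d" for p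
  define k1 where "k1 p = (cx (w0 p) - k2 p * of_int s) / of_int a" for p
  have PQ: "P (k1 p, k2 p, k3 p) = p" for p
  proof -
    have "k1 p * of_int a + k2 p * of_int s = cx (w0 p)" "k2 p * of_int d = cy (w0 p)" "k3 p * l = snd p"
      using * l by (simp_all add: k1_def k2_def k3_def)
    then show ?thesis unfolding P_def prod.case using cxy[of "w0 p"] by (simp add: w0_def)
  qed
  have QP: "k1 (P (i, j, k)) = i" "k2 (P (i, j, k)) = j" "k3 (P (i, j, k)) = k" for i j k
  proof -
    show 3: "k3 (P (i, j, k)) = k" using l by (simp add: k3_def P_def)
    have w: "w0 (P (i, j, k)) = of_real (i * of_int a + j * of_int s) + of_real (j * of_int d) * om"
      unfolding w0_def 3 by (simp add: P_def)
    show 2: "k2 (P (i, j, k)) = j" unfolding k2_def w cxy' using *(2) by simp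
    show "k1 (P (i, j, k)) = i" unfolding k1_def 2 w cxy' using *(1) by simp
  qed
  have cont: "continuous_on UNIV k1" "continuous_on UNIV k2" "continuous_on UNIV k3"
    unfolding k1_def k2_def k3_def w0_def cx_def cy_def
    using * l by (auto intro!: continuous_intros)
  have "P = (\<lambda>q. (of_real (fst q * of_int a + fst (snd q) * of_int s) + of_real (fst (snd q) * of_int d) * om
      + of_real (snd (snd q)) * v, snd (snd q) * l))" by (auto simp: P_def)
  then have cP: "continuous_on UNIV P" by (simp only:) (intro continuous_intros)
  have actP: "act (eis (i' * a + j' * s) (j' * d) + of_int k' * v, k' * int (height K)) (P (i, j, k))
      = P (i + of_int i', j + of_int j', k + of_int k')" for i j k i' j' k'
    unfolding P_def prod.case act_simp TransSub_rot[OF K] by (simp add: eis_def l_def algebra_simps)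
  have orb: "orbit_of (act ` K) p = orbit_of (act ` K) q \<longleftrightarrow>
     (\<exists>i' j' k'. k1 q = k1 p + of_int i' \<and> k2 q = k2 p + of_int j' \<and> k3 q = k3 p + of_int k')" for p q
  proof -
    have "orbit_of (act ` K) p = orbit_of (act ` K) q \<longleftrightarrow> (\<exists>x\<in>K. q = act x p)"
      using deck_group.orbit_of_eq_iff[OF deck_group_act[OF S(1)]] by auto
    also have "\<dots> \<longleftrightarrow> (\<exists>i' j' k'. q = act (eis (i' * a + j' * s) (j' * d) + of_int k' * v, k' * int (height K)) (P (k1 p, k2 p, k3 p)))"
    proof
      assume "\<exists>x\<in>K. q = act x p"
      then obtain x where x: "x \<in> K" "q = act x p" by blast
      then have "x \<in> {(eis (i * a + j * s) (j * d) + of_int k * v, k * int (height K)) |i j k. True}" using *(4) by blast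
      then obtain i' j' k' where "x = (eis (i' * a + j' * s) (j' * d) + of_int k' * v, k' * int (height K))" by blast
      then show "\<exists>i' j' k'. q = act (eis (i' * a + j' * s) (j' * d) + of_int k' * v, k' * int (height K)) (P (k1 p, k2 p, k3 p))"
        using x(2) unfolding PQ by blast
    next
      assume "\<exists>i' j' k'. q = act (eis (i' * a + j' * s) (j' * d) + of_int k' * v, k' * int (height K)) (P (k1 p, k2 p, k3 p))"
      then obtain i' j' k' where q: "q = act (eis (i' * a + j' * s) (j' * d) + of_int k' * v, k' * int (height K)) p"
        unfolding PQ by blast
      have "(eis (i' * a + j' * s) (j' * d) + of_int k' * v, k' * int (height K)) \<in> K" by (subst *(4)) blast
      then show "\<exists>x\<in>K. q = act x p" using q by blast
    qed
    also have "\<dots> \<longleftrightarrow> (\<exists>i' j' k'. k1 q = k1 p + of_int i' \<and> k2 q = k2 p + of_int j' \<and> k3 q = k3 p + of_int k')"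
      unfolding actP using PQ QP by metis
    finally show ?thesis .
  qed
  define e where "e x = cis (2 * pi * x)" for x :: real
  have e_eq: "e x = e y \<longleftrightarrow> (\<exists>k::int. y = x + of_int k)" for x y
  proof
    assume "e x = e y"
    then have "sin (2 * pi * x) = sin (2 * pi * y) \<and> cos (2 * pi * x) = cos (2 * pi * y)"
      by (simp add: e_def complex_eq_iff)
    then obtain k :: int where "2 * pi * x = 2 * pi * y + 2 * pi * of_int k" using sin_cos_eq_iff by metis
    then have "2 * pi * x = 2 * pi * (y + of_int k)" by (simp add: algebra_simps)
    then have "x = y + of_int k" by simp
    then show "\<exists>k::int. y = x + of_int k" by (intro exI[of _ "- k"]) simp
  next
    assume "\<exists>k::int. y = x + of_int k"
    then obtain k :: int where "y = x + of_int k" by blast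
    then have "e y = cis (2 * pi * x + 2 * pi * real_of_int k)" by (simp only: e_def distrib_left)
    also have "\<dots> = cis (2 * pi * x) * cis (2 * pi * real_of_int k)" by (simp only: cis_mult)
    also have "cis (2 * pi * real_of_int k) = 1" by (rule cis_multiple_2pi) simp
    finally show "e x = e y" by (simp only: e_def mult_1_right)
  qed
  have e_surj: "\<exists>x. z = e x" if "z \<in> sphere 0 1" for z
  proof -
    have "z = cis (Arg z)" using \<open>z \<in> sphere 0 1\<close> by (subst cis_Arg) (auto simp: sgn_div_norm)
    then have "z = e (Arg z / (2 * pi))" by (simp add: e_def)
    then show ?thesis by blast
  qed
  have e_in: "e x \<in> sphere 0 1" for x by (simp add: e_def)
  define f where "f p = (e (k1 p), e (k2 p), e (k3 p))" for p
  have ce: "continuous_on UNIV e" unfolding e_def by (intro continuous_intros)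
  have "continuous_on UNIV f" unfolding f_def
    by (intro continuous_on_Pair continuous_on_compose2[OF ce] cont) auto
  then have cf: "continuous_map euclidean manifold_G1 f"
    unfolding manifold_G1_def using e_in by (auto simp: continuous_map_in_subtopology f_def)
  have ff: "f p = f q \<longleftrightarrow> orbit_of (act ` K) p = orbit_of (act ` K) q" for p q
    unfolding f_def orb prod.inject e_eq by blast
  have ker: "f p = f q" if "p \<in> topspace euclidean" "q \<in> topspace euclidean"
    "orbit_of (act ` K) p = orbit_of (act ` K) q" for p q using that ff by blast
  obtain h where h0: "continuous_map (orbit_space (act ` K)) manifold_G1 h"
     "h ` topspace (orbit_space (act ` K)) = f ` topspace euclidean"
     "\<And>p. p \<in> topspace euclidean \<Longrightarrow> h (orbit_of (act ` K) p) = f p"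
    using quotient_map_lift_exists[OF quotient_map_orbit_space cf ker] by blast
  then have h: "continuous_map (orbit_space (act ` K)) manifold_G1 h"
     "h ` topspace (orbit_space (act ` K)) = f ` UNIV" "\<And>p. h (orbit_of (act ` K) p) = f p" by simp_all
  have "f ` UNIV = topspace manifold_G1"
  proof (intro equalityI subsetI)
    fix z assume "z \<in> topspace manifold_G1"
    then obtain z1 z2 z3 where z: "z = (z1, z2, z3)" "z1 \<in> sphere 0 1" "z2 \<in> sphere 0 1" "z3 \<in> sphere 0 1"
      by (auto simp: manifold_G1_def)
    obtain x1 x2 x3 where "z1 = e x1" "z2 = e x2" "z3 = e x3" using z e_surj by metis
    then have "z = f (P (x1, x2, x3))" using z(1) by (simp add: f_def QP)
    then show "z \<in> f ` UNIV" by blast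
  qed (use e_in in \<open>auto simp: manifold_G1_def f_def\<close>)
  then have hs: "h ` topspace (orbit_space (act ` K)) = topspace manifold_G1" using h(2) by simp
  have hi: "inj_on h (topspace (orbit_space (act ` K)))"
    unfolding topspace_orbit_space by (rule inj_onI) (use h(3) ff in auto)
  have "compact_space (orbit_space (act ` K))"
  proof -
    \<comment> \<open>The closed unit cube in these coordinates meets every orbit, by passing to
      fractional parts.\<close>
    let ?C = "P ` ({0..1} \<times> {0..1} \<times> {0..1})"
    have "compact ?C"
      by (intro compact_continuous_image continuous_on_subset[OF cP] compact_Times) auto
    then have "compactin (orbit_space (act ` K)) (orbit_of (act ` K) ` ?C)"
      using image_compactin[of euclidean ?C, OF _ deck_group.continuous_orbit_of[OF deck_group_act[OF S(1)]]] by simp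
    moreover have "orbit_of (act ` K) ` ?C = topspace (orbit_space (act ` K))"
    proof -
      have box: "\<exists>q\<in>?C. orbit_of (act ` K) p = orbit_of (act ` K) q" for p
      proof (rule bexI)
        show "P (frac (k1 p), frac (k2 p), frac (k3 p)) \<in> ?C"
          by (intro imageI) (auto intro: less_imp_le[OF frac_lt_1])
        show "orbit_of (act ` K) p = orbit_of (act ` K) (P (frac (k1 p), frac (k2 p), frac (k3 p)))"
          unfolding orb QP frac_def
          by (intro exI[of _ "- \<lfloor>k1 p\<rfloor>"] exI[of _ "- \<lfloor>k2 p\<rfloor>"] exI[of _ "- \<lfloor>k3 p\<rfloor>"])
            (simp only: of_int_minus diff_conv_add_uminus simp_thms)
      qed
      show ?thesis unfolding topspace_orbit_space
      proof (intro equalityI subsetI)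
        fix z assume "z \<in> range (orbit_of (act ` K))"
        then obtain p where p: "z = orbit_of (act ` K) p" by (rule rangeE)
        obtain q where q: "orbit_of (act ` K) p = orbit_of (act ` K) q" "q \<in> ?C" using box[of p] by (rule bexE)
        show "z \<in> orbit_of (act ` K) ` ?C" unfolding p q(1) by (rule imageI[OF q(2)])
      qed (erule imageE, simp only: rangeI)
    qed
    ultimately show ?thesis by (simp add: compact_space_def)
  qed
  moreover have "Hausdorff_space manifold_G1"
    unfolding manifold_G1_def by (intro Hausdorff_space_subtopology Hausdorff_space_euclidean)
  ultimately have "homeomorphic_map (orbit_space (act ` K)) manifold_G1 h"
    using continuous_imp_homeomorphic_map h(1) hs hi by blast
  then show ?thesis using homeomorphic_map_imp_homeomorphic_space by blast
qed

section \<open>Coverings and subgroups\<close>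

lemma subgroup_classes_iso:
  assumes G: "group G" and G': "group G'" and \<phi>: "\<phi> \<in> iso G G'"
  shows "card (subgroup_classes H G n) = card (subgroup_classes H G' n)"
    "finite (subgroup_classes H G n) \<Longrightarrow> finite (subgroup_classes H G' n)"
proof -
  interpret G: group G by fact
  interpret G': group G' by fact
  have hom: "\<phi> \<in> hom G G'" and bij: "bij_betw \<phi> (carrier G) (carrier G')"
    using \<phi> by (auto simp: iso_def)
  interpret h: group_hom G G' \<phi> using hom G G' by (simp add: group_hom_def group_hom_axioms_def)
  have inj: "inj_on \<phi> (carrier G)" using bij by (simp add: bij_betw_def)
  define R where "R = {(K, L). \<exists>g \<in> carrier G. L = g <#\<^bsub>G\<^esub> K #>\<^bsub>G\<^esub> inv\<^bsub>G\<^esub> g}"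
  define R' where "R' = {(K, L). \<exists>g \<in> carrier G'. L = g <#\<^bsub>G'\<^esub> K #>\<^bsub>G'\<^esub> inv\<^bsub>G'\<^esub> g}"
  define S where "S = {K. subgroup K G \<and> card (rcosets\<^bsub>G\<^esub> K) = n \<and> G\<lparr>carrier := K\<rparr> \<cong> H}"
  define S' where "S' = {K. subgroup K G' \<and> card (rcosets\<^bsub>G'\<^esub> K) = n \<and> G'\<lparr>carrier := K\<rparr> \<cong> H}"
  have idx: "card (rcosets\<^bsub>G'\<^esub> (\<phi> ` K)) = card (rcosets\<^bsub>G\<^esub> K)" if K: "K \<subseteq> carrier G" for K
  proof -
    have "\<phi> ` (K #>\<^bsub>G\<^esub> x) = \<phi> ` K #>\<^bsub>G'\<^esub> \<phi> x" if "x \<in> carrier G" for x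
      using K that unfolding r_coset_def by (auto simp: subset_iff image_iff)
    then have "(\<lambda>x. \<phi> ` K #>\<^bsub>G'\<^esub> \<phi> x) ` carrier G = (\<lambda>x. \<phi> ` (K #>\<^bsub>G\<^esub> x)) ` carrier G" by simp
    moreover have "carrier G' = \<phi> ` carrier G" using bij by (simp add: bij_betw_def)
    ultimately have "rcosets\<^bsub>G'\<^esub> (\<phi> ` K) = (`) \<phi> ` (rcosets\<^bsub>G\<^esub> K)"
      by (simp add: RCOSETS_def UNION_singleton_eq_range image_image)
    moreover have "inj_on ((`) \<phi>) (rcosets\<^bsub>G\<^esub> K)"
    proof (rule inj_onI)
      fix A B assume AB: "A \<in> rcosets\<^bsub>G\<^esub> K" "B \<in> rcosets\<^bsub>G\<^esub> K" "\<phi> ` A = \<phi> ` B"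
      then have "A \<subseteq> carrier G" "B \<subseteq> carrier G" using G.r_coset_subset_G[OF K] unfolding RCOSETS_def by blast+
      then show "A = B" using AB(3) inj by (simp add: inj_on_image_eq_iff)
    qed
    ultimately show ?thesis by (simp add: card_image)
  qed
  have resiso: "G\<lparr>carrier := K\<rparr> \<cong> G'\<lparr>carrier := \<phi> ` K\<rparr>" if K: "subgroup K G" for K
  proof -
    have "\<phi> \<in> iso (G\<lparr>carrier := K\<rparr>) (G'\<lparr>carrier := \<phi> ` K\<rparr>)"
      using subgroup.subset[OF K] inj by (auto simp: iso_def hom_def bij_betw_def inj_on_subset subset_iff)
    then show ?thesis by (rule is_isoI)
  qed
  have sg: "subgroup (\<phi> ` K) G'" if "subgroup K G" for K using h.subgroup_img_is_subgroup[OF that] .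
  have 1: "\<phi> ` K \<in> S'" if "K \<in> S" for K
  proof -
    have K: "subgroup K G" "G\<lparr>carrier := K\<rparr> \<cong> H" using that by (auto simp: S_def)
    have "G'\<lparr>carrier := \<phi> ` K\<rparr> \<cong> G\<lparr>carrier := K\<rparr>"
      using resiso[OF K(1)] G.subgroup_imp_group[OF K(1)] group.iso_sym by blast
    then have "G'\<lparr>carrier := \<phi> ` K\<rparr> \<cong> H" using K(2) iso_trans by blast
    then show ?thesis using that sg[OF K(1)] idx[OF subgroup.subset[OF K(1)]] by (simp add: S_def S'_def)
  qed
  have 2: "\<exists>K\<in>S. R' `` {L} = R' `` {\<phi> ` K}" if L: "L \<in> S'" for L
  proof -
    have L': "subgroup L G'" "card (rcosets\<^bsub>G'\<^esub> L) = n" "G'\<lparr>carrier := L\<rparr> \<cong> H" using L by (auto simp: S'_def)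
    define K where "K = inv_into (carrier G) \<phi> ` L"
    have \<psi>: "inv_into (carrier G) \<phi> \<in> iso G' G" using G.iso_set_sym[OF \<phi>] .
    then interpret k: group_hom G' G "inv_into (carrier G) \<phi>"
      using G G' by (simp add: group_hom_def group_hom_axioms_def iso_def)
    have K: "subgroup K G" unfolding K_def by (rule k.subgroup_img_is_subgroup[OF L'(1)])
    have "\<phi> ` K = (\<lambda>x. x) ` L" unfolding K_def image_image
      by (rule image_cong[OF HOL.refl]) (use subgroup.subset[OF L'(1)] bij in \<open>auto simp: bij_betw_def f_inv_into_f\<close>)
    then have KL: "\<phi> ` K = L" by simp
    have "K \<in> S" unfolding S_def
      using K idx[OF subgroup.subset[OF K]] resiso[OF K] L' iso_trans unfolding KL by auto
    then show ?thesis using KL by auto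
  qed
  have 3: "R `` {K} = R `` {L} \<longleftrightarrow> R' `` {\<phi> ` K} = R' `` {\<phi> ` L}" if "K \<in> S" "L \<in> S" for K L
  proof -
    have K: "K \<subseteq> carrier G" "L \<subseteq> carrier G" using that subgroup.subset by (auto simp: S_def)
    then have K': "\<phi> ` K \<subseteq> carrier G'" "\<phi> ` L \<subseteq> carrier G'" using bij by (auto simp: bij_betw_def)
    have im: "conj_set G' (\<phi> g) (\<phi> ` K) = \<phi> ` conj_set G g K" if "g \<in> carrier G" for g
      unfolding conj_set_def image_image
      by (rule image_cong[OF HOL.refl]) (use that K in auto)
    have cs: "conj_set G g K \<subseteq> carrier G" if "g \<in> carrier G" for g
      using that K by (auto simp: conj_set_def)
    have "(\<exists>g\<in>carrier G. L = conj_set G g K) \<longleftrightarrow> (\<exists>g\<in>carrier G. \<phi> ` L = \<phi> ` conj_set G g K)"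
      using inj_on_image_eq_iff[OF inj K(2) cs] by blast
    also have "\<dots> \<longleftrightarrow> (\<exists>g\<in>carrier G'. \<phi> ` L = conj_set G' g (\<phi> ` K))"
    proof
      assume "\<exists>g\<in>carrier G. \<phi> ` L = \<phi> ` conj_set G g K"
      then obtain g where g: "g \<in> carrier G" "\<phi> ` L = \<phi> ` conj_set G g K" by (rule bexE)
      show "\<exists>g\<in>carrier G'. \<phi> ` L = conj_set G' g (\<phi> ` K)"
        by (rule bexI[of _ "\<phi> g"]) (use g im[OF g(1)] in simp_all)
    next
      assume "\<exists>g\<in>carrier G'. \<phi> ` L = conj_set G' g (\<phi> ` K)"
      then obtain g' where g': "\<phi> ` L = conj_set G' g' (\<phi> ` K)" "g' \<in> carrier G'" by (rule bexE)
      have "g' \<in> \<phi> ` carrier G" using g'(2) bij by (simp add: bij_betw_def)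
      then obtain g where g: "g' = \<phi> g" "g \<in> carrier G" by (rule imageE)
      show "\<exists>g\<in>carrier G. \<phi> ` L = \<phi> ` conj_set G g K"
        by (rule bexI[OF _ g(2)]) (simp only: g'(1) g(1) im[OF g(2)])
    qed
    finally show ?thesis
      unfolding R_def R'_def G.conj_class_eq_iff[OF K] G'.conj_class_eq_iff[OF K'] .
  qed
  have "subgroup_classes H G n = S // R" "subgroup_classes H G' n = S' // R'"
    by (simp_all add: subgroup_classes_def S_def S'_def R_def R'_def)
  then show "card (subgroup_classes H G n) = card (subgroup_classes H G' n)"
    "finite (subgroup_classes H G n) \<Longrightarrow> finite (subgroup_classes H G' n)"
    using quotient_transfer[of S "(`) \<phi>" S' R' R, OF 1 2 3] by simp_all
qed

section \<open>Isomorphism types of the subgroups\<close>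

lemma iso_commute:
  assumes "group G" "G \<cong> H" "\<And>x y. x \<in> carrier H \<Longrightarrow> y \<in> carrier H \<Longrightarrow> x \<otimes>\<^bsub>H\<^esub> y = y \<otimes>\<^bsub>H\<^esub> x"
    and xy: "x \<in> carrier G" "y \<in> carrier G"
  shows "x \<otimes>\<^bsub>G\<^esub> y = y \<otimes>\<^bsub>G\<^esub> x"
proof -
  interpret group G by fact
  obtain \<phi> where \<phi>: "\<phi> \<in> hom G H" "inj_on \<phi> (carrier G)" using assms(2) by (auto simp: is_iso_def iso_def bij_betw_def)
  have "\<phi> (x \<otimes>\<^bsub>G\<^esub> y) = \<phi> (y \<otimes>\<^bsub>G\<^esub> x)"
    using assms(3) xy \<phi>(1) by (simp add: hom_mult hom_in_carrier)
  then show ?thesis using \<phi>(2) xy by (auto dest: inj_onD)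
qed

lemma EG_not_commute: "\<not> (\<forall>x\<in>carrier EG. \<forall>y\<in>carrier EG. x \<otimes>\<^bsub>EG\<^esub> y = y \<otimes>\<^bsub>EG\<^esub> x)"
proof
  assume "\<forall>x\<in>carrier EG. \<forall>y\<in>carrier EG. x \<otimes>\<^bsub>EG\<^esub> y = y \<otimes>\<^bsub>EG\<^esub> x"
  then have "(0, 1) \<otimes>\<^bsub>EG\<^esub> (1, 0) = (1, 0) \<otimes>\<^bsub>EG\<^esub> (0, 1)" by (elim ballE[where x = "(0, 1)"] ballE[where x = "(1, 0)"]) simp_all
  then show False by simp
qed

lemma EG_iso_pi1: "EG \<cong> pi1_G3" using of_EG_iso by (rule is_isoI)

lemma IndexSub_cases: "IndexSub n = TransSub n \<union> ScrewSub n" by (auto simp: TransSub_def ScrewSub_def)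

text \<open>Subgroups with a screw motion are isomorphic to the whole group by
  \<open>ScrewSub_model\<close>; the others are commutative, and the whole group is not.\<close>

lemma IndexSub_iso_pi1_G3:
  assumes n: "n > 0"
  shows "{K. subgroup K EG \<and> card (rcosets\<^bsub>EG\<^esub> K) = n \<and> EG\<lparr>carrier := K\<rparr> \<cong> pi1_G3} = ScrewSub n"
proof -
  have "EG\<lparr>carrier := K\<rparr> \<cong> pi1_G3" if K: "K \<in> ScrewSub n" for K
  proof -
    have S: "subgroup K EG" using IndexSubD[OF n] K by (auto simp: ScrewSub_def)
    have "EG \<cong> EG\<lparr>carrier := K\<rparr>" using ScrewSub_model[OF n K] by blast
    then show ?thesis using EG.iso_sym EG_iso_pi1 iso_trans by blast
  qed
  moreover have "\<not> EG\<lparr>carrier := K\<rparr> \<cong> pi1_G3" if K: "K \<in> TransSub n" for K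
  proof
    have S: "subgroup K EG" using IndexSubD[OF n] K by (auto simp: TransSub_def)
    assume "EG\<lparr>carrier := K\<rparr> \<cong> pi1_G3"
    then have "pi1_G3 \<cong> EG\<lparr>carrier := K\<rparr>" using group.iso_sym EG.subgroup_imp_group[OF S] by blast
    then have "EG \<cong> EG\<lparr>carrier := K\<rparr>" using EG_iso_pi1 iso_trans by blast
    then have "x \<otimes>\<^bsub>EG\<^esub> y = y \<otimes>\<^bsub>EG\<^esub> x" if "x \<in> carrier EG" "y \<in> carrier EG" for x y
      by (rule iso_commute[OF group_EG]) (use TransSub_commute[OF n K] that in auto)
    then show False using EG_not_commute by blast
  qed
  ultimately show ?thesis using IndexSub_cases[of n] by (auto simp: IndexSub_def)
qed

lemma IndexSub_iso_int_cubed: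
  assumes n: "n > 0"
  shows "{K. subgroup K EG \<and> card (rcosets\<^bsub>EG\<^esub> K) = n \<and> EG\<lparr>carrier := K\<rparr> \<cong> int_cubed} = TransSub n"
proof -
  have "\<not> EG\<lparr>carrier := K\<rparr> \<cong> int_cubed" if K: "K \<in> ScrewSub n" for K
  proof
    assume "EG\<lparr>carrier := K\<rparr> \<cong> int_cubed"
    moreover have "EG \<cong> EG\<lparr>carrier := K\<rparr>" using ScrewSub_model[OF n K] by blast
    ultimately have i: "EG \<cong> int_cubed" using iso_trans by blast
    have "x \<otimes>\<^bsub>EG\<^esub> y = y \<otimes>\<^bsub>EG\<^esub> x" if "x \<in> carrier EG" "y \<in> carrier EG" for x y
      by (rule iso_commute[OF group_EG i _ that]) (auto simp: int_cubed_def)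
    then show False using EG_not_commute by blast
  qed
  then show ?thesis using IndexSub_cases[of n] TransSub_iso[OF n] by (auto simp: IndexSub_def)
qed

lemma subgroup_classes_EG:
  assumes "n > 0"
  shows "subgroup_classes pi1_G3 EG n = ScrewSub n // conj_rel"
    "subgroup_classes int_cubed EG n = TransSub n // conj_rel"
  unfolding subgroup_classes_def IndexSub_iso_pi1_G3[OF assms] IndexSub_iso_int_cubed[OF assms] conj_rel_eq by simp_all

section \<open>Equivalence classes of coverings\<close>

lemma equivalent_coverings_trans:
  assumes "equivalent_coverings a b" "equivalent_coverings b c"
  shows "equivalent_coverings a c"
proof -
  obtain h k where h: "homeomorphic_map (fst a) (fst b) h" "\<And>y. y \<in> topspace (fst a) \<Longrightarrow> snd a y = snd b (h y)"
    and k: "homeomorphic_map (fst b) (fst c) k" "\<And>y. y \<in> topspace (fst b) \<Longrightarrow> snd b y = snd c (k y)"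
    using assms by (auto simp: equivalent_coverings_def)
  have "homeomorphic_map (fst a) (fst c) (k \<circ> h)" using h(1) k(1) by (rule homeomorphic_map_compose)
  moreover have "snd a y = snd c ((k \<circ> h) y)" if "y \<in> topspace (fst a)" for y
  proof -
    have "h y \<in> topspace (fst b)" using that homeomorphic_imp_surjective_map[OF h(1)] by blast
    then show ?thesis using h(2)[OF that] k(2) by simp
  qed
  ultimately show ?thesis unfolding equivalent_coverings_def by blast
qed

lemma equivalent_coverings_sym:
  assumes "equivalent_coverings a b"
  shows "equivalent_coverings b a"
proof -
  obtain h where h: "homeomorphic_map (fst a) (fst b) h" "\<And>y. y \<in> topspace (fst a) \<Longrightarrow> snd a y = snd b (h y)"
    using assms by (auto simp: equivalent_coverings_def)
  obtain k where k: "homeomorphic_maps (fst a) (fst b) h k" using h(1) homeomorphic_map_maps by blast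
  then have "homeomorphic_map (fst b) (fst a) k" using homeomorphic_maps_sym homeomorphic_map_maps by blast
  moreover have "snd b y = snd a (k y)" if "y \<in> topspace (fst b)" for y
  proof -
    have "h (k y) = y" "k y \<in> topspace (fst a)"
      using k that by (auto simp: homeomorphic_maps_def continuous_map_def)
    then show ?thesis using h(2) by metis
  qed
  ultimately show ?thesis unfolding equivalent_coverings_def by blast
qed

lemma equivalent_coverings_refl: "equivalent_coverings a a"
  unfolding equivalent_coverings_def using homeomorphic_map_id by (intro exI[of _ id]) auto

lemma equivalent_class_eq_iff:
  fixes a b :: "'a topology \<times> ('a \<Rightarrow> 'b)"
  shows "({(c1, c2). equivalent_coverings c1 c2} :: ('a topology \<times> ('a \<Rightarrow> 'b)) rel) `` {a} =
      {(c1, c2). equivalent_coverings c1 c2} `` {b} \<longleftrightarrow> equivalent_coverings a b"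
    (is "?R `` _ = _ \<longleftrightarrow> _")
proof
  assume "?R `` {a} = ?R `` {b}"
  then have "equivalent_coverings a c \<longleftrightarrow> equivalent_coverings b c" for c :: "'a topology \<times> ('a \<Rightarrow> 'b)"
    by (cases c) (simp add: set_eq_iff)
  then show "equivalent_coverings a b" using equivalent_coverings_refl by metis
next
  assume "equivalent_coverings a b"
  then show "?R `` {a} = ?R `` {b}"
    using equivalent_coverings_sym equivalent_coverings_trans by blast
qed

abbreviation "deckG3 \<equiv> act ` carrier EG"

interpretation D: deck_group deckG3
  by (rule deck_group_act[OF subgroup_carrier_EG])

definition cov_of :: "(complex \<times> int) set \<Rightarrow> E3 set topology \<times> (E3 set \<Rightarrow> E3 set)" where
  "cov_of K = (orbit_space (act ` K), orbit_down deckG3)"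

lemma act_image_subset: "subgroup K EG \<Longrightarrow> act ` K \<subseteq> deckG3"
  using subgroup.subset by blast

lemma card_fibre_cov_of:
  assumes K: "subgroup K EG" and z: "z \<in> topspace manifold_G3"
  shows "card {y \<in> topspace (orbit_space (act ` K)). orbit_down deckG3 y = z} = card (rcosets\<^bsub>EG\<^esub> K)"
proof -
  obtain x where "z = orbit_of deckG3 x" using z by (auto simp: manifold_G3_eq topspace_orbit_space)
  then show ?thesis
    using D.card_fibre_orbit_down[OF deck_group_act[OF K] act_image_subset[OF K], of x] card_rcosets_act[OF K] by simp
qed

lemma connected_covering_cov_of:
  assumes K: "K \<in> IndexSub n"
  shows "connected_covering n (orbit_space (act ` K)) manifold_G3 (orbit_down deckG3)"
proof -
  have S: "subgroup K EG" "card (rcosets\<^bsub>EG\<^esub> K) = n" using K by (auto simp: IndexSub_def)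
  have "connected_space (orbit_space (act ` K))"
    by (rule deck_group.connected_orbit_space[OF deck_group_act[OF S(1)]])
  moreover have "covering_map (orbit_space (act ` K)) manifold_G3 (orbit_down deckG3)"
    unfolding manifold_G3_eq by (rule D.covering_map_orbit_down[OF deck_group_act[OF S(1)] act_image_subset[OF S(1)]])
  ultimately show ?thesis
    unfolding connected_covering_def using card_fibre_cov_of[OF S(1)] S(2) by blast
qed

text \<open>The group of maps supplied by \<open>D.covering_map_classification\<close> is pulled
  back along \<open>act\<close> to a subgroup of \<open>EG\<close>, whose index is read off the
  fibre over the orbit of the origin.\<close>

lemma connected_covering_classification:
  assumes c: "connected_covering n N manifold_G3 p"
  obtains K where "K \<in> IndexSub n" "equivalent_coverings (N, p) (cov_of K)"
proof -
  have cc: "covering_map N (orbit_space deckG3) p" "connected_space N"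
    using c by (auto simp: connected_covering_def manifold_G3_eq)
  obtain K0 h where K0: "K0 \<subseteq> deckG3" "deck_group K0" and h: "homeomorphic_map N (orbit_space K0) h"
    "\<And>y. y \<in> topspace N \<Longrightarrow> p y = orbit_down deckG3 (h y)"
    using D.covering_map_classification[OF cc] by blast
  interpret K0: deck_group K0 by fact
  define K where "K = {x \<in> carrier EG. act x \<in> K0}"
  have aK: "act ` K = K0" using K0(1) by (auto simp: K_def)
  have S: "subgroup K EG"
  proof (rule EG.subgroupI)
    show "K \<noteq> {}" using aK K0.id_mem by auto
    fix x assume x: "x \<in> K"
    then have xc: "x \<in> carrier EG" "act x \<in> K0" by (auto simp: K_def)
    obtain k where k: "k \<in> K0" "act x \<circ> k = id" "k \<circ> act x = id" using K0.inverse_ex[OF xc(2)] by blast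
    have "act (inv\<^bsub>EG\<^esub> x) = act (inv\<^bsub>EG\<^esub> x) \<circ> (act x \<circ> k)" using k(2) by simp
    also have "\<dots> = k" using act_inv[OF xc(1)] by (metis comp_assoc id_comp)
    finally show "inv\<^bsub>EG\<^esub> x \<in> K" using k(1) EG.inv_closed[OF xc(1)] by (simp only: K_def mem_Collect_eq simp_thms)
    fix y assume "y \<in> K"
    then have yc: "y \<in> carrier EG" "act y \<in> K0" by (auto simp: K_def)
    show "x \<otimes>\<^bsub>EG\<^esub> y \<in> K"
      using K0.comp_mem[OF xc(2) yc(2)] EG.m_closed[OF xc(1) yc(1)]
      by (simp only: K_def mem_Collect_eq act_mult simp_thms)
  qed (auto simp: K_def)
  have eq: "equivalent_coverings (N, p) (cov_of K)"
    using h unfolding equivalent_coverings_def cov_of_def aK by auto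
  have z: "orbit_of deckG3 0 \<in> topspace manifold_G3" by (simp add: manifold_G3_eq topspace_orbit_space)
  let ?F = "{y \<in> topspace N. p y = orbit_of deckG3 0}"
  let ?F' = "{y \<in> topspace (orbit_space K0). orbit_down deckG3 y = orbit_of deckG3 0}"
  have "h ` ?F = ?F'"
  proof (intro Set.set_eqI iffI)
    fix y assume "y \<in> h ` ?F"
    then show "y \<in> ?F'" using h(2) homeomorphic_imp_surjective_map[OF h(1)] by auto
  next
    fix y assume y: "y \<in> ?F'"
    then have "y \<in> h ` topspace N" using homeomorphic_imp_surjective_map[OF h(1)] by simp
    then obtain y' where "y' \<in> topspace N" "y = h y'" by blast
    then show "y \<in> h ` ?F" using y h(2) by auto
  qed
  moreover have "inj_on h ?F" using homeomorphic_imp_injective_map[OF h(1)] by (rule inj_on_subset) auto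
  ultimately have "card ?F' = card ?F" using card_image[of h ?F] by simp
  moreover have "card ?F = n" using c z by (auto simp: connected_covering_def)
  ultimately have "K \<in> IndexSub n" using card_fibre_cov_of[OF S z] S aK by (simp add: IndexSub_def)
  then show ?thesis using that eq by blast
qed

lemma cov_of_equivalent_iff:
  assumes K: "subgroup K EG" and L: "subgroup L EG"
  shows "equivalent_coverings (cov_of K) (cov_of L) \<longleftrightarrow> (\<exists>g\<in>carrier EG. L = conjEG g K)"
proof -
  have iv: "inv_into UNIV (act g) = act (inv\<^bsub>EG\<^esub> g)" if "g \<in> carrier EG" for g
    using act_inv[OF that] by (metis inv_unique_comp)
  have "equivalent_coverings (cov_of K) (cov_of L) \<longleftrightarrow> (\<exists>g\<in>deckG3. act ` L = (\<lambda>k. g \<circ> k \<circ> inv_into UNIV g) ` act ` K)"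
    unfolding cov_of_def using D.equivalent_coverings_orbit_iff[OF deck_group_act[OF K] act_image_subset[OF K]
      deck_group_act[OF L] act_image_subset[OF L]] .
  also have "\<dots> \<longleftrightarrow> (\<exists>g\<in>carrier EG. act ` L = (\<lambda>k. act g \<circ> k \<circ> inv_into UNIV (act g)) ` act ` K)" by blast
  also have "\<dots> \<longleftrightarrow> (\<exists>g\<in>carrier EG. act ` L = act ` conjEG g K)"
    by (intro bex_cong HOL.refl) (simp only: iv conj_set_def image_image act_mult)
  also have "\<dots> \<longleftrightarrow> (\<exists>g\<in>carrier EG. L = conjEG g K)"
    using inj_image_eq_iff[of act] act_inj by (simp add: inj_def)
  finally show ?thesis .
qed

text \<open>Here \<open>T\<close> stands for the family of subgroups whose orbit spaces are
  homeomorphic to \<open>F\<close>, so one argument serves both types of total space.\<close>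

lemma covering_classes_card:
  assumes n: "n > 0"
    and T: "\<And>K. K \<in> IndexSub n \<Longrightarrow> orbit_space (act ` K) homeomorphic_space F \<longleftrightarrow> K \<in> T" "T \<subseteq> IndexSub n"
  shows "card (T // conj_rel) = card (covering_classes n F manifold_G3 :: (E3 set topology \<times> (E3 set \<Rightarrow> E3 set)) set set)"
    "finite (T // conj_rel) \<Longrightarrow> finite (covering_classes n F manifold_G3 :: (E3 set topology \<times> (E3 set \<Rightarrow> E3 set)) set set)"
proof -
  let ?R = "{(c1, c2). equivalent_coverings c1 c2} :: (E3 set topology \<times> (E3 set \<Rightarrow> E3 set)) rel"
  let ?S = "{(N, p). connected_covering n N manifold_G3 p \<and> N homeomorphic_space F} :: (E3 set topology \<times> (E3 set \<Rightarrow> E3 set)) set"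
  have 1: "cov_of K \<in> ?S" if "K \<in> T" for K
    using connected_covering_cov_of T that by (auto simp: cov_of_def)
  have 2: "\<exists>K\<in>T. ?R `` {c} = ?R `` {cov_of K}" if cS: "c \<in> ?S" for c
  proof -
    obtain N p where c: "c = (N, p)" "connected_covering n N manifold_G3 p" "N homeomorphic_space F" using cS by auto
    obtain K where K: "K \<in> IndexSub n" "equivalent_coverings (N, p) (cov_of K)"
      using connected_covering_classification[OF c(2)] .
    have "N homeomorphic_space orbit_space (act ` K)"
      using K(2) homeomorphic_map_imp_homeomorphic_space by (auto simp: equivalent_coverings_def cov_of_def)
    then have "orbit_space (act ` K) homeomorphic_space F"
      using c(3) homeomorphic_space_sym homeomorphic_space_trans by blast
    then have "K \<in> T" using T K(1) by blast
    then show ?thesis using K(2) c(1) equivalent_class_eq_iff by blast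
  qed
  have 3: "conj_rel `` {K} = conj_rel `` {L} \<longleftrightarrow> ?R `` {cov_of K} = ?R `` {cov_of L}" if "K \<in> T" "L \<in> T" for K L
  proof -
    have "subgroup K EG" "subgroup L EG" using that T(2) by (auto simp: IndexSub_def)
    then show ?thesis unfolding equivalent_class_eq_iff using conj_rel_class_eq_iff cov_of_equivalent_iff by simp
  qed
  show "card (T // conj_rel) = card (covering_classes n F manifold_G3 :: (E3 set topology \<times> (E3 set \<Rightarrow> E3 set)) set set)"
    "finite (T // conj_rel) \<Longrightarrow> finite (covering_classes n F manifold_G3 :: (E3 set topology \<times> (E3 set \<Rightarrow> E3 set)) set set)"
    unfolding covering_classes_def using quotient_transfer[of T cov_of ?S ?R conj_rel, OF 1 2 3] by simp_all
qed

text \<open>A homeomorphism would transfer commutativity of the translation subgroup to the whole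
  deck group, by \<open>homeomorphic_orbit_spaces_commute\<close>.\<close>

lemma TransSub_not_G3:
  assumes n: "n > 0" and K: "K \<in> TransSub n"
  shows "\<not> orbit_space (act ` K) homeomorphic_space manifold_G3"
proof
  assume h: "orbit_space (act ` K) homeomorphic_space manifold_G3"
  have S: "subgroup K EG" using IndexSubD[OF n] K by (auto simp: TransSub_def)
  have "act x \<circ> act y = act y \<circ> act x" if "x \<in> carrier EG" "y \<in> carrier EG" for x y
  proof (rule homeomorphic_orbit_spaces_commute[OF deck_group_act[OF S] deck_group_act[OF subgroup_carrier_EG]
      h[unfolded manifold_G3_eq]])
    fix k l assume "k \<in> act ` K" "l \<in> act ` K"
    then show "k \<circ> l = l \<circ> k" using TransSub_commute[OF n K] act_mult by (metis (no_types, lifting) imageE)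
  qed (use that in auto)
  then have "x \<otimes>\<^bsub>EG\<^esub> y = y \<otimes>\<^bsub>EG\<^esub> x" if "x \<in> carrier EG" "y \<in> carrier EG" for x y
    using that unfolding act_mult[symmetric] act_inj by blast
  then show False using EG_not_commute by blast
qed

text \<open>The torus is realised as the orbit space of one translation subgroup, that of height 3
  with the full lattice, to which \<open>TransSub_not_G3\<close> applies.\<close>

lemma G1_not_G3: "\<not> manifold_G1 homeomorphic_space manifold_G3"
proof -
  have "hnf 1 1 0 \<in> Lat 1" using sublattice_hnf card_cosets_hnf[of 1 1 0] by (simp add: Lat_def)
  moreover have "(+) 0 ` hnf 1 1 0 \<in> cosets (hnf 1 1 0)" unfolding cosets_def by (rule imageI) simp
  ultimately obtain K where K: "K \<in> IndexSub 3" "params K = (3, hnf 1 1 0, (+) 0 ` hnf 1 1 0)"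
    using params_surj[of 3 3 "hnf 1 1 0"] by auto
  then have A: "K \<in> TransSub 3" by (simp add: TransSub_def params_def)
  have "orbit_space (act ` K) homeomorphic_space manifold_G1" by (rule TransSub_homeomorphic[OF _ A]) simp
  moreover have "\<not> orbit_space (act ` K) homeomorphic_space manifold_G3" by (rule TransSub_not_G3[OF _ A]) simp
  ultimately show ?thesis using homeomorphic_space_trans by blast
qed

lemma orbit_space_type:
  assumes n: "n > 0" and K: "K \<in> IndexSub n"
  shows "orbit_space (act ` K) homeomorphic_space manifold_G3 \<longleftrightarrow> K \<in> ScrewSub n"
    "orbit_space (act ` K) homeomorphic_space manifold_G1 \<longleftrightarrow> K \<in> TransSub n"
proof -
  have "K \<in> TransSub n \<or> K \<in> ScrewSub n" "\<not> (K \<in> TransSub n \<and> K \<in> ScrewSub n)" using K by (auto simp: TransSub_def ScrewSub_def)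
  then show "orbit_space (act ` K) homeomorphic_space manifold_G3 \<longleftrightarrow> K \<in> ScrewSub n"
    "orbit_space (act ` K) homeomorphic_space manifold_G1 \<longleftrightarrow> K \<in> TransSub n"
    using TransSub_not_G3[OF n] TransSub_homeomorphic[OF n] ScrewSub_homeomorphic[OF n] G1_not_G3
      homeomorphic_space_trans homeomorphic_space_sym by blast+
qed

theorem theorem2:
  fixes n :: nat
  assumes "n > 0"
  shows
    "(\<not> 3 dvd n \<longrightarrow>
        (\<forall>(N :: 'a topology) p. connected_covering n N manifold_G3 p \<longrightarrow>
           N homeomorphic_space manifold_G3)) \<and>
     (3 dvd n \<longrightarrow>
        (\<forall>(N :: 'a topology) p. connected_covering n N manifold_G3 p \<longrightarrow>
           N homeomorphic_space manifold_G3 \<or> N homeomorphic_space manifold_G1)) \<and>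
     \<comment> \<open>up to equivalence, total spaces on the point type of \<open>manifold_G3\<close> suffice\<close>
     (\<forall>(N :: 'a topology) p. connected_covering n N manifold_G3 p \<longrightarrow>
        (\<exists>(N' :: E3 set topology) p'. connected_covering n N' manifold_G3 p' \<and>
           equivalent_coverings (N, p) (N', p'))) \<and>
     finite (covering_classes n manifold_G3 manifold_G3
               :: (E3 set topology \<times> (E3 set \<Rightarrow> E3 set)) set set) \<and>
     finite (covering_classes n manifold_G1 manifold_G3
               :: (E3 set topology \<times> (E3 set \<Rightarrow> E3 set)) set set) \<and>
     finite (subgroup_classes pi1_G3 pi1_G3 n) \<and>
     finite (subgroup_classes int_cubed pi1_G3 n) \<and>
     card (covering_classes n manifold_G3 manifold_G3
             :: (E3 set topology \<times> (E3 set \<Rightarrow> E3 set)) set set)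
       = num_subgroup_classes pi1_G3 pi1_G3 n \<and>
     card (covering_classes n manifold_G1 manifold_G3
             :: (E3 set topology \<times> (E3 set \<Rightarrow> E3 set)) set set)
       = num_subgroup_classes int_cubed pi1_G3 n \<and>
     of_nat (num_subgroup_classes pi1_G3 pi1_G3 n)
       = (\<Sum>k \<in> pos_divisors (of_nat n). theta (of_nat k))
         + (\<Sum>k \<in> pos_divisors (of_nat n / 3). theta (of_nat k))
         - 2 * (\<Sum>k \<in> pos_divisors (of_nat n / 9). theta (of_nat k)) \<and>
     of_nat (num_subgroup_classes int_cubed pi1_G3 n)
       = 1 / 3 * (omega (of_nat n / 3)
         + 2 * (\<Sum>k \<in> pos_divisors (of_nat n / 3). theta (of_nat k))
         + 4 * (\<Sum>k \<in> pos_divisors (of_nat n / 9). theta (of_nat k)))"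
proof -
  note cl = subgroup_classes_EG[OF assms]
  note ti = subgroup_classes_iso[OF group_EG group_pi1_G3 of_EG_iso, of _ n]
  note fin = card_TransSub_classes(2)[OF assms] card_ScrewSub_classes(2)[OF assms]
  have nB: "num_subgroup_classes pi1_G3 pi1_G3 n = card (ScrewSub n // conj_rel)"
    using ti(1)[of pi1_G3] cl(1) by (simp add: num_subgroup_classes_def)
  have nA: "num_subgroup_classes int_cubed pi1_G3 n = card (TransSub n // conj_rel)"
    using ti(1)[of int_cubed] cl(2) by (simp add: num_subgroup_classes_def)
  have fB: "finite (subgroup_classes pi1_G3 pi1_G3 n)" using ti(2)[of pi1_G3] cl(1) fin by simp
  have fA: "finite (subgroup_classes int_cubed pi1_G3 n)" using ti(2)[of int_cubed] cl(2) fin by simp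
  have sub: "TransSub n \<subseteq> IndexSub n" "ScrewSub n \<subseteq> IndexSub n" by (auto simp: TransSub_def ScrewSub_def)
  have cB: "card (ScrewSub n // conj_rel) = card (covering_classes n manifold_G3 manifold_G3 :: (E3 set topology \<times> (E3 set \<Rightarrow> E3 set)) set set)"
    "finite (covering_classes n manifold_G3 manifold_G3 :: (E3 set topology \<times> (E3 set \<Rightarrow> E3 set)) set set)"
    by (rule covering_classes_card[OF assms]; use orbit_space_type(1)[OF assms] sub(2) fin(2) in auto)+
  have cA: "card (TransSub n // conj_rel) = card (covering_classes n manifold_G1 manifold_G3 :: (E3 set topology \<times> (E3 set \<Rightarrow> E3 set)) set set)"
    "finite (covering_classes n manifold_G1 manifold_G3 :: (E3 set topology \<times> (E3 set \<Rightarrow> E3 set)) set set)"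
    by (rule covering_classes_card[OF assms]; use orbit_space_type(2)[OF assms] sub(1) fin(1) in auto)+
  have kind: "N homeomorphic_space manifold_G3 \<or> 3 dvd n \<and> N homeomorphic_space manifold_G1"
    and cov: "\<exists>(N' :: E3 set topology) p'. connected_covering n N' manifold_G3 p' \<and> equivalent_coverings (N, p) (N', p')"
    if c: "connected_covering n N manifold_G3 p" for N :: "'a topology" and p
  proof -
    obtain K where K: "K \<in> IndexSub n" "equivalent_coverings (N, p) (cov_of K)"
      using connected_covering_classification[OF c] .
    show "\<exists>(N' :: E3 set topology) p'. connected_covering n N' manifold_G3 p' \<and> equivalent_coverings (N, p) (N', p')"
      using connected_covering_cov_of[OF K(1)] K(2) unfolding cov_of_def by blast
    have h: "N homeomorphic_space orbit_space (act ` K)"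
      using K(2) homeomorphic_map_imp_homeomorphic_space by (auto simp: equivalent_coverings_def cov_of_def)
    show "N homeomorphic_space manifold_G3 \<or> 3 dvd n \<and> N homeomorphic_space manifold_G1"
    proof (cases "3 dvd height K")
      case True
      then have "K \<in> TransSub n" using K(1) by (simp add: TransSub_def)
      \<comment> \<open>The height divides the index, so a torus can occur only if 3 divides
        \<open>n\<close>.\<close>
      moreover have "3 dvd n" using True IndexSubD(5)[OF assms K(1)] dvd_trans by blast
      ultimately show ?thesis using h homeomorphic_space_trans TransSub_homeomorphic[OF assms] by blast
    next
      case False
      then have "K \<in> ScrewSub n" using K(1) by (simp add: ScrewSub_def)
      then show ?thesis using h homeomorphic_space_trans ScrewSub_homeomorphic[OF assms] by blast
    qed
  qed
  show ?thesis
    using kind cov cA(2) cB(2) fA fB cA(1) cB(1)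
      card_TransSub_classes_formula[OF assms] card_ScrewSub_classes_formula[OF assms]
    unfolding nA nB by auto
qed

end
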